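(* Let $\mathfrak{M} = M(X,\mathfrak{a})^\Gamma$ be the equivariant map algebra associated to an affine scheme $X=\operatorname{Spec} A$ over $k$, a finite-dimensional unital associative $k$-algebra $\mathfrak{a}$, and a finite group $\Gamma$ acting on $X$ and on $\mathfrak{a}$ by automorphisms. Let $\mathcal{S}$ be the set of isomorphism classes of irreducible finite-dimensional representations of $\mathfrak{M}$ (including the class of the zero-dimensional representation). Then the map $$\operatorname{ev}^\Gamma : \mathcal{E}^\Gamma_{\mathrm{single}} \to \mathcal{S},\qquad \psi\mapsto \operatorname{ev}^\Gamma_\psi,$$ is a bijection. In other words, $\mathcal{E}^\Gamma_{\mathrm{single}}$ enumerates the isomorphism classes of irreducible finite-dimensional representations of $\mathfrak{M}$.
   Context: $k$ is an algebraically closed field of arbitrary characteristic; tensor products are over $k$. $A$ is a commutative associative unital $k$-algebra (not necessarily finitely generated) and $X=\operatorname{Spec} A$. $\Gamma$ is a finite group whose order is not divisible by the characteristic of $k$ (no condition in characteristic zero). $\Gamma$ acts on the scheme $X$, equivalently on the $k$-algebra $A$, by automorphisms, and on the finite-dimensional unital associative $k$-algebra $\mathfrak{a}$ by algebra automorphisms. A point $x\in X$ is $k$-rational if $A/\mathsf{m}_x\cong k$, where $\mathsf{m}_x$ is the ideal of $A$ corresponding to $x$; $X_{\mathrm{rat}}$ is the set of $k$-rational points. The map algebra is $M(X,\mathfrak{a})=\mathfrak{a}\otimes A$ with product $(\mathtt{a}_1\otimes a_1)(\mathtt{a}_2\otimes a_2)=(\mathtt{a}_1\mathtt{a}_2)\otimes(a_1a_2)$,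 viewed as a $k$-algebra. $\Gamma$ acts on it by $\gamma\cdot(\mathtt{a}\otimes a)=(\gamma\cdot\mathtt{a})\otimes(\gamma\cdot a)$, and $\mathfrak{M}=M(X,\mathfrak{a})^\Gamma=(\mathfrak{a}\otimes A)^\Gamma$ is the fixed-point subalgebra, equivalently the algebra of $\Gamma$-equivariant regular maps $X\to\mathfrak{a}$. It is an associative unital $k$-algebra. For $x\in X_{\mathrm{rat}}$, let $\Gamma_x=\{\gamma\in\Gamma:\gamma\cdot x=x\}$ and $\mathfrak{a}^x=\{\mathtt{a}\in\mathfrak{a}:\gamma\cdot\mathtt{a}=\mathtt{a}\text{ for all }\gamma\in\Gamma_x\}$. The evaluation map $\operatorname{ev}_x:\mathfrak{M}\to\mathfrak{a}^x$, $\alpha\mapsto\alpha(x)$, is the restriction to $\mathfrak{M}$ of the map $\mathfrak{a}\otimes A\to\mathfrak{a}\otimes (A/\mathsf{m}_x)\cong\mathfrak{a}$; it is a surjective algebra homomorphism onto $\mathfrak{a}^x$. A representation of an associative algebra $B$ is an algebra homomorphism $B\to\operatorname{End}_k V$, for $V$ a $k$-vector space; algebra homomorphisms between unital algebras are understood to preserve the unit. By convention, the zero-dimensional representation is regarded as an irreducible representation. For $x\in X_{\mathrm{rat}}$, $\mathcal{R}_x$ is the set of isomorphism classes of irreducible finite-dimensional representations of $\mathfrak{a}^x$, with $0\in\mathcal{R}_x$ denoting the class of the zero-dimensional representation. Put $\mathcal{R}_X=\bigsqcup_{x\in X_{\mathrm{rat}}}\mathcal{R}_x$ (disjoint union). $\Gamma$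 acts on $\mathcal{R}_X$ by $\gamma\cdot[\rho]=[\rho\circ\gamma^{-1}]\in\mathcal{R}_{\gamma\cdot x}$ for $[\rho]\in\mathcal{R}_x$ (where $\gamma^{-1}$ maps $\mathfrak{a}^{\gamma\cdot x}$ to $\mathfrak{a}^x$). For $[\rho]\in\mathcal{R}_x$, $\operatorname{ev}_x[\rho]$ denotes the isomorphism class of the representation $\rho\circ\operatorname{ev}_x$ of $\mathfrak{M}$, which depends only on $[\rho]$. $\mathcal{E}^\Gamma_{\mathrm{single}}$ is the set of $\Gamma$-equivariant functions $\psi:X_{\mathrm{rat}}\to\mathcal{R}_X$ such that $\psi(x)\in\mathcal{R}_x$ for all $x\in X_{\mathrm{rat}}$ and such that $\operatorname{Supp}\psi:=\{x\in X_{\mathrm{rat}}:\psi(x)\neq0\}$ is contained in a single $\Gamma$-orbit (the function $\psi=0$, with empty support, is included). For $0\neq\psi\in\mathcal{E}^\Gamma_{\mathrm{single}}$, define $\operatorname{ev}^\Gamma_\psi=\operatorname{ev}_x[\psi(x)]$, meaning the class of $\rho\circ \operatorname{ev}_x$ for $\rho$ in the class $\psi(x)$, where $x$ is any point with $\Gamma\cdot x=\operatorname{Supp}\psi$; this is independent of the choice of $x\in\operatorname{Supp}\psi$. For $\psi=0$, $\operatorname{ev}^\Gamma_\psi$ is the class of the zero-dimensional representation. *)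

theory Defs
  imports
    "HOL-Algebra.Group_Action"
    "HOL-Algebra.QuotRing"
    "HOL-Algebra.Module"
    "HOL-Library.Poly_Mapping"
    "HOL-Computational_Algebra.Polynomial"
begin

section \<open>Algebras over a field\<close>

text \<open>The sort \<open>{ring, monoid_mult}\<close> (resp. \<open>{comm_ring, comm_monoid_mult}\<close>) describes
  unital associative (resp. also commutative) rings without requiring \<open>0 \<noteq> 1\<close>, unlike
  \<open>ring_1\<close> and \<open>comm_ring_1\<close>. So the zero algebra (and the empty scheme) is not excluded.\<close>

locale unital_algebra = vector_space scale
  for scale :: "'k::field \<Rightarrow> 'b::{ring, monoid_mult} \<Rightarrow> 'b" +
  assumes mult_scale_left: "scale c x * y = scale c (x * y)"
    and mult_scale_right: "x * scale c y = scale c (x * y)"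
begin

definition finite_dimensional :: bool where
  "finite_dimensional \<longleftrightarrow> (\<exists>S. finite S \<and> span S = UNIV)"

definition algebra_endomorphism :: "('b \<Rightarrow> 'b) \<Rightarrow> bool" where
  "algebra_endomorphism f \<longleftrightarrow>
     (\<forall>x y. f (x + y) = f x + f y) \<and> (\<forall>c x. f (scale c x) = scale c (f x)) \<and>
     (\<forall>x y. f (x * y) = f x * f y) \<and> f 1 = 1"

end

text \<open>Algebras that are not whole types (subalgebras, tensor products) are given by the
  record \<open>('k, 'b) module\<close>, which carries ring operations and a scalar multiplication.\<close>

definition alg_of :: "('k \<Rightarrow> 'b::{ring, monoid_mult} \<Rightarrow> 'b) \<Rightarrow> ('k, 'b) module" where
  "alg_of scale =
     \<lparr>carrier = UNIV, monoid.mult = (*), one = 1, zero = 0, add = (+), module.smult = scale\<rparr>"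

definition ring_of :: "'b::{ring, monoid_mult} ring" where
  "ring_of = \<lparr>carrier = UNIV, monoid.mult = (*), one = 1, zero = 0, add = (+)\<rparr>"

section \<open>Free vector spaces\<close>

definition free_scale :: "'k::field \<Rightarrow> ('i \<Rightarrow>\<^sub>0 'k) \<Rightarrow> ('i \<Rightarrow>\<^sub>0 'k)" where
  "free_scale c p = Poly_Mapping.map ((*) c) p"

lemma lookup_free_scale: "Poly_Mapping.lookup (free_scale c p) i = c * Poly_Mapping.lookup p i"
  by (simp add: free_scale_def Poly_Mapping.map.rep_eq when_def)

interpretation free: vector_space free_scale
  by unfold_locales
    (auto intro!: poly_mapping_eqI simp: lookup_free_scale lookup_add algebra_simps)

definition linear_extension ::
    "('k::field \<Rightarrow> 'v::ab_group_add \<Rightarrow> 'v) \<Rightarrow> ('i \<Rightarrow> 'v) \<Rightarrow> ('i \<Rightarrow>\<^sub>0 'k) \<Rightarrow> 'v" where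
  "linear_extension s f p =
     (\<Sum>i\<in>Poly_Mapping.keys p. s (Poly_Mapping.lookup p i) (f i))"

section \<open>Tensor products of algebras\<close>

text \<open>The tensor product of two algebras is the free vector space on the pairs, modulo the
  subspace of bilinearity relations. Its elements are cosets. The product of the free
  vector space below (the monoid algebra of \<open>'a \<times> 'b\<close>) is not the \<open>(*)\<close> of
  \<open>\<Rightarrow>\<^sub>0\<close>, which would add the exponents.\<close>

abbreviation pure :: "'a \<Rightarrow> 'b \<Rightarrow> ('a \<times> 'b) \<Rightarrow>\<^sub>0 'k::field" where
  "pure a b \<equiv> Poly_Mapping.single (a, b) 1"

definition pair_algebra ::
    "(('a::{ring, monoid_mult} \<times> 'b::{ring, monoid_mult}) \<Rightarrow>\<^sub>0 'k::field) ring" where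
  "pair_algebra =
     \<lparr>carrier = UNIV,
      monoid.mult = (\<lambda>p q. linear_extension free_scale (\<lambda>(a, b).
                     linear_extension free_scale (\<lambda>(a', b'). pure (a * a') (b * b')) q) p),
      one = pure 1 1, zero = 0, add = (+)\<rparr>"

definition tensor_relations ::
    "('k::field \<Rightarrow> 'a::ab_group_add \<Rightarrow> 'a) \<Rightarrow> ('k \<Rightarrow> 'b::ab_group_add \<Rightarrow> 'b)
     \<Rightarrow> (('a \<times> 'b) \<Rightarrow>\<^sub>0 'k) set" where
  "tensor_relations s t = free.span
     ({pure (a + a') b - (pure a b + pure a' b) | a a' b. True} \<union>
      {pure a (b + b') - (pure a b + pure a b') | a b b'. True} \<union>
      {pure (s c a) b - free_scale c (pure a b) | c a b. True} \<union>
      {pure a (t c b) - free_scale c (pure a b) | c a b. True})"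

definition tensor_algebra ::
    "('k::field \<Rightarrow> 'a::{ring, monoid_mult} \<Rightarrow> 'a) \<Rightarrow> ('k \<Rightarrow> 'b::{ring, monoid_mult} \<Rightarrow> 'b)
     \<Rightarrow> ('k, (('a \<times> 'b) \<Rightarrow>\<^sub>0 'k) set) module" where
  "tensor_algebra s t = (let N = tensor_relations s t; Q = pair_algebra Quot N in
     \<lparr>carrier = carrier Q, monoid.mult = monoid.mult Q, one = one Q, zero = zero Q, add = add Q,
      module.smult = (\<lambda>c \<alpha>. \<Union>p\<in>\<alpha>. N +>\<^bsub>pair_algebra\<^esub> free_scale c p)\<rparr>)"

section \<open>Representations\<close>

text \<open>A representation of \<open>B\<close> is a pair of a vector space \<open>V\<close> (a subspace of some ambient
  vector space with scalar multiplication \<open>s\<close>) and a map \<open>\<rho>\<close> from \<open>B\<close> to endomorphisms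
  of \<open>V\<close>. Values of \<open>\<rho>\<close> off \<open>carrier B\<close> and off \<open>V\<close> are irrelevant.\<close>

definition endomorphism :: "('k::field \<Rightarrow> 'v::ab_group_add \<Rightarrow> 'v) \<Rightarrow> 'v set \<Rightarrow> ('v \<Rightarrow> 'v) \<Rightarrow> bool" where
  "endomorphism s V f \<longleftrightarrow>
     (\<forall>v\<in>V. f v \<in> V) \<and> (\<forall>v\<in>V. \<forall>w\<in>V. f (v + w) = f v + f w) \<and>
     (\<forall>c. \<forall>v\<in>V. f (s c v) = s c (f v))"

definition alg_rep :: "('k::field, 'b) module \<Rightarrow> ('k \<Rightarrow> 'v::ab_group_add \<Rightarrow> 'v)
    \<Rightarrow> 'v set \<times> ('b \<Rightarrow> 'v \<Rightarrow> 'v) \<Rightarrow> bool" where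
  "alg_rep B s = (\<lambda>(V, \<rho>).
     Modules.module.subspace s V \<and>
     (\<forall>b\<in>carrier B. endomorphism s V (\<rho> b)) \<and>
     (\<forall>b\<in>carrier B. \<forall>b'\<in>carrier B. \<forall>v\<in>V. \<rho> (b \<oplus>\<^bsub>B\<^esub> b') v = \<rho> b v + \<rho> b' v) \<and>
     (\<forall>c. \<forall>b\<in>carrier B. \<forall>v\<in>V. \<rho> (c \<odot>\<^bsub>B\<^esub> b) v = s c (\<rho> b v)) \<and>
     (\<forall>b\<in>carrier B. \<forall>b'\<in>carrier B. \<forall>v\<in>V. \<rho> (b \<otimes>\<^bsub>B\<^esub> b') v = \<rho> b (\<rho> b' v)) \<and>
     (\<forall>v\<in>V. \<rho> \<one>\<^bsub>B\<^esub> v = v))"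

definition fin_dim_rep :: "('k::field, 'b) module \<Rightarrow> ('k \<Rightarrow> 'v::ab_group_add \<Rightarrow> 'v)
    \<Rightarrow> 'v set \<times> ('b \<Rightarrow> 'v \<Rightarrow> 'v) \<Rightarrow> bool" where
  "fin_dim_rep B s r \<longleftrightarrow>
     alg_rep B s r \<and> (\<exists>S. finite S \<and> Modules.module.span s S = fst r)"

text \<open>With this definition the zero-dimensional representation is irreducible.\<close>

definition irreducible_rep :: "('k::field, 'b) module \<Rightarrow> ('k \<Rightarrow> 'v::ab_group_add \<Rightarrow> 'v)
    \<Rightarrow> 'v set \<times> ('b \<Rightarrow> 'v \<Rightarrow> 'v) \<Rightarrow> bool" where
  "irreducible_rep B s = (\<lambda>(V, \<rho>).
     alg_rep B s (V, \<rho>) \<and>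
     (\<forall>W. Modules.module.subspace s W \<and> W \<subseteq> V \<and> (\<forall>b\<in>carrier B. \<forall>w\<in>W. \<rho> b w \<in> W)
          \<longrightarrow> W = {0} \<or> W = V))"

definition rep_iso :: "('k::field, 'b) module
    \<Rightarrow> ('k \<Rightarrow> 'v::ab_group_add \<Rightarrow> 'v) \<Rightarrow> ('k \<Rightarrow> 'w::ab_group_add \<Rightarrow> 'w)
    \<Rightarrow> 'v set \<times> ('b \<Rightarrow> 'v \<Rightarrow> 'v) \<Rightarrow> 'w set \<times> ('b \<Rightarrow> 'w \<Rightarrow> 'w) \<Rightarrow> bool" where
  "rep_iso B s t = (\<lambda>(V, \<rho>) (W, \<sigma>). \<exists>f. bij_betw f V W \<and>
     (\<forall>v\<in>V. \<forall>w\<in>V. f (v + w) = f v + f w) \<and> (\<forall>c. \<forall>v\<in>V. f (s c v) = t c (f v)) \<and>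
     (\<forall>b\<in>carrier B. \<forall>v\<in>V. f (\<rho> b v) = \<sigma> b (f v)))"

text \<open>To form a set of isomorphism classes, representations are taken on subspaces of the
  vector space \<open>nat \<Rightarrow>\<^sub>0 'k\<close> of countable dimension; each finite-dimensional
  representation on any vector space is isomorphic to one of these.\<close>

type_synonym ('k, 'b) rep = "(nat \<Rightarrow>\<^sub>0 'k) set \<times> ('b \<Rightarrow> (nat \<Rightarrow>\<^sub>0 'k) \<Rightarrow> (nat \<Rightarrow>\<^sub>0 'k))"

lemma fin_dim_rep_iso_universe:
  fixes B :: "('k::field, 'b) module" and s :: "'k \<Rightarrow> 'v::ab_group_add \<Rightarrow> 'v"
  assumes "vector_space s" and r: "fin_dim_rep B s r"
  shows "\<exists>r' :: ('k, 'b) rep. fin_dim_rep B free_scale r' \<and> rep_iso B s free_scale r r'"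
proof -
  interpret vs: vector_space s by fact
  interpret pair: vector_space_pair s free_scale
    by unfold_locales
  obtain V \<rho> where r_eq: "r = (V, \<rho>)" by (cases r)
  obtain S where S: "finite S" "vs.span S = V" and rep: "alg_rep B s (V, \<rho>)"
    using r unfolding fin_dim_rep_def r_eq by auto
  obtain E where E: "E \<subseteq> S" "vs.independent E" "S \<subseteq> vs.span E"
    by (meson vs.maximal_independent_subset)
  have finE: "finite E" and spanE: "vs.span E = V"
    using E S finite_subset vs.span_minimal[of S "vs.span E"] vs.span_mono[of E S] by auto
  obtain n :: "'v \<Rightarrow> nat" where n: "inj_on n E"
    using finE finite_imp_inj_to_nat_seg by blast
  define e where "e i = Poly_Mapping.single i (1::'k)" for i :: nat
  have e_indep: "free.independent (e ` I)" and e_inj: "inj_on e I" if "finite I" for I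
  proof -
    show inj: "inj_on e I"
      unfolding e_def inj_on_def by (metis keys_single singleton_inject zero_neq_one)
    show "free.independent (e ` I)"
    proof (rule free.independent_if_scalars_zero)
      show "finite (e ` I)" using that by simp
      fix f x assume sum: "(\<Sum>x\<in>e ` I. free_scale (f x) x) = 0" and x: "x \<in> e ` I"
      then obtain i where i: "i \<in> I" "x = e i" by auto
      have "(\<Sum>j\<in>I. free_scale (f (e j)) (e j)) = 0"
        using sum inj by (simp add: sum.reindex)
      then have "(\<Sum>j\<in>I. Poly_Mapping.lookup (free_scale (f (e j)) (e j)) i) = 0"
        by (metis lookup_sum lookup_zero)
      then show "f x = 0"
        using i that by (simp add: lookup_free_scale e_def lookup_single when_def
            if_distrib sum.delta cong: if_cong)
    qed
  qed
  define f where "f = pair.construct E (e \<circ> n)"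
  have lin: "Vector_Spaces.linear s free_scale f"
    unfolding f_def by (rule pair.linear_construct[OF E(2)])
  interpret f: Vector_Spaces.linear s free_scale f by (rule lin)
  have f_E: "f x = e (n x)" if "x \<in> E" for x
    unfolding f_def using pair.construct_basis[OF E(2) that, of "e \<circ> n"] by simp
  have inj_f: "inj_on f V"
  proof -
    have "f ` E = e ` n ` E" using f_E by force
    then have "free.independent (f ` E)" using e_indep finE by simp
    moreover have "inj_on f E"
    proof -
      have "inj_on (e \<circ> n) E" using n e_inj[of "n ` E"] finE comp_inj_on by blast
      then show ?thesis using f_E by (simp add: inj_on_def)
    qed
    ultimately show ?thesis
      using pair.linear_inj_on_span_independent_image[OF lin] spanE by metis
  qed
  define W where "W = f ` V"
  define g where "g = the_inv_into V f"
  have W_span: "W = free.span (f ` S)"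
    unfolding W_def using pair.linear_span_image[OF lin] S by simp
  have gf: "g (f v) = v" if "v \<in> V" for v
    unfolding g_def using inj_f that by (simp add: the_inv_into_f_f)
  have f_add: "f (v + w) = f v + f w" and f_scale: "f (s c v) = free_scale c (f v)" for c v w
    by (simp_all add: f.add f.scale)
  define \<sigma> where "\<sigma> b w = f (\<rho> b (g w))" for b w
  have V_add: "v + w \<in> V" and V_scale: "s c v \<in> V" if "v \<in> V" "w \<in> V" for c v w
    using that spanE vs.span_add vs.span_scale by blast+
  have inter: "f (\<rho> b v) = \<sigma> b (f v)" if "v \<in> V" for b v
    using that by (simp add: \<sigma>_def gf)
  have "free.subspace W"
    unfolding W_span by (rule free.subspace_span)
  then have "alg_rep B free_scale (W, \<sigma>)"
    using rep unfolding alg_rep_def endomorphism_def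
    by (auto simp: W_def inter[symmetric] f_add[symmetric] f_scale[symmetric] V_add V_scale)
  moreover have "rep_iso B s free_scale (V, \<rho>) (W, \<sigma>)"
    unfolding rep_iso_def using inj_f inter f_add f_scale
    by (auto intro!: exI[of _ f] simp: W_def bij_betw_def)
  ultimately show ?thesis
    using S(1) W_span unfolding fin_dim_rep_def r_eq by (metis finite_imageI fst_conv)
qed

definition irr_reps :: "('k::field, 'b) module \<Rightarrow> ('k, 'b) rep set" where
  "irr_reps B = {r. fin_dim_rep B free_scale r \<and> irreducible_rep B free_scale r}"

definition iso_rel :: "('k::field, 'b) module \<Rightarrow> (('k, 'b) rep \<times> ('k, 'b) rep) set" where
  "iso_rel B = {(r, r'). fin_dim_rep B free_scale r \<and> fin_dim_rep B free_scale r' \<and>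
                         rep_iso B free_scale free_scale r r'}"

definition irr_classes :: "('k::field, 'b) module \<Rightarrow> ('k, 'b) rep set set" where
  "irr_classes B = irr_reps B // iso_rel B"

definition zero_class :: "('k::field, 'b) module \<Rightarrow> ('k, 'b) rep set" where
  "zero_class B = iso_rel B `` {({0}, \<lambda>_ _. 0)}"

text \<open>The class of \<open>\<rho> \<circ> \<phi>\<close>, for \<open>\<rho>\<close> in a given class and \<open>\<phi>\<close> an algebra
  homomorphism from \<open>B\<close>. The union is over copies of one and the same class.\<close>

definition pullback_class ::
    "('k::field, 'b) module \<Rightarrow> ('b \<Rightarrow> 'c) \<Rightarrow> ('k, 'c) rep set \<Rightarrow> ('k, 'b) rep set" where
  "pullback_class B \<phi> C = (\<Union>(V, \<rho>)\<in>C. iso_rel B `` {(V, \<rho> \<circ> \<phi>)})"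

section \<open>Equivariant map algebras\<close>

locale equivariant_map_data =
  A: unital_algebra scale_A +
  \<aa>: unital_algebra scale_\<aa> +
  G: group G +
  action_A: group_action G UNIV act_A +
  action_\<aa>: group_action G UNIV act_\<aa>
  for scale_A :: "'k::alg_closed_field \<Rightarrow> 'x::{comm_ring, comm_monoid_mult} \<Rightarrow> 'x"
    and scale_\<aa> :: "'k \<Rightarrow> 'a::{ring, monoid_mult} \<Rightarrow> 'a"
    and G :: "('g, 'm) monoid_scheme"
    and act_A :: "'g \<Rightarrow> 'x \<Rightarrow> 'x"
    and act_\<aa> :: "'g \<Rightarrow> 'a \<Rightarrow> 'a" +
  assumes finite_dimensional_\<aa>: "\<aa>.finite_dimensional"
    and finite_G: "finite (carrier G)"
    and order_G: "\<not> CHAR('k) dvd Coset.order G"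
    and act_A_algebra: "\<gamma> \<in> carrier G \<Longrightarrow> A.algebra_endomorphism (act_A \<gamma>)"
    and act_\<aa>_algebra: "\<gamma> \<in> carrier G \<Longrightarrow> \<aa>.algebra_endomorphism (act_\<aa> \<gamma>)"
begin

text \<open>Points of \<open>Spec A\<close> are prime ideals; \<open>x\<close> is \<open>k\<close>-rational if \<open>A/x\<close> is isomorphic
  to \<open>k\<close> as a \<open>k\<close>-algebra (not only as a ring).\<close>

definition X :: "'x set set" where
  "X = {x. primeideal x (ring_of :: 'x ring)}"

definition X_rat :: "'x set set" where
  "X_rat = {x \<in> X. \<exists>h \<in> ring_iso ((ring_of :: 'x ring) Quot x) (ring_of :: 'k ring).
     \<forall>c f. h (x +>\<^bsub>ring_of\<^esub> scale_A c f) = c * h (x +>\<^bsub>ring_of\<^esub> f)}"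

text \<open>The value of \<open>f \<in> A\<close> at a rational point \<open>x\<close>: the scalar that corresponds to the
  residue class of \<open>f\<close> in \<open>A/x \<cong> k\<close>.\<close>

definition val :: "'x set \<Rightarrow> 'x \<Rightarrow> 'k" where
  "val x f = (THE c. f - scale_A c 1 \<in> x)"

text \<open>\<open>act_A \<gamma>\<close> is composition of functions with the action of \<open>\<gamma>\<^sup>-\<^sup>1\<close> on \<open>Spec A\<close>,
  so it maps the ideal of \<open>x\<close> onto the ideal of \<open>\<gamma> \<cdot> x\<close>.\<close>

definition act_X :: "'g \<Rightarrow> 'x set \<Rightarrow> 'x set" where
  "act_X \<gamma> x = act_A \<gamma> ` x"

definition fixed_alg :: "'x set \<Rightarrow> ('k, 'a) module" where
  "fixed_alg x = (alg_of scale_\<aa>)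
     \<lparr>carrier := {a. \<forall>\<gamma> \<in> stabilizer G act_X x. act_\<aa> \<gamma> a = a}\<rparr>"

definition act_pairs :: "'g \<Rightarrow> (('a \<times> 'x) \<Rightarrow>\<^sub>0 'k) \<Rightarrow> (('a \<times> 'x) \<Rightarrow>\<^sub>0 'k)" where
  "act_pairs \<gamma> = linear_extension free_scale (\<lambda>(a, f). pure (act_\<aa> \<gamma> a) (act_A \<gamma> f))"

definition act_tensor :: "'g \<Rightarrow> (('a \<times> 'x) \<Rightarrow>\<^sub>0 'k) set \<Rightarrow> (('a \<times> 'x) \<Rightarrow>\<^sub>0 'k) set" where
  "act_tensor \<gamma> \<alpha> = (\<Union>p\<in>\<alpha>. tensor_relations scale_\<aa> scale_A +>\<^bsub>pair_algebra\<^esub> act_pairs \<gamma> p)"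

definition map_alg :: "('k, (('a \<times> 'x) \<Rightarrow>\<^sub>0 'k) set) module" where
  "map_alg = (tensor_algebra scale_\<aa> scale_A)
     \<lparr>carrier := {\<alpha> \<in> carrier (tensor_algebra scale_\<aa> scale_A).
                    \<forall>\<gamma> \<in> carrier G. act_tensor \<gamma> \<alpha> = \<alpha>}\<rparr>"

text \<open>\<open>a \<otimes> f\<close> is mapped to \<open>f(x) a\<close>; the linear extension to the free vector space on the
  pairs is constant on each coset \<open>\<alpha>\<close>.\<close>

definition ev :: "'x set \<Rightarrow> (('a \<times> 'x) \<Rightarrow>\<^sub>0 'k) set \<Rightarrow> 'a" where
  "ev x \<alpha> = the_elem (linear_extension scale_\<aa> (\<lambda>(a, f). scale_\<aa> (val x f) a) ` \<alpha>)"

definition R :: "'x set \<Rightarrow> ('k, 'a) rep set set" where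
  "R x = irr_classes (fixed_alg x)"

definition R_X :: "('x set \<times> ('k, 'a) rep set) set" where
  "R_X = Sigma X_rat R"

definition act_R :: "'g \<Rightarrow> 'x set \<times> ('k, 'a) rep set \<Rightarrow> 'x set \<times> ('k, 'a) rep set" where
  "act_R \<gamma> = (\<lambda>(x, C).
     (act_X \<gamma> x, pullback_class (fixed_alg (act_X \<gamma> x)) (act_\<aa> (inv\<^bsub>G\<^esub> \<gamma>)) C))"

definition Supp :: "('x set \<Rightarrow> 'x set \<times> ('k, 'a) rep set) \<Rightarrow> 'x set set" where
  "Supp \<psi> = {x \<in> X_rat. \<psi> x \<noteq> (x, zero_class (fixed_alg x))}"

definition E_single :: "('x set \<Rightarrow> 'x set \<times> ('k, 'a) rep set) set" where
  "E_single = {\<psi> \<in> X_rat \<rightarrow>\<^sub>E R_X.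
     (\<forall>x\<in>X_rat. \<psi> x \<in> {x} \<times> R x) \<and>
     (\<forall>\<gamma>\<in>carrier G. \<forall>x\<in>X_rat. \<psi> (act_X \<gamma> x) = act_R \<gamma> (\<psi> x)) \<and>
     (Supp \<psi> = {} \<or> (\<exists>x\<in>X_rat. Supp \<psi> \<subseteq> orbit G act_X x))}"

definition ev_class ::
    "('x set \<Rightarrow> 'x set \<times> ('k, 'a) rep set) \<Rightarrow> ('k, (('a \<times> 'x) \<Rightarrow>\<^sub>0 'k) set) rep set" where
  "ev_class \<psi> =
     (if Supp \<psi> = {} then zero_class map_alg
      else let x = (SOME x. x \<in> X_rat \<and> orbit G act_X x = Supp \<psi>)
           in pullback_class map_alg (ev x) (snd (\<psi> x)))"

end

end

theory Submission
  imports Defs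
begin

text \<open>
  Let \<open>M\<close> be the algebra of equivariant maps and let \<open>V\<close> be a nonzero irreducible finite-dimensional
  representation of it.
  For \<open>\<alpha> \<in> \<aa> \<otimes> A\<close> write \<open>avg \<alpha> \<in> M\<close> for the mean of \<open>\<alpha>\<close> over the group; this exists because
  the order of the group is invertible in the field. Let \<open>Q\<close> be the largest ideal of \<open>A\<close> such
  that \<open>avg (a \<otimes> f)\<close> kills \<open>V\<close> for all \<open>a\<close> and all \<open>f \<in> Q\<close>. Three properties of \<open>Q\<close> produce a point.

  \<^item> \<open>Q\<close> is prime with respect to stable ideals (\<open>Q_prime\<close>): if \<open>L\<close> and \<open>L'\<close> are stable and neither is
    contained in \<open>Q\<close>, some elements of \<open>M\<close> with coefficients in \<open>L\<close> and in \<open>L'\<close> act nontrivially, and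
    by irreducibility a product of these with a third element between them acts nontrivially too.
    The product has coefficients in \<open>L L'\<close>, so \<open>L L'\<close> is not contained in \<open>Q\<close>.
  \<^item> Each invariant function is a scalar modulo \<open>Q\<close> (\<open>invariant_scalar_mod_Q\<close>). This is Schur's
    lemma, since \<open>1 \<otimes> f\<close> is central in \<open>M\<close> for invariant \<open>f\<close>.
  \<^item> Each element of \<open>A\<close> is a root of a monic polynomial with invariant coefficients
    (\<open>monic_invariant_relation\<close>).

  By Zorn's lemma there is an ideal \<open>x \<supseteq> Q\<close> maximal under the condition that the intersection of
  the translates of \<open>x\<close> lies in \<open>Q\<close>. The first property makes \<open>x\<close> prime; the other two make the
  domain \<open>A/x\<close> algebraic over the algebraically closed field, so \<open>x\<close> is rational
  (\<open>exists_point\<close>).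

  If \<open>\<alpha> \<in> M\<close> vanishes at \<open>x\<close>, it vanishes on the orbit of \<open>x\<close>, and interpolation on that finite set
  shows that \<open>\<alpha>\<close> has coefficients in the intersection of the translates of \<open>x\<close>, hence in \<open>Q\<close>; so
  \<open>\<alpha> = avg \<alpha>\<close> acts as zero (\<open>vanishing_acts_zero\<close>). Therefore \<open>V\<close> comes from an irreducible
  representation of \<open>\<aa>\<^sup>x\<close> (\<open>factors_through_evaluation\<close>), and spreading its class along the orbit
  gives the equivariant function.

  Injectivity rests on equivariant interpolation (\<open>equivariant_interpolation\<close>): evaluation at
  \<open>x\<close> is onto \<open>\<aa>\<^sup>x\<close>, even on the maps that vanish at a given point of another orbit. So the orbit
  can be read off from the representation (\<open>same_orbit_of_ev_class_eq\<close>), and then the class at \<open>x\<close>.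

  The formal proof handles elements of the tensor product through representatives \<open>p\<close> in the
  free vector space on pairs, so that sums and linear maps are those of a vector space on a whole
  type. Equations between tensors become congruences modulo the bilinearity relations.
\<close>

section \<open>Polynomials in a linear operator\<close>

definition poly_apply ::
    "('k::field \<Rightarrow> 'v::ab_group_add \<Rightarrow> 'v) \<Rightarrow> ('v \<Rightarrow> 'v) \<Rightarrow> 'k poly \<Rightarrow> 'v \<Rightarrow> 'v" where
  "poly_apply s T p v = (\<Sum>i\<le>degree p. s (coeff p i) ((T ^^ i) v))"

context vector_space
begin

lemma poly_apply_bound:
  assumes "degree p \<le> n"
  shows "poly_apply scale T p v = (\<Sum>i\<le>n. scale (coeff p i) ((T ^^ i) v))"
  unfolding poly_apply_def
  by (rule sum.mono_neutral_left) (use assms in \<open>auto simp: coeff_eq_0\<close>)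

lemma endomorphism_diff:
  assumes "endomorphism scale V T" "subspace V" "v \<in> V" "w \<in> V"
  shows "T (v - w) = T v - T w"
proof -
  have "T (v + scale (-1) w) = T v + scale (-1) (T w)"
    using assms unfolding endomorphism_def by (metis subspace_scale)
  then show ?thesis by simp
qed

lemma endomorphism_zero: "endomorphism scale V T \<Longrightarrow> subspace V \<Longrightarrow> T 0 = 0"
  using endomorphism_diff[of V T 0 0] subspace_0 by simp

lemma endomorphism_sum:
  assumes "endomorphism scale V T" "subspace V" "\<And>i. i \<in> I \<Longrightarrow> w i \<in> V"
  shows "T (\<Sum>i\<in>I. w i) = (\<Sum>i\<in>I. T (w i))"
  using assms(3)
proof (induction I rule: infinite_finite_induct)
  case (insert i I)
  then have "w i \<in> V" "(\<Sum>i\<in>I. w i) \<in> V" using subspace_sum[OF assms(2), of I w] by auto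
  then show ?case
    using insert assms(1) unfolding endomorphism_def by simp
qed (use endomorphism_zero[OF assms(1,2)] in simp_all)

lemma endomorphism_funpow: "endomorphism scale V T \<Longrightarrow> v \<in> V \<Longrightarrow> (T ^^ i) v \<in> V"
  by (induction i) (auto simp: endomorphism_def)

lemma poly_apply_closed:
  assumes "endomorphism scale V T" "subspace V" "v \<in> V"
  shows "poly_apply scale T p v \<in> V"
  unfolding poly_apply_def
  using assms by (intro subspace_sum subspace_scale endomorphism_funpow) auto

lemma poly_apply_linear_factor:
  assumes T: "endomorphism scale V T" and V: "subspace V" and v: "v \<in> V"
  shows "poly_apply scale T ([:-c, 1:] * q) v =
         T (poly_apply scale T q v) - scale c (poly_apply scale T q v)"
proof -
  let ?p = "[:-c, 1:] * q"
  define n where "n = degree q"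
  have deg: "degree ?p \<le> Suc n"
    using degree_mult_le[of "[:-c, 1:]" q] by (simp add: n_def)
  have pow: "(T ^^ i) v \<in> V" for i using T v by (rule endomorphism_funpow)
  have p: "coeff ?p i = coeff (pCons 0 q) i - c * coeff q i" for i by simp
  have "poly_apply scale T ?p v = (\<Sum>i\<le>Suc n. scale (coeff ?p i) ((T ^^ i) v))"
    by (rule poly_apply_bound[OF deg])
  also have "\<dots> = (\<Sum>i\<le>Suc n. scale (coeff (pCons 0 q) i) ((T ^^ i) v))
                 - (\<Sum>i\<le>Suc n. scale c (scale (coeff q i) ((T ^^ i) v)))"
    unfolding p by (simp only: scale_left_diff_distrib sum_subtractf scale_scale)
  also have "(\<Sum>i\<le>Suc n. scale (coeff (pCons 0 q) i) ((T ^^ i) v))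
             = (\<Sum>i\<le>n. T (scale (coeff q i) ((T ^^ i) v)))"
    using T pow by (subst sum.atMost_Suc_shift) (simp add: endomorphism_def)
  also have "\<dots> = T (\<Sum>i\<le>n. scale (coeff q i) ((T ^^ i) v))"
    using T V pow by (intro endomorphism_sum[symmetric]) (auto intro: subspace_scale)
  also have "(\<Sum>i\<le>Suc n. scale c (scale (coeff q i) ((T ^^ i) v)))
             = scale c (\<Sum>i\<le>Suc n. scale (coeff q i) ((T ^^ i) v))"
    by (simp only: scale_sum_right)
  also have "(\<Sum>i\<le>Suc n. scale (coeff q i) ((T ^^ i) v)) = poly_apply scale T q v"
    by (rule poly_apply_bound[symmetric]) (simp add: n_def)
  also have "(\<Sum>i\<le>n. scale (coeff q i) ((T ^^ i) v)) = poly_apply scale T q v"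
    by (rule poly_apply_bound[symmetric]) (simp add: n_def)
  finally show ?thesis .
qed

end

text \<open>Splitting off one linear factor \<open>X - c\<close> of \<open>p\<close> at a time, the value at \<open>v\<close> must enter \<open>W\<close> at
  some step, and the vector before that step is an eigenvector modulo \<open>W\<close>. With \<open>W = {0}\<close> this gives the
  eigenvalue in Schur's lemma. With \<open>W\<close> a prime ideal of \<open>A\<close> and \<open>T\<close> the multiplication by \<open>f\<close>, it
  makes \<open>f\<close> a scalar modulo \<open>W\<close>.\<close>
lemma eigenvector_modulo_subspace:
  fixes s :: "'k::alg_closed_field \<Rightarrow> 'v::ab_group_add \<Rightarrow> 'v"
  assumes "vector_space s" and T: "endomorphism s V T" and V: "Modules.module.subspace s V"
    and W: "Modules.module.subspace s W"
    and v: "v \<in> V" "v \<notin> W" and p: "p \<noteq> 0" "poly_apply s T p v \<in> W"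
  obtains c u where "u \<in> V" "u \<notin> W" "T u - s c u \<in> W"
proof -
  interpret vector_space s by fact
  have "\<exists>c u. u \<in> V \<and> u \<notin> W \<and> T u - s c u \<in> W"
    using p
  proof (induction "degree p" arbitrary: p)
    case 0
    then obtain a where a: "p = [:a:]" "a \<noteq> 0" by (metis degree_0_id pCons_0_0)
    then have "s a v \<in> W" using 0 by (simp add: poly_apply_def)
    then have "s (inverse a) (s a v) \<in> W" by (rule subspace_scale[OF W])
    then show ?case using a v by simp
  next
    case (Suc n)
    then obtain c where "poly p c = 0"
      using alg_closed_imp_poly_has_root[of p] by auto
    then obtain q where q: "p = [:-c, 1:] * q"
      using poly_eq_0_iff_dvd by (metis dvdE)
    then have q0: "q \<noteq> 0" "degree q = n"
      using Suc.prems(1) Suc.hyps(2) unfolding q by (auto simp: degree_mult_eq simp del: mult_pCons_left)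
    show ?case
    proof (cases "poly_apply s T q v \<in> W")
      case True
      then show ?thesis using Suc(1)[of q] q0 by auto
    next
      case False
      moreover have "poly_apply s T q v \<in> V" by (rule poly_apply_closed[OF T V v(1)])
      ultimately show ?thesis
        using Suc(4) unfolding q poly_apply_linear_factor[OF T V v(1)] by blast
    qed
  qed
  then show ?thesis using that by blast
qed

text \<open>Among \<open>v, T v, \<dots>, T\<^sup>n v\<close>, with \<open>n\<close> the size of a spanning set, either two vectors coincide or there
  is a linear dependence.\<close>
lemma (in vector_space) annihilating_polynomial:
  assumes T: "endomorphism scale V T" and V: "V = span S" "finite S" and v: "v \<in> V"
  obtains p where "p \<noteq> 0" "poly_apply scale T p v = 0"
proof -
  define n where "n = card S"
  define w where "w i = (T ^^ i) v" for i
  have w: "w i \<in> V" for i unfolding w_def by (rule endomorphism_funpow[OF T v])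
  have "\<exists>p. p \<noteq> 0 \<and> (\<Sum>i\<le>degree p. scale (coeff p i) (w i)) = 0"
  proof (cases "inj_on w {..n}")
    case False
    then obtain i j where ij: "i \<noteq> j" "w i = w j" by (auto simp: inj_on_def)
    define p where "p = monom (1::'a) i - monom 1 j"
    have "coeff p i \<noteq> 0" using ij by (simp add: p_def)
    then have "p \<noteq> 0" by auto
    moreover have "(\<Sum>k\<le>degree p. scale (coeff p k) (w k)) = 0"
    proof -
      have "(\<Sum>k\<le>degree p. scale (coeff p k) (w k)) = (\<Sum>k\<le>i+j. scale (coeff p k) (w k))"
        unfolding w_def poly_apply_def[symmetric]
        by (rule poly_apply_bound)
          (auto simp: p_def intro!: degree_diff_le order_trans[OF degree_monom_le])
      also have "\<dots> = (\<Sum>k\<le>i+j. (if k = i then w k else 0) - (if k = j then w k else 0))"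
        by (rule sum.cong) (auto simp: p_def scale_left_diff_distrib)
      also have "\<dots> = w i - w j" by (simp add: sum_subtractf)
      finally show ?thesis using ij by simp
    qed
    ultimately show ?thesis by blast
  next
    case True
    have "dependent (w ` {..n})"
    proof (rule ccontr)
      assume "\<not> dependent (w ` {..n})"
      then have "card (w ` {..n}) \<le> n"
        unfolding n_def using independent_span_bound[OF V(2)] w V(1) by blast
      then show False using True by (simp add: card_image)
    qed
    then obtain u i0 where u: "(\<Sum>x\<in>w ` {..n}. scale (u x) x) = 0" "i0 \<le> n" "u (w i0) \<noteq> 0"
      by (auto simp: dependent_finite)
    define p where "p = (\<Sum>i\<le>n. monom (u (w i)) i)"
    have cp: "coeff p i = (if i \<le> n then u (w i) else 0)" for i
      by (auto simp: p_def coeff_sum sum.delta)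
    then have "coeff p i0 \<noteq> 0" using u by simp
    then have p0: "p \<noteq> 0" by auto
    have "degree p \<le> n" by (rule degree_le) (simp add: cp)
    then have "(\<Sum>k\<le>degree p. scale (coeff p k) (w k)) = (\<Sum>k\<le>n. scale (coeff p k) (w k))"
      unfolding w_def poly_apply_def[symmetric] by (rule poly_apply_bound)
    also have "\<dots> = 0" using u True by (simp add: sum.reindex cp)
    finally show ?thesis using p0 by blast
  qed
  then show ?thesis using that by (auto simp: w_def poly_apply_def)
qed

section \<open>Expansion of a product of sums\<close>

text \<open>The sort admits the zero ring, where a monic polynomial makes no sense. So integral dependence
  on the invariants is derived below from this identity between elements.\<close>
lemma prod_add_expand:
  fixes f :: "'x::{comm_ring, comm_monoid_mult}"
  assumes "finite I"
  shows "(\<Prod>i\<in>I. f + h i) = (\<Sum>S\<in>Pow I. f ^ (card I - card S) * (\<Prod>i\<in>S. h i))"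
  using assms
proof (induction I)
  case (insert i I)
  have inj: "inj_on (Set.insert i) (Pow I)"
    using insert.hyps(2) by (auto simp: inj_on_def)
  have disj: "Pow I \<inter> Set.insert i ` Pow I = {}" using insert.hyps(2) by auto
  have S: "finite S" "i \<notin> S" "card S \<le> card I" if "S \<in> Pow I" for S
    using that insert.hyps by (auto intro: finite_subset card_mono)
  have "(\<Sum>S\<in>Pow (Set.insert i I). f ^ (card (Set.insert i I) - card S) * (\<Prod>i\<in>S. h i))
     = (\<Sum>S\<in>Pow I. f ^ (Suc (card I) - card S) * (\<Prod>i\<in>S. h i))
      + (\<Sum>S\<in>Pow I. f ^ (card I - card S) * (h i * (\<Prod>i\<in>S. h i)))"
    unfolding Pow_insert using insert.hyps inj disj S
    by (subst sum.union_disjoint) (auto simp: sum.reindex intro!: sum.cong)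
  also have "(\<Sum>S\<in>Pow I. f ^ (Suc (card I) - card S) * (\<Prod>i\<in>S. h i))
             = f * (\<Sum>S\<in>Pow I. f ^ (card I - card S) * (\<Prod>i\<in>S. h i))"
    using S by (simp add: sum_distrib_left Suc_diff_le mult.assoc)
  also have "(\<Sum>S\<in>Pow I. f ^ (card I - card S) * (h i * (\<Prod>i\<in>S. h i)))
             = h i * (\<Sum>S\<in>Pow I. f ^ (card I - card S) * (\<Prod>i\<in>S. h i))"
    by (simp add: sum_distrib_left mult.left_commute)
  finally show ?case
    using insert by (simp add: distrib_right)
qed simp

section \<open>Isomorphism classes of representations and pullback\<close>

lemma alg_rep_endomorphism:
  "alg_rep B s (V, \<rho>) \<Longrightarrow> b \<in> carrier B \<Longrightarrow> endomorphism s V (\<rho> b)"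
  by (simp add: alg_rep_def)

lemma alg_rep_closed: "alg_rep B s (V, \<rho>) \<Longrightarrow> b \<in> carrier B \<Longrightarrow> v \<in> V \<Longrightarrow> \<rho> b v \<in> V"
  by (simp add: alg_rep_def endomorphism_def)

lemma alg_rep_scale:
  "alg_rep B s (V, \<rho>) \<Longrightarrow> b \<in> carrier B \<Longrightarrow> v \<in> V \<Longrightarrow> \<rho> (c \<odot>\<^bsub>B\<^esub> b) v = s c (\<rho> b v)"
  by (simp add: alg_rep_def)

lemma rep_iso_refl: "rep_iso B s s r r"
  unfolding rep_iso_def by (cases r) (auto intro!: exI[of _ id])

lemma rep_iso_of_eq:
  "(\<And>b v. b \<in> carrier B \<Longrightarrow> v \<in> V \<Longrightarrow> \<rho> b v = \<sigma> b v) \<Longrightarrow> rep_iso B s s (V, \<rho>) (V, \<sigma>)"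
  unfolding rep_iso_def by (auto intro!: exI[of _ id])

lemma rep_iso_sym:
  assumes "vector_space s" and r: "alg_rep B s (V, \<rho>)" and iso: "rep_iso B s t (V, \<rho>) (W, \<sigma>)"
  shows "rep_iso B t s (W, \<sigma>) (V, \<rho>)"
proof -
  interpret vector_space s by fact
  obtain f where f: "bij_betw f V W"
    "\<And>v w. v \<in> V \<Longrightarrow> w \<in> V \<Longrightarrow> f (v + w) = f v + f w"
    "\<And>c v. v \<in> V \<Longrightarrow> f (s c v) = t c (f v)"
    "\<And>b v. b \<in> carrier B \<Longrightarrow> v \<in> V \<Longrightarrow> f (\<rho> b v) = \<sigma> b (f v)"
    using iso unfolding rep_iso_def by auto
  define g where "g = the_inv_into V f"
  have g: "bij_betw g W V" unfolding g_def by (rule bij_betw_the_inv_into[OF f(1)])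
  have gf: "g (f v) = v" if "v \<in> V" for v
    using f(1) that by (simp add: g_def bij_betw_def the_inv_into_f_f)
  have fg: "\<exists>v\<in>V. w = f v" if "w \<in> W" for w using f(1) that by (auto simp: bij_betw_def)
  have V: "subspace V" using r by (simp add: alg_rep_def)
  have "g (v + w) = g v + g w" if "v \<in> W" "w \<in> W" for v w
    using fg[OF that(1)] fg[OF that(2)] V gf f(2) subspace_add[OF V] by metis
  moreover have "g (t c w) = s c (g w)" if "w \<in> W" for c w
    using fg[OF that] gf f(3) subspace_scale[OF V] by metis
  moreover have "g (\<sigma> b w) = \<rho> b (g w)" if "b \<in> carrier B" "w \<in> W" for b w
    using fg[OF that(2)] that(1) gf f(4) alg_rep_closed[OF r] by metis
  ultimately show ?thesis using g unfolding rep_iso_def by auto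
qed

lemma rep_iso_trans:
  assumes "rep_iso B s t (V, \<rho>) (W, \<sigma>)" and "rep_iso B t u (W, \<sigma>) (U, \<tau>)"
  shows "rep_iso B s u (V, \<rho>) (U, \<tau>)"
proof -
  obtain f where f: "bij_betw f V W"
    "\<And>v w. v \<in> V \<Longrightarrow> w \<in> V \<Longrightarrow> f (v + w) = f v + f w"
    "\<And>c v. v \<in> V \<Longrightarrow> f (s c v) = t c (f v)"
    "\<And>b v. b \<in> carrier B \<Longrightarrow> v \<in> V \<Longrightarrow> f (\<rho> b v) = \<sigma> b (f v)"
    using assms(1) unfolding rep_iso_def by auto
  obtain g where g: "bij_betw g W U"
    "\<And>v w. v \<in> W \<Longrightarrow> w \<in> W \<Longrightarrow> g (v + w) = g v + g w"
    "\<And>c v. v \<in> W \<Longrightarrow> g (t c v) = u c (g v)"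
    "\<And>b v. b \<in> carrier B \<Longrightarrow> v \<in> W \<Longrightarrow> g (\<sigma> b v) = \<tau> b (g v)"
    using assms(2) unfolding rep_iso_def by auto
  have "f v \<in> W" if "v \<in> V" for v using f(1) that by (auto simp: bij_betw_def)
  then show ?thesis
    unfolding rep_iso_def using f g
    by (auto intro!: exI[of _ "g \<circ> f"] bij_betw_trans[OF f(1) g(1)])
qed

lemma equiv_iso_rel: "equiv {r. fin_dim_rep B free_scale r} (iso_rel B)"
proof (rule equivI)
  show "iso_rel B \<subseteq> {r. fin_dim_rep B free_scale r} \<times> {r. fin_dim_rep B free_scale r}"
    by (auto simp: iso_rel_def)
  show "refl_on {r. fin_dim_rep B free_scale r} (iso_rel B)"
    by (auto simp: refl_on_def iso_rel_def rep_iso_refl)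
  show "sym (iso_rel B)"
    unfolding sym_def iso_rel_def fin_dim_rep_def
    using rep_iso_sym[OF free.vector_space_axioms] by fastforce
  show "trans (iso_rel B)"
    unfolding trans_def iso_rel_def using rep_iso_trans by fastforce
qed

lemma iso_class_eq_iff:
  assumes "fin_dim_rep B free_scale r" "fin_dim_rep B free_scale r'"
  shows "iso_rel B `` {r} = iso_rel B `` {r'} \<longleftrightarrow> rep_iso B free_scale free_scale r r'"
  using eq_equiv_class_iff[OF equiv_iso_rel, of r B r'] assms by (simp add: iso_rel_def)

lemma irr_classes_iff:
  "C \<in> irr_classes B \<longleftrightarrow> (\<exists>V \<rho>. (V, \<rho>) \<in> irr_reps B \<and> C = iso_rel B `` {(V, \<rho>)})"
  unfolding irr_classes_def quotient_def by auto

lemma irr_reps_fin_dim: "r \<in> irr_reps B \<Longrightarrow> fin_dim_rep B free_scale r"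
  by (simp add: irr_reps_def)

lemma irr_reps_alg_rep: "r \<in> irr_reps B \<Longrightarrow> alg_rep B free_scale r"
  by (simp add: irr_reps_def fin_dim_rep_def)

lemma zero_rep_irr: "({0}, \<lambda>_ _. 0) \<in> irr_reps B"
  unfolding irr_reps_def fin_dim_rep_def irreducible_rep_def alg_rep_def endomorphism_def
  by (auto simp: free.subspace_def intro!: exI[of _ "{}"])

lemma zero_class_irr: "zero_class B \<in> irr_classes B"
  unfolding irr_classes_iff zero_class_def using zero_rep_irr by blast

lemma iso_class_eq_zero_iff:
  fixes B :: "('k::field, 'b) module"
  assumes "fin_dim_rep B free_scale (V, \<rho>)"
  shows "iso_rel B `` {(V, \<rho>)} = zero_class B \<longleftrightarrow> V = {0}"
proof -
  have V: "free.subspace V" "alg_rep B free_scale (V, \<rho>)"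
    using assms by (simp_all add: fin_dim_rep_def alg_rep_def)
  have "rep_iso B free_scale free_scale (V, \<rho>)
      ({0 :: nat \<Rightarrow>\<^sub>0 'k}, \<lambda>_ _. 0) \<longleftrightarrow> V = {0}"
  proof
    assume "rep_iso B free_scale free_scale (V, \<rho>)
      ({0 :: nat \<Rightarrow>\<^sub>0 'k}, \<lambda>_ _. 0)"
    then obtain f where "bij_betw f V {0 :: nat \<Rightarrow>\<^sub>0 'k}"
      by (auto simp: rep_iso_def)
    then have "card V = 1" using bij_betw_same_card by fastforce
    then show "V = {0}" using free.subspace_0[OF V(1)] by (auto simp: card_1_singleton_iff)
  next
    assume "V = {0}"
    then show "rep_iso B free_scale free_scale (V, \<rho>)
      ({0 :: nat \<Rightarrow>\<^sub>0 'k}, \<lambda>_ _. 0)"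
      using alg_rep_closed[OF V(2)] by (auto intro!: rep_iso_of_eq)
  qed
  then show ?thesis
    unfolding zero_class_def using iso_class_eq_iff[OF assms irr_reps_fin_dim[OF zero_rep_irr]]
    by simp
qed

definition algebra_hom :: "('k, 'b) module \<Rightarrow> ('k, 'c) module \<Rightarrow> ('b \<Rightarrow> 'c) \<Rightarrow> bool" where
  "algebra_hom B C \<phi> \<longleftrightarrow>
     (\<forall>b\<in>carrier B. \<phi> b \<in> carrier C) \<and>
     (\<forall>b\<in>carrier B. \<forall>b'\<in>carrier B. \<phi> (b \<oplus>\<^bsub>B\<^esub> b') = \<phi> b \<oplus>\<^bsub>C\<^esub> \<phi> b') \<and>
     (\<forall>b\<in>carrier B. \<forall>b'\<in>carrier B. \<phi> (b \<otimes>\<^bsub>B\<^esub> b') = \<phi> b \<otimes>\<^bsub>C\<^esub> \<phi> b') \<and>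
     (\<forall>c. \<forall>b\<in>carrier B. \<phi> (c \<odot>\<^bsub>B\<^esub> b) = c \<odot>\<^bsub>C\<^esub> \<phi> b) \<and>
     \<phi> \<one>\<^bsub>B\<^esub> = \<one>\<^bsub>C\<^esub>"

lemma alg_rep_pullback:
  "algebra_hom B C \<phi> \<Longrightarrow> alg_rep C s (V, \<rho>) \<Longrightarrow> alg_rep B s (V, \<rho> \<circ> \<phi>)"
  unfolding algebra_hom_def alg_rep_def by auto

lemma fin_dim_rep_pullback:
  "algebra_hom B C \<phi> \<Longrightarrow> fin_dim_rep C s (V, \<rho>) \<Longrightarrow> fin_dim_rep B s (V, \<rho> \<circ> \<phi>)"
  unfolding fin_dim_rep_def by (auto intro: alg_rep_pullback)

lemma rep_iso_pullback:
  "algebra_hom B C \<phi> \<Longrightarrow> rep_iso C s t (V, \<rho>) (W, \<sigma>) \<Longrightarrow> rep_iso B s t (V, \<rho> \<circ> \<phi>) (W, \<sigma> \<circ> \<phi>)"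
  unfolding algebra_hom_def rep_iso_def case_prod_conv comp_def
  by (elim exE, rule_tac x = f in exI) simp

lemma rep_iso_pullback_surj:
  assumes "\<phi> ` carrier B = carrier C" and "rep_iso B s t (V, \<rho> \<circ> \<phi>) (W, \<sigma> \<circ> \<phi>)"
  shows "rep_iso C s t (V, \<rho>) (W, \<sigma>)"
  using assms(2) unfolding rep_iso_def assms(1)[symmetric] case_prod_conv comp_def
  by (elim exE, rule_tac x = f in exI) simp

text \<open>Along a surjection the invariant subspaces are the same, and so irreducibility is preserved.\<close>
lemma irreducible_pullback:
  assumes "algebra_hom B C \<phi>" "\<phi> ` carrier B = carrier C" "(V, \<rho>) \<in> irr_reps C"
  shows "(V, \<rho> \<circ> \<phi>) \<in> irr_reps B"
  using assms fin_dim_rep_pullback[OF assms(1)] alg_rep_pullback[OF assms(1)]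
  unfolding irr_reps_def irreducible_rep_def assms(2)[symmetric] by auto

text \<open>\<open>pullback_class\<close> is a union over all members of the class; each contributes the same
  class, so any representation in the class may be used to compute it.\<close>
lemma pullback_class_iso_class:
  assumes \<phi>: "algebra_hom B C \<phi>" and r: "fin_dim_rep C free_scale (V, \<rho>)"
  shows "pullback_class B \<phi> (iso_rel C `` {(V, \<rho>)}) = iso_rel B `` {(V, \<rho> \<circ> \<phi>)}"
proof -
  have "iso_rel B `` {(W, \<sigma> \<circ> \<phi>)} = iso_rel B `` {(V, \<rho> \<circ> \<phi>)}"
    if "(W, \<sigma>) \<in> iso_rel C `` {(V, \<rho>)}" for W \<sigma>
  proof -
    have "fin_dim_rep C free_scale (W, \<sigma>)" "rep_iso C free_scale free_scale (V, \<rho>) (W, \<sigma>)"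
      using that by (auto simp: iso_rel_def)
    then show ?thesis
      using iso_class_eq_iff fin_dim_rep_pullback[OF \<phi>] rep_iso_pullback[OF \<phi>] r by blast
  qed
  moreover have "(V, \<rho>) \<in> iso_rel C `` {(V, \<rho>)}"
    using r by (simp add: iso_rel_def rep_iso_refl)
  ultimately show ?thesis unfolding pullback_class_def by fastforce
qed

lemma pullback_class_irr:
  assumes "algebra_hom B C \<phi>" "\<phi> ` carrier B = carrier C" "D \<in> irr_classes C"
  shows "pullback_class B \<phi> D \<in> irr_classes B"
proof -
  obtain V \<rho> where r: "(V, \<rho>) \<in> irr_reps C" "D = iso_rel C `` {(V, \<rho>)}"
    using assms(3) by (auto simp: irr_classes_iff)
  show ?thesis
    unfolding r(2) pullback_class_iso_class[OF assms(1) irr_reps_fin_dim[OF r(1)]]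
    using irreducible_pullback[OF assms(1,2) r(1)] by (auto simp: irr_classes_iff)
qed

lemma pullback_class_zero:
  assumes "algebra_hom B C \<phi>"
  shows "pullback_class B \<phi> (zero_class C) = zero_class B"
  unfolding zero_class_def pullback_class_iso_class[OF assms irr_reps_fin_dim[OF zero_rep_irr]]
  by (simp add: comp_def)

lemma pullback_class_eq_zero_iff:
  assumes "algebra_hom B C \<phi>" "D \<in> irr_classes C"
  shows "pullback_class B \<phi> D = zero_class B \<longleftrightarrow> D = zero_class C"
proof -
  obtain V \<rho> where r: "(V, \<rho>) \<in> irr_reps C" "D = iso_rel C `` {(V, \<rho>)}"
    using assms(2) by (auto simp: irr_classes_iff)
  note fd = irr_reps_fin_dim[OF r(1)]
  show ?thesis
    unfolding r(2) pullback_class_iso_class[OF assms(1) fd] iso_class_eq_zero_iff[OF fd]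
      iso_class_eq_zero_iff[OF fin_dim_rep_pullback[OF assms(1) fd]] ..
qed

lemma pullback_class_inj:
  assumes \<phi>: "algebra_hom B C \<phi>" "\<phi> ` carrier B = carrier C"
    and D: "D \<in> irr_classes C" "D' \<in> irr_classes C"
    and eq: "pullback_class B \<phi> D = pullback_class B \<phi> D'"
  shows "D = D'"
proof -
  obtain V \<rho> where r: "(V, \<rho>) \<in> irr_reps C" "D = iso_rel C `` {(V, \<rho>)}"
    using D(1) by (auto simp: irr_classes_iff)
  obtain W \<sigma> where r': "(W, \<sigma>) \<in> irr_reps C" "D' = iso_rel C `` {(W, \<sigma>)}"
    using D(2) by (auto simp: irr_classes_iff)
  note fd = irr_reps_fin_dim[OF r(1)] irr_reps_fin_dim[OF r'(1)]
  have "rep_iso B free_scale free_scale (V, \<rho> \<circ> \<phi>) (W, \<sigma> \<circ> \<phi>)"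
    using eq unfolding r r' pullback_class_iso_class[OF \<phi>(1) fd(1)]
      pullback_class_iso_class[OF \<phi>(1) fd(2)]
    using iso_class_eq_iff fd fin_dim_rep_pullback[OF \<phi>(1)] by blast
  then show ?thesis
    unfolding r r' iso_class_eq_iff[OF fd] by (rule rep_iso_pullback_surj[OF \<phi>(2)])
qed

text \<open>The maps need to agree only on the carrier, because representations that agree there are
  isomorphic. This matters for evaluation at a point, which commutes with the group action on
  equivariant maps only.\<close>
lemma pullback_class_comp:
  assumes \<phi>: "algebra_hom B C \<phi>" and \<psi>: "algebra_hom C D \<psi>" and \<chi>: "algebra_hom B D \<chi>"
    and eq: "\<And>b. b \<in> carrier B \<Longrightarrow> \<chi> b = \<psi> (\<phi> b)" and E: "E \<in> irr_classes D"
  shows "pullback_class B \<phi> (pullback_class C \<psi> E) = pullback_class B \<chi> E"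
proof -
  obtain V \<rho> where r: "(V, \<rho>) \<in> irr_reps D" "E = iso_rel D `` {(V, \<rho>)}"
    using E by (auto simp: irr_classes_iff)
  note fd = irr_reps_fin_dim[OF r(1)]
  note fd' = fin_dim_rep_pullback[OF \<psi> fd]
  have "rep_iso B free_scale free_scale (V, \<rho> \<circ> \<psi> \<circ> \<phi>) (V, \<rho> \<circ> \<chi>)"
    by (rule rep_iso_of_eq) (simp add: eq)
  then show ?thesis
    unfolding r(2) pullback_class_iso_class[OF \<psi> fd] pullback_class_iso_class[OF \<phi> fd']
      pullback_class_iso_class[OF \<chi> fd]
    using iso_class_eq_iff[OF fin_dim_rep_pullback[OF \<phi> fd'] fin_dim_rep_pullback[OF \<chi> fd]]
    by blast
qed

lemma pullback_class_id:
  assumes "D \<in> irr_classes B" and "\<And>b. b \<in> carrier B \<Longrightarrow> \<phi> b = b" and "algebra_hom B B \<phi>"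
  shows "pullback_class B \<phi> D = D"
proof -
  obtain V \<rho> where r: "(V, \<rho>) \<in> irr_reps B" "D = iso_rel B `` {(V, \<rho>)}"
    using assms(1) by (auto simp: irr_classes_iff)
  note fd = irr_reps_fin_dim[OF r(1)]
  show ?thesis
    unfolding r(2) pullback_class_iso_class[OF assms(3) fd]
      iso_class_eq_iff[OF fin_dim_rep_pullback[OF assms(3) fd] fd]
    by (rule rep_iso_of_eq) (simp add: assms(2))
qed

text \<open>The choice of preimages that defines \<open>\<sigma>\<close> is harmless since \<open>\<rho>\<close> is constant on the fibres of \<open>\<phi>\<close>.\<close>
lemma irr_reps_descend:
  assumes \<phi>: "algebra_hom B C \<phi>" "\<phi> ` carrier B = carrier C"
    and closed: "\<And>b b'. b \<in> carrier B \<Longrightarrow> b' \<in> carrier B \<Longrightarrow> b \<oplus>\<^bsub>B\<^esub> b' \<in> carrier B"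
      "\<And>b b'. b \<in> carrier B \<Longrightarrow> b' \<in> carrier B \<Longrightarrow> b \<otimes>\<^bsub>B\<^esub> b' \<in> carrier B"
      "\<And>c b. b \<in> carrier B \<Longrightarrow> c \<odot>\<^bsub>B\<^esub> b \<in> carrier B" "\<one>\<^bsub>B\<^esub> \<in> carrier B"
    and r: "(V, \<rho>) \<in> irr_reps B"
    and ker: "\<And>b b' v. b \<in> carrier B \<Longrightarrow> b' \<in> carrier B \<Longrightarrow> \<phi> b = \<phi> b' \<Longrightarrow> v \<in> V \<Longrightarrow> \<rho> b v = \<rho> b' v"
  obtains \<sigma> where "(V, \<sigma>) \<in> irr_reps C" "\<And>b v. b \<in> carrier B \<Longrightarrow> v \<in> V \<Longrightarrow> \<sigma> (\<phi> b) v = \<rho> b v"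
proof
  define \<sigma> where "\<sigma> c = \<rho> (inv_into (carrier B) \<phi> c)" for c
  show \<sigma>: "\<sigma> (\<phi> b) v = \<rho> b v" if "b \<in> carrier B" "v \<in> V" for b v
    unfolding \<sigma>_def using that
    by (intro ker inv_into_into f_inv_into_f) auto
  have rep: "alg_rep B free_scale (V, \<rho>)" using r by (rule irr_reps_alg_rep)
  have hom: "\<phi> b \<oplus>\<^bsub>C\<^esub> \<phi> b' = \<phi> (b \<oplus>\<^bsub>B\<^esub> b')" "\<phi> b \<otimes>\<^bsub>C\<^esub> \<phi> b' = \<phi> (b \<otimes>\<^bsub>B\<^esub> b')"
    "c \<odot>\<^bsub>C\<^esub> \<phi> b = \<phi> (c \<odot>\<^bsub>B\<^esub> b)" "\<one>\<^bsub>C\<^esub> = \<phi> \<one>\<^bsub>B\<^esub>"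
    if "b \<in> carrier B" "b' \<in> carrier B" for b b' c
    using \<phi>(1) that by (simp_all add: algebra_hom_def)
  have V: "v \<in> V \<Longrightarrow> w \<in> V \<Longrightarrow> v + w \<in> V" "v \<in> V \<Longrightarrow> free_scale c v \<in> V" for v w c
    using rep by (auto simp: alg_rep_def free.subspace_def)
  have "alg_rep C free_scale (V, \<sigma>)"
    using rep closed alg_rep_closed[OF rep] unfolding alg_rep_def endomorphism_def \<phi>(2)[symmetric]
    by (auto simp: hom \<sigma> V)
  moreover have "W = {0} \<or> W = V"
    if W: "free.subspace W" "W \<subseteq> V" "\<forall>b\<in>carrier C. \<forall>w\<in>W. \<sigma> b w \<in> W" for W
  proof -
    have "\<rho> b w \<in> W" if "b \<in> carrier B" "w \<in> W" for b w
    proof -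
      have "\<phi> b \<in> carrier C" using that \<phi>(2) by blast
      then have "\<sigma> (\<phi> b) w \<in> W" using W(3) that by blast
      then show ?thesis using \<sigma>[OF that(1)] that W(2) by auto
    qed
    then show ?thesis
      using r W by (auto simp: irr_reps_def irreducible_rep_def)
  qed
  ultimately show "(V, \<sigma>) \<in> irr_reps C"
    using r by (auto simp: irr_reps_def irreducible_rep_def fin_dim_rep_def)
qed

section \<open>Linear maps on free vector spaces\<close>

lemma free_induct [case_names single add scale]:
  fixes p :: "'i \<Rightarrow>\<^sub>0 'k::field"
  assumes "\<And>i. P (Poly_Mapping.single i 1)" "\<And>p q. P p \<Longrightarrow> P q \<Longrightarrow> P (p + q)"
    "\<And>c p. P p \<Longrightarrow> P (free_scale c p)"
  shows "P p"
proof (induction p rule: update_induct)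
  case const
  show ?case using assms(3)[OF assms(1), of 0] by simp
next
  case (update p i c)
  have "Poly_Mapping.update i c p = p + free_scale c (Poly_Mapping.single i 1)"
    using update(1) by (intro poly_mapping_eqI)
      (auto simp: lookup_update lookup_add lookup_free_scale lookup_single when_def in_keys_iff)
  then show ?case using update(3) assms by metis
qed

lemma pure_induct [case_names pure add scale]:
  fixes p :: "('a \<times> 'b) \<Rightarrow>\<^sub>0 'k::field"
  assumes "\<And>a b. P (pure a b)" "\<And>p q. P p \<Longrightarrow> P q \<Longrightarrow> P (p + q)"
    "\<And>c p. P p \<Longrightarrow> P (free_scale c p)"
  shows "P p"
  using assms by (induction p rule: free_induct) auto

context vector_space
begin

lemma linear_extension_superset:
  assumes "finite S" "Poly_Mapping.keys p \<subseteq> S"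
  shows "linear_extension scale f p = (\<Sum>i\<in>S. scale (Poly_Mapping.lookup p i) (f i))"
  unfolding linear_extension_def
  by (rule sum.mono_neutral_left) (use assms in \<open>auto simp: in_keys_iff\<close>)

lemma linear_extension_add:
  "linear_extension scale f (p + q) = linear_extension scale f p + linear_extension scale f q"
proof -
  let ?S = "Poly_Mapping.keys p \<union> Poly_Mapping.keys q"
  have "Poly_Mapping.keys (p + q) \<subseteq> ?S" by (rule keys_add)
  then show ?thesis
    by (simp add: linear_extension_superset[of ?S] lookup_add scale_left_distrib sum.distrib)
qed

lemma linear_extension_scale:
  "linear_extension scale f (free_scale c p) = scale c (linear_extension scale f p)"
proof -
  have "Poly_Mapping.keys (free_scale c p) \<subseteq> Poly_Mapping.keys p"
    by (auto simp: in_keys_iff lookup_free_scale)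
  then show ?thesis
    by (simp add: linear_extension_superset[of "Poly_Mapping.keys p"] lookup_free_scale
        scale_sum_right)
qed

lemma linear_extension_single [simp]:
  "linear_extension scale f (Poly_Mapping.single i 1) = f i"
  by (simp add: linear_extension_def)

lemma linear_extension_diff:
  "linear_extension scale f (p - q) = linear_extension scale f p - linear_extension scale f q"
  by (metis add_diff_cancel diff_add_cancel linear_extension_add)

end

lemmas free_linear_simps = free.linear_extension_add free.linear_extension_scale
  free.linear_extension_diff

section \<open>The tensor product of two algebras\<close>

definition pair_mult :: "(('a::{ring, monoid_mult} \<times> 'b::{ring, monoid_mult}) \<Rightarrow>\<^sub>0 'k::field)
    \<Rightarrow> (('a \<times> 'b) \<Rightarrow>\<^sub>0 'k) \<Rightarrow> (('a \<times> 'b) \<Rightarrow>\<^sub>0 'k)" where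
  "pair_mult = monoid.mult pair_algebra"

lemma pair_algebra_simps [simp]:
  "carrier pair_algebra = UNIV" "monoid.mult pair_algebra = pair_mult"
  "one pair_algebra = pure 1 1" "zero pair_algebra = 0" "add pair_algebra = (+)"
  by (simp_all add: pair_algebra_def pair_mult_def)

lemma pair_mult_eq: "pair_mult p q = linear_extension free_scale (\<lambda>(a, b).
    linear_extension free_scale (\<lambda>(a', b'). pure (a * a') (b * b')) q) p"
  by (simp add: pair_mult_def pair_algebra_def)

lemma pair_mult_pure [simp]: "pair_mult (pure a b) (pure a' b') = pure (a * a') (b * b')"
  by (simp add: pair_mult_eq)

lemma pair_mult_add_left: "pair_mult (p + q) r = pair_mult p r + pair_mult q r"
  and pair_mult_scale_left: "pair_mult (free_scale c p) r = free_scale c (pair_mult p r)"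
  by (simp_all add: pair_mult_eq free_linear_simps)

lemma pair_mult_add_right: "pair_mult r (p + q) = pair_mult r p + pair_mult r q"
  and pair_mult_scale_right: "pair_mult r (free_scale c p) = free_scale c (pair_mult r p)"
proof -
  have 1: "pair_mult r (p + q) = pair_mult r p + pair_mult r q" if "r = pure a b" for r a b
    using that by (simp add: pair_mult_eq free_linear_simps)
  have 2: "pair_mult r (free_scale c p) = free_scale c (pair_mult r p)" if "r = pure a b" for r a b
    using that by (simp add: pair_mult_eq free_linear_simps)
  show "pair_mult r (p + q) = pair_mult r p + pair_mult r q"
    by (induction r rule: pure_induct)
      (simp_all add: 1 pair_mult_add_left pair_mult_scale_left free.scale_right_distrib algebra_simps)
  show "pair_mult r (free_scale c p) = free_scale c (pair_mult r p)"
    by (induction r rule: pure_induct)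
      (simp_all add: 2 pair_mult_add_left pair_mult_scale_left free.scale_right_distrib mult.commute)
qed

lemmas pair_mult_linear = pair_mult_add_left pair_mult_add_right pair_mult_scale_left
  pair_mult_scale_right

lemma pair_mult_assoc: "pair_mult (pair_mult p q) r = pair_mult p (pair_mult q r)"
proof (induction p rule: pure_induct)
  case (pure a b)
  show ?case
  proof (induction q rule: pure_induct)
    case (pure c d)
    show ?case by (induction r rule: pure_induct) (simp_all add: pair_mult_linear mult.assoc)
  qed (simp_all add: pair_mult_linear)
qed (simp_all add: pair_mult_linear)

lemma pair_mult_one [simp]: "pair_mult (pure 1 1) p = p" "pair_mult p (pure 1 1) = p"
  by (induction p rule: pure_induct) (simp_all add: pair_mult_linear)

lemma ring_pair_algebra: "ring pair_algebra"
proof (rule ringI)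
  show "abelian_group pair_algebra"
    by (rule abelian_groupI) (auto simp: algebra_simps intro: exI[of _ "- x" for x])
  show "Group.monoid pair_algebra"
    by (rule monoidI) (simp_all add: pair_mult_assoc)
qed (simp_all add: pair_mult_linear)

lemma pair_mult_diff_left: "pair_mult (p - q) r = pair_mult p r - pair_mult q r"
  by (metis add_diff_cancel diff_add_cancel pair_mult_add_left)

lemma pair_mult_diff_right: "pair_mult r (p - q) = pair_mult r p - pair_mult r q"
  by (metis add_diff_cancel diff_add_cancel pair_mult_add_right)

lemma pair_mult_sum_right: "pair_mult r (\<Sum>i\<in>I. p i) = (\<Sum>i\<in>I. pair_mult r (p i))"
  using pair_mult_diff_right[of r 0 0]
  by (induction I rule: infinite_finite_induct) (simp_all add: pair_mult_add_right)

locale algebra_pair = a: unital_algebra s + b: unital_algebra t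
  for s :: "'k::field \<Rightarrow> 'a::{ring, monoid_mult} \<Rightarrow> 'a"
    and t :: "'k \<Rightarrow> 'b::{ring, monoid_mult} \<Rightarrow> 'b"
begin

abbreviation N :: "(('a \<times> 'b) \<Rightarrow>\<^sub>0 'k) set" where
  "N \<equiv> tensor_relations s t"

abbreviation T :: "('k, (('a \<times> 'b) \<Rightarrow>\<^sub>0 'k) set) module" where
  "T \<equiv> tensor_algebra s t"

definition tensor_class :: "(('a \<times> 'b) \<Rightarrow>\<^sub>0 'k) \<Rightarrow> (('a \<times> 'b) \<Rightarrow>\<^sub>0 'k) set" where
  "tensor_class p = N +>\<^bsub>pair_algebra\<^esub> p"

lemma subspace_N: "free.subspace N"
  unfolding tensor_relations_def by (rule free.subspace_span)

lemma N_add_left: "pure (a + a') b - (pure a b + pure a' b) \<in> N"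
  and N_add_right: "pure a (b + b') - (pure a b + pure a b') \<in> N"
  and N_scale_left: "pure (s c a) b - free_scale c (pure a b) \<in> N"
  and N_scale_right: "pure a (t c b) - free_scale c (pure a b) \<in> N"
  unfolding tensor_relations_def by (rule free.span_base, blast)+

lemma N_minimal:
  assumes "free.subspace S"
    "\<And>a a' b. pure (a + a') b - (pure a b + pure a' b) \<in> S"
    "\<And>a b b'. pure a (b + b') - (pure a b + pure a b') \<in> S"
    "\<And>c a b. pure (s c a) b - free_scale c (pure a b) \<in> S"
    "\<And>c a b. pure a (t c b) - free_scale c (pure a b) \<in> S"
  shows "N \<subseteq> S"
  unfolding tensor_relations_def
  by (rule free.span_minimal) (use assms in auto)

lemma N_ideal: "p \<in> N \<Longrightarrow> pair_mult p q \<in> N" "p \<in> N \<Longrightarrow> pair_mult q p \<in> N"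
proof -
  note sub = free.subspace_add[OF subspace_N] free.subspace_scale[OF subspace_N]
    free.subspace_0[OF subspace_N]
  let ?S = "{p. \<forall>q. pair_mult p q \<in> N \<and> pair_mult q p \<in> N}"
  have "pair_mult 0 q = 0" "pair_mult q 0 = 0" for q :: "('a \<times> 'b) \<Rightarrow>\<^sub>0 'k"
    using pair_mult_scale_left[of 0 0 q] pair_mult_scale_right[of q 0 0] by simp_all
  then have S: "free.subspace ?S"
    by (intro free.subspaceI) (auto simp: pair_mult_linear sub)
  have gen: "p \<in> ?S"
    if "\<And>a b. pair_mult p (pure a b) \<in> N \<and> pair_mult (pure a b) p \<in> N" for p
  proof (intro CollectI allI)
    fix q
    show "pair_mult p q \<in> N \<and> pair_mult q p \<in> N"
      using that by (induction q rule: pure_induct) (auto simp: pair_mult_linear intro: sub)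
  qed
  have "N \<subseteq> ?S"
    by (rule N_minimal[OF S]; rule gen; unfold pair_mult_diff_left pair_mult_diff_right
        pair_mult_linear pair_mult_pure a.mult_scale_left a.mult_scale_right b.mult_scale_left
        b.mult_scale_right distrib_left distrib_right;
        intro conjI N_add_left N_add_right N_scale_left N_scale_right)
  then show "p \<in> N \<Longrightarrow> pair_mult p q \<in> N" "p \<in> N \<Longrightarrow> pair_mult q p \<in> N" by blast+
qed

lemma ideal_N: "ideal N pair_algebra"
proof (rule idealI[OF ring_pair_algebra])
  interpret ring pair_algebra by (rule ring_pair_algebra)
  have inv: "inv\<^bsub>add_monoid pair_algebra\<^esub> p = - p" for p :: "('a \<times> 'b) \<Rightarrow>\<^sub>0 'k"
    using minus_equality[of "- p" p] by (simp add: a_inv_def)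
  show "subgroup N (add_monoid pair_algebra)"
    by unfold_locales
      (auto simp: inv[simplified] intro: free.subspace_add free.subspace_0 free.subspace_neg subspace_N)
qed (auto intro: N_ideal)

sublocale I: ideal N pair_algebra by (rule ideal_N)

lemma mem_tensor_class: "q \<in> tensor_class p \<longleftrightarrow> q - p \<in> N"
  unfolding tensor_class_def a_r_coset_def' by (auto intro: bexI[of _ "q - p"])

lemma tensor_class_self: "p \<in> tensor_class p"
  by (simp add: mem_tensor_class free.subspace_0 subspace_N)

lemma tensor_class_eq_iff: "tensor_class p = tensor_class q \<longleftrightarrow> p - q \<in> N"
proof
  assume "tensor_class p = tensor_class q"
  then show "p - q \<in> N" using tensor_class_self[of p] by (simp add: mem_tensor_class)
next
  assume "p - q \<in> N"
  then have "r - p \<in> N \<longleftrightarrow> r - q \<in> N" for r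
    using free.subspace_add[OF subspace_N, of "r - p" "p - q"]
      free.subspace_diff[OF subspace_N, of "r - q" "p - q"] by auto
  then show "tensor_class p = tensor_class q" by (auto simp: mem_tensor_class)
qed

lemma carrier_T: "carrier T = range tensor_class"
  by (auto simp: tensor_algebra_def Let_def FactRing_def A_RCOSETS_def' tensor_class_def)

lemma one_T: "\<one>\<^bsub>T\<^esub> = tensor_class (pure 1 1)"
  by (simp add: tensor_algebra_def Let_def FactRing_def tensor_class_def)

lemma add_T: "tensor_class p \<oplus>\<^bsub>T\<^esub> tensor_class q = tensor_class (p + q)"
  using I.a_rcos_sum[of p q] by (simp add: tensor_algebra_def Let_def FactRing_def tensor_class_def)

lemma mult_T: "tensor_class p \<otimes>\<^bsub>T\<^esub> tensor_class q = tensor_class (pair_mult p q)"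
  using I.rcoset_mult_add[of p q]
  by (simp add: tensor_algebra_def Let_def FactRing_def tensor_class_def)

text \<open>The operations on cosets are defined as unions over representatives; such a union is a single
  coset as soon as the map on representatives respects the relations.\<close>
lemma Union_tensor_class:
  assumes "\<And>q. q - p \<in> N \<Longrightarrow> f q - f p \<in> N"
  shows "(\<Union>q\<in>tensor_class p. tensor_class (f q)) = tensor_class (f p)"
proof -
  have "tensor_class (f q) = tensor_class (f p)" if "q \<in> tensor_class p" for q
    using assms that by (simp add: mem_tensor_class tensor_class_eq_iff)
  then show ?thesis using tensor_class_self[of p] by blast
qed

lemma smult_T: "c \<odot>\<^bsub>T\<^esub> tensor_class p = tensor_class (free_scale c p)"
proof -
  have "c \<odot>\<^bsub>T\<^esub> tensor_class p = (\<Union>q\<in>tensor_class p. tensor_class (free_scale c q))"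
    by (simp add: tensor_algebra_def Let_def tensor_class_def)
  also have "\<dots> = tensor_class (free_scale c p)"
    by (rule Union_tensor_class)
      (simp add: free.scale_right_diff_distrib[symmetric] free.subspace_scale[OF subspace_N])
  finally show ?thesis .
qed

end

section \<open>Rational points\<close>

text \<open>Ideals without the record overhead of \<open>ideal\<close>; the two agree by \<open>ideal_ring_of_iff\<close> below.\<close>
definition ideal_set :: "'x::{comm_ring, comm_monoid_mult} set \<Rightarrow> bool" where
  "ideal_set I \<longleftrightarrow> 0 \<in> I \<and> (\<forall>f\<in>I. \<forall>g\<in>I. f + g \<in> I) \<and> (\<forall>f\<in>I. \<forall>r. r * f \<in> I)"

lemma ideal_set_minus: "ideal_set I \<Longrightarrow> f \<in> I \<Longrightarrow> - f \<in> I"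
  unfolding ideal_set_def by (metis minus_mult_left mult_1)

lemma ideal_set_diff: "ideal_set I \<Longrightarrow> f \<in> I \<Longrightarrow> g \<in> I \<Longrightarrow> f - g \<in> I"
  using ideal_set_minus[of I g] unfolding ideal_set_def by (metis diff_conv_add_uminus)

lemma ideal_set_sum: "ideal_set I \<Longrightarrow> (\<And>i. i \<in> S \<Longrightarrow> f i \<in> I) \<Longrightarrow> (\<Sum>i\<in>S. f i) \<in> I"
  by (induction S rule: infinite_finite_induct) (auto simp: ideal_set_def)

lemma ring_of_simps [simp]:
  "carrier ring_of = UNIV" "monoid.mult ring_of = (*)" "one ring_of = 1" "zero ring_of = 0"
  "add ring_of = (+)"
  by (simp_all add: ring_of_def)

lemma cring_ring_of: "cring (ring_of :: 'x::{comm_ring, comm_monoid_mult} ring)"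
proof (rule cringI)
  show "abelian_group (ring_of :: 'x ring)"
    by (rule abelian_groupI) (auto simp: algebra_simps intro: exI[of _ "- x" for x])
  show "Group.comm_monoid (ring_of :: 'x ring)"
    by (rule comm_monoidI) (simp_all add: ac_simps)
qed (simp add: distrib_right)

lemma ideal_ring_of_iff: "ideal I (ring_of :: 'x::{comm_ring, comm_monoid_mult} ring) \<longleftrightarrow> ideal_set I"
proof -
  interpret cring "ring_of :: 'x ring" by (rule cring_ring_of)
  have inv: "inv\<^bsub>add_monoid ring_of\<^esub> p = - p" for p :: 'x
    using minus_equality[of "- p" p] by (simp add: a_inv_def)
  show ?thesis
  proof
    assume I: "ideal I (ring_of :: 'x ring)"
    then interpret ideal I "ring_of :: 'x ring" .
    show "ideal_set I"
      unfolding ideal_set_def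
      using additive_subgroup.zero_closed[OF is_additive_subgroup] a_closed I_l_closed by auto
  next
    assume I: "ideal_set I"
    show "ideal I (ring_of :: 'x ring)"
    proof (rule idealI[OF ring_axioms])
      show "subgroup I (add_monoid (ring_of :: 'x ring))"
        using I ideal_set_minus[OF I]
        by unfold_locales (auto simp: inv[simplified] ideal_set_def)
    qed (use I in \<open>auto simp: ideal_set_def mult.commute\<close>)
  qed
qed

lemma mem_coset_ring_of: "g \<in> I +>\<^bsub>ring_of\<^esub> f \<longleftrightarrow> g - f \<in> I"
  unfolding a_r_coset_def' by (auto intro: bexI[of _ "g - f"])

lemma coset_ring_of_eq_iff:
  assumes "ideal_set I"
  shows "I +>\<^bsub>ring_of\<^esub> f = I +>\<^bsub>ring_of\<^esub> g \<longleftrightarrow> f - g \<in> I"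
proof
  assume "I +>\<^bsub>ring_of\<^esub> f = I +>\<^bsub>ring_of\<^esub> g"
  moreover have "f \<in> I +>\<^bsub>ring_of\<^esub> f" using assms by (simp add: mem_coset_ring_of ideal_set_def)
  ultimately show "f - g \<in> I" by (simp add: mem_coset_ring_of)
next
  assume fg: "f - g \<in> I"
  then have "h - f \<in> I \<longleftrightarrow> h - g \<in> I" for h
    using ideal_set_diff[OF assms, of "h - g" "f - g"] assms
    unfolding ideal_set_def by (metis add.commute diff_add_cancel diff_diff_eq2 add_diff_eq)
  then show "I +>\<^bsub>ring_of\<^esub> f = I +>\<^bsub>ring_of\<^esub> g" by (auto simp: mem_coset_ring_of)
qed

sublocale equivariant_map_data \<subseteq> tensor: algebra_pair scale_\<aa> scale_A
  by unfold_locales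

context equivariant_map_data
begin

lemma act_A_add [simp]: "g \<in> carrier G \<Longrightarrow> act_A g (f + f') = act_A g f + act_A g f'"
  and act_A_scale [simp]: "g \<in> carrier G \<Longrightarrow> act_A g (scale_A c f) = scale_A c (act_A g f)"
  and act_A_mult [simp]: "g \<in> carrier G \<Longrightarrow> act_A g (f * f') = act_A g f * act_A g f'"
  and act_A_1 [simp]: "g \<in> carrier G \<Longrightarrow> act_A g 1 = 1"
  using act_A_algebra by (simp_all add: A.algebra_endomorphism_def)

lemma act_\<aa>_add [simp]: "g \<in> carrier G \<Longrightarrow> act_\<aa> g (a + a') = act_\<aa> g a + act_\<aa> g a'"
  and act_\<aa>_scale [simp]: "g \<in> carrier G \<Longrightarrow> act_\<aa> g (scale_\<aa> c a) = scale_\<aa> c (act_\<aa> g a)"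
  and act_\<aa>_mult [simp]: "g \<in> carrier G \<Longrightarrow> act_\<aa> g (a * a') = act_\<aa> g a * act_\<aa> g a'"
  and act_\<aa>_1 [simp]: "g \<in> carrier G \<Longrightarrow> act_\<aa> g 1 = 1"
  using act_\<aa>_algebra by (simp_all add: \<aa>.algebra_endomorphism_def)

lemma act_A_0 [simp]: "g \<in> carrier G \<Longrightarrow> act_A g 0 = 0"
  using act_A_scale[of g 0 0] by simp

lemma act_A_diff [simp]: "g \<in> carrier G \<Longrightarrow> act_A g (f - f') = act_A g f - act_A g f'"
  by (metis add_diff_cancel diff_add_cancel act_A_add)

lemma act_A_sum: "g \<in> carrier G \<Longrightarrow> act_A g (\<Sum>i\<in>S. f i) = (\<Sum>i\<in>S. act_A g (f i))"
  by (induction S rule: infinite_finite_induct) simp_all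

lemma act_A_prod: "g \<in> carrier G \<Longrightarrow> act_A g (\<Prod>i\<in>S. f i) = (\<Prod>i\<in>S. act_A g (f i))"
  by (induction S rule: infinite_finite_induct) simp_all

lemma act_A_comp:
  "g \<in> carrier G \<Longrightarrow> h \<in> carrier G \<Longrightarrow> act_A (g \<otimes>\<^bsub>G\<^esub> h) f = act_A g (act_A h f)"
  by (simp add: action_A.composition_rule)

lemma act_\<aa>_comp:
  "g \<in> carrier G \<Longrightarrow> h \<in> carrier G \<Longrightarrow> act_\<aa> (g \<otimes>\<^bsub>G\<^esub> h) a = act_\<aa> g (act_\<aa> h a)"
  by (simp add: action_\<aa>.composition_rule)

lemma act_A_one [simp]: "act_A \<one>\<^bsub>G\<^esub> f = f"
  using action_A.id_eq_one by (metis UNIV_I restrict_apply')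

lemma act_\<aa>_one [simp]: "act_\<aa> \<one>\<^bsub>G\<^esub> a = a"
  using action_\<aa>.id_eq_one by (metis UNIV_I restrict_apply')

lemma act_A_inv [simp]:
  "g \<in> carrier G \<Longrightarrow> act_A (inv\<^bsub>G\<^esub> g) (act_A g f) = f"
  "g \<in> carrier G \<Longrightarrow> act_A g (act_A (inv\<^bsub>G\<^esub> g) f) = f"
  by (simp_all flip: act_A_comp)

lemma act_\<aa>_inv [simp]:
  "g \<in> carrier G \<Longrightarrow> act_\<aa> (inv\<^bsub>G\<^esub> g) (act_\<aa> g a) = a"
  "g \<in> carrier G \<Longrightarrow> act_\<aa> g (act_\<aa> (inv\<^bsub>G\<^esub> g) a) = a"
  by (simp_all flip: act_\<aa>_comp)

lemma sum_translate: "h \<in> carrier G \<Longrightarrow> (\<Sum>g\<in>carrier G. F (h \<otimes>\<^bsub>G\<^esub> g)) = (\<Sum>g\<in>carrier G. F g)"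
  by (rule sum.reindex_bij_witness[of _ "\<lambda>g. inv\<^bsub>G\<^esub> h \<otimes>\<^bsub>G\<^esub> g" "\<lambda>g. h \<otimes>\<^bsub>G\<^esub> g"])
    (auto simp: G.m_assoc[symmetric])

text \<open>By Lagrange, the order of a stabilizer is invertible in the field along with the order of the
  group.\<close>
lemma of_nat_card_subgroup:
  assumes "subgroup H G"
  shows "(of_nat (card H) :: 'k) \<noteq> 0"
proof
  assume "(of_nat (card H) :: 'k) = 0"
  then have "CHAR('k) dvd card H" by (simp add: of_nat_eq_0_iff_char_dvd)
  then show False using order_G G.lagrange[OF assms] by (metis dvd_mult)
qed

text \<open>Everything about rational points follows from this description: an ideal is a rational point
  iff it is proper and each function is congruent to a scalar. The scalar is unique and depends
  multiplicatively on the function, which gives both primeness and the isomorphism \<open>A/x \<cong> k\<close>.\<close>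
lemma X_rat_iff:
  "x \<in> X_rat \<longleftrightarrow> ideal_set x \<and> 1 \<notin> x \<and> (\<forall>f. \<exists>c. f - scale_A c 1 \<in> x)"
proof
  assume x: "x \<in> X_rat"
  then have "primeideal x (ring_of :: 'x ring)" by (simp add: X_rat_def X_def)
  then interpret primeideal x "ring_of :: 'x ring" .
  have I: "ideal_set x" using ideal_ring_of_iff is_ideal by blast
  obtain h where h: "h \<in> ring_iso ((ring_of :: 'x ring) Quot x) (ring_of :: 'k ring)"
    "\<And>c f. h (x +>\<^bsub>ring_of\<^esub> scale_A c f) = c * h (x +>\<^bsub>ring_of\<^esub> f)"
    using x by (auto simp: X_rat_def)
  have "1 \<notin> x" using one_imp_carrier I_notcarr by auto
  moreover have "\<exists>c. f - scale_A c 1 \<in> x" for f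
  proof
    let ?c = "h (x +>\<^bsub>ring_of\<^esub> f)"
    have "h (x +>\<^bsub>ring_of\<^esub> 1) = 1"
      using h(1) ring_hom_one[of h "(ring_of :: 'x ring) Quot x" "ring_of :: 'k ring"]
      by (simp add: ring_iso_def FactRing_def)
    then have "h (x +>\<^bsub>ring_of\<^esub> scale_A ?c 1) = h (x +>\<^bsub>ring_of\<^esub> f)" by (simp add: h(2))
    moreover have "inj_on h (carrier ((ring_of :: 'x ring) Quot x))"
      using h(1) by (simp add: ring_iso_def bij_betw_def)
    moreover have "x +>\<^bsub>ring_of\<^esub> f' \<in> carrier ((ring_of :: 'x ring) Quot x)" for f'
      by (auto simp: FactRing_def A_RCOSETS_def')
    ultimately have "x +>\<^bsub>ring_of\<^esub> f = x +>\<^bsub>ring_of\<^esub> scale_A ?c 1" by (metis inj_onD)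
    then show "f - scale_A ?c 1 \<in> x" by (simp add: coset_ring_of_eq_iff[OF I])
  qed
  ultimately show "ideal_set x \<and> 1 \<notin> x \<and> (\<forall>f. \<exists>c. f - scale_A c 1 \<in> x)" using I by blast
next
  assume x: "ideal_set x \<and> 1 \<notin> x \<and> (\<forall>f. \<exists>c. f - scale_A c 1 \<in> x)"
  then have I: "ideal_set x" and one: "1 \<notin> x" by auto
  have add: "f + g \<in> x" if "f \<in> x" "g \<in> x" for f g using I that by (simp add: ideal_set_def)
  have mult: "g * f \<in> x" if "f \<in> x" for f g using I that by (simp add: ideal_set_def)
  obtain u where u: "f - scale_A (u f) 1 \<in> x" for f using x by metis
  have scalar: "c = d" if "scale_A c 1 - scale_A d 1 \<in> x" for c d
  proof (rule ccontr)
    assume "c \<noteq> d"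
    have "scale_A (inverse (c - d)) 1 * scale_A (c - d) 1 \<in> x"
      using that by (intro mult) (simp add: A.scale_left_diff_distrib)
    then show False using \<open>c \<noteq> d\<close> one by (simp add: A.mult_scale_left)
  qed
  have uI: "u f = c" if "f - scale_A c 1 \<in> x" for f c
    using scalar[of "u f" c] ideal_set_diff[OF I that u[of f]] by simp
  have u_add: "u (f + g) = u f + u g" for f g
    using add[OF u[of f] u[of g]] by (intro uI) (simp add: A.scale_left_distrib algebra_simps)
  have u_scale: "u (scale_A c f) = c * u f" for c f
    using mult[OF u[of f], of "scale_A c 1"]
    by (intro uI) (simp add: A.mult_scale_left A.scale_right_diff_distrib)
  have u_mult: "u (f * g) = u f * u g" for f g
  proof (rule uI)
    have "f * g - scale_A (u f * u g) 1
        = g * (f - scale_A (u f) 1) + scale_A (u f) 1 * (g - scale_A (u g) 1)"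
      by (simp add: algebra_simps A.mult_scale_left A.mult_scale_right)
    then show "f * g - scale_A (u f * u g) 1 \<in> x" using add mult u by metis
  qed
  have u_scalar: "u (scale_A c 1) = c" for c
    by (rule uI) (use I in \<open>simp add: ideal_set_def\<close>)
  have u_0: "u f = 0 \<longleftrightarrow> f \<in> x" for f using u[of f] uI[of f 0] by auto
  have u_1: "u 1 = 1" using u_scalar[of 1] by simp
  have u_diff: "u (f - g) = u f - u g" for f g by (metis add_diff_cancel diff_add_cancel u_add)
  have ideal: "ideal x (ring_of :: 'x ring)" using I by (simp add: ideal_ring_of_iff)
  interpret ideal x "ring_of :: 'x ring" by fact
  have prime: "primeideal x (ring_of :: 'x ring)"
    by (rule primeidealI[OF ideal cring_ring_of]) (use one in \<open>auto simp flip: u_0 simp: u_mult\<close>)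
  define h where "h C = u (SOME f. C = x +>\<^bsub>ring_of\<^esub> f)" for C
  have h: "h (x +>\<^bsub>ring_of\<^esub> f) = u f" for f
  proof -
    define g where "g = (SOME g. x +>\<^bsub>ring_of\<^esub> f = x +>\<^bsub>ring_of\<^esub> g)"
    have "x +>\<^bsub>ring_of\<^esub> f = x +>\<^bsub>ring_of\<^esub> g" unfolding g_def by (rule someI[of _ f]) simp
    then have "u (f - g) = 0" by (simp add: coset_ring_of_eq_iff[OF I] u_0)
    then show ?thesis by (simp add: h_def g_def[symmetric] u_diff)
  qed
  have car: "carrier ((ring_of :: 'x ring) Quot x) = range (\<lambda>f. x +>\<^bsub>ring_of\<^esub> f)"
    by (auto simp: FactRing_def A_RCOSETS_def')
  have "h \<in> ring_iso ((ring_of :: 'x ring) Quot x) (ring_of :: 'k ring)"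
  proof (rule ring_iso_memI)
    fix C D assume "C \<in> carrier ((ring_of :: 'x ring) Quot x)"
      "D \<in> carrier ((ring_of :: 'x ring) Quot x)"
    then obtain f g where fg: "C = x +>\<^bsub>ring_of\<^esub> f" "D = x +>\<^bsub>ring_of\<^esub> g" by (auto simp: car)
    show "h (C \<otimes>\<^bsub>ring_of Quot x\<^esub> D) = h C \<otimes>\<^bsub>ring_of\<^esub> h D"
      using rcoset_mult_add[of f g] by (simp add: fg FactRing_def h u_mult)
    show "h (C \<oplus>\<^bsub>ring_of Quot x\<^esub> D) = h C \<oplus>\<^bsub>ring_of\<^esub> h D"
      using a_rcos_sum[of f g] by (simp add: fg FactRing_def h u_add)
  next
    show "h \<one>\<^bsub>ring_of Quot x\<^esub> = \<one>\<^bsub>ring_of\<^esub>"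
      by (simp add: FactRing_def h u_1)
    show "bij_betw h (carrier ((ring_of :: 'x ring) Quot x)) (carrier (ring_of :: 'k ring))"
      unfolding bij_betw_def
    proof
      show "inj_on h (carrier ((ring_of :: 'x ring) Quot x))"
      proof (rule inj_onI)
        fix C D assume CD: "C \<in> carrier ((ring_of :: 'x ring) Quot x)"
          "D \<in> carrier ((ring_of :: 'x ring) Quot x)" "h C = h D"
        then obtain f g where fg: "C = x +>\<^bsub>ring_of\<^esub> f" "D = x +>\<^bsub>ring_of\<^esub> g" by (auto simp: car)
        show "C = D"
          using CD(3) unfolding fg coset_ring_of_eq_iff[OF I] by (simp add: h u_diff flip: u_0)
      qed
      show "h ` carrier ((ring_of :: 'x ring) Quot x) = carrier (ring_of :: 'k ring)"
        using surjI[of u, OF u_scalar] by (simp add: car h image_image)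
    qed
  qed simp
  moreover have "\<forall>c f. h (x +>\<^bsub>ring_of\<^esub> scale_A c f) = c * h (x +>\<^bsub>ring_of\<^esub> f)"
    by (simp only: h u_scale simp_thms)
  ultimately show "x \<in> X_rat"
    unfolding X_rat_def X_def using prime by blast
qed

lemma X_rat_ideal_set: "x \<in> X_rat \<Longrightarrow> ideal_set x"
  by (simp add: X_rat_iff)

lemma val_eqI:
  assumes x: "x \<in> X_rat" and f: "f - scale_A c 1 \<in> x"
  shows "val x f = c"
  unfolding val_def
proof (rule the_equality)
  show "f - scale_A c 1 \<in> x" by (rule f)
  fix d assume d: "f - scale_A d 1 \<in> x"
  show "d = c"
  proof (rule ccontr)
    assume "d \<noteq> c"
    have "scale_A (c - d) 1 \<in> x"
      using ideal_set_diff[OF X_rat_ideal_set[OF x] d f] by (simp add: A.scale_left_diff_distrib)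
    then have "scale_A (inverse (c - d)) 1 * scale_A (c - d) 1 \<in> x"
      using x by (simp add: X_rat_iff ideal_set_def)
    then show False using \<open>d \<noteq> c\<close> x by (simp add: A.mult_scale_left X_rat_iff)
  qed
qed

lemma val_diff_mem: "x \<in> X_rat \<Longrightarrow> f - scale_A (val x f) 1 \<in> x"
  using val_eqI X_rat_iff by metis

context
  fixes x assumes x: "x \<in> X_rat"
begin

lemma val_add: "val x (f + g) = val x f + val x g"
proof -
  have "(f - scale_A (val x f) 1) + (g - scale_A (val x g) 1) \<in> x"
    using x val_diff_mem[OF x] by (simp add: X_rat_iff ideal_set_def)
  then show ?thesis by (intro val_eqI[OF x]) (simp add: A.scale_left_distrib algebra_simps)
qed

lemma val_mult: "val x (f * g) = val x f * val x g"
proof (rule val_eqI[OF x])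
  have "f * g - scale_A (val x f * val x g) 1
      = g * (f - scale_A (val x f) 1) + scale_A (val x f) 1 * (g - scale_A (val x g) 1)"
    by (simp add: algebra_simps A.mult_scale_left A.mult_scale_right)
  then show "f * g - scale_A (val x f * val x g) 1 \<in> x"
    using x val_diff_mem[OF x] by (simp add: X_rat_iff ideal_set_def)
qed

lemma val_scalar [simp]: "val x (scale_A c 1) = c"
  using x by (intro val_eqI) (simp_all add: X_rat_iff ideal_set_def)

lemma val_1 [simp]: "val x 1 = 1"
  using val_scalar[of 1] by simp

lemma val_scale: "val x (scale_A c f) = c * val x f"
  using val_mult[of "scale_A c 1" f] by (simp add: A.mult_scale_left)

lemma val_eq_0_iff: "val x f = 0 \<longleftrightarrow> f \<in> x"
  using val_diff_mem[OF x, of f] val_eqI[OF x, of f 0] by auto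

lemma val_diff: "val x (f - g) = val x f - val x g"
  by (metis add_diff_cancel diff_add_cancel val_add)

lemma val_0 [simp]: "val x 0 = 0"
  using val_scale[of 0 0] by simp

lemma val_sum: "val x (\<Sum>i\<in>S. f i) = (\<Sum>i\<in>S. val x (f i))"
  by (induction S rule: infinite_finite_induct) (simp_all add: val_add)

lemma val_prod: "val x (\<Prod>i\<in>S. f i) = (\<Prod>i\<in>S. val x (f i))"
  by (induction S rule: infinite_finite_induct) (simp_all add: val_mult)

end

lemma act_X_mem_iff: "g \<in> carrier G \<Longrightarrow> act_A g f \<in> act_X g x \<longleftrightarrow> f \<in> x"
  unfolding act_X_def by (metis act_A_inv(1) image_iff)

lemma mem_act_X: "g \<in> carrier G \<Longrightarrow> f \<in> act_X g x \<longleftrightarrow> act_A (inv\<^bsub>G\<^esub> g) f \<in> x"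
  using act_X_mem_iff[of g "act_A (inv\<^bsub>G\<^esub> g) f" x] by simp

lemma act_X_X_rat:
  assumes "g \<in> carrier G" "x \<in> X_rat"
  shows "act_X g x \<in> X_rat"
  unfolding X_rat_iff ideal_set_def
proof (intro conjI ballI allI)
  fix f
  obtain c where "act_A (inv\<^bsub>G\<^esub> g) f - scale_A c 1 \<in> x" using assms by (auto simp: X_rat_iff)
  then show "\<exists>c. f - scale_A c 1 \<in> act_X g x" using assms by (auto simp: mem_act_X)
qed (use assms in \<open>auto simp: mem_act_X X_rat_iff ideal_set_def\<close>)

lemma val_act: "g \<in> carrier G \<Longrightarrow> x \<in> X_rat \<Longrightarrow> val (act_X g x) (act_A g f) = val x f"
  using val_diff_mem[of x f]
  by (intro val_eqI act_X_X_rat) (simp_all add: mem_act_X)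

lemma act_X_comp:
  "g \<in> carrier G \<Longrightarrow> h \<in> carrier G \<Longrightarrow> act_X (g \<otimes>\<^bsub>G\<^esub> h) x = act_X g (act_X h x)"
  by (simp add: act_X_def image_image act_A_comp)

lemma act_X_one [simp]: "act_X \<one>\<^bsub>G\<^esub> x = x"
  by (simp add: act_X_def)

lemma act_X_inv [simp]:
  "g \<in> carrier G \<Longrightarrow> act_X (inv\<^bsub>G\<^esub> g) (act_X g x) = x"
  "g \<in> carrier G \<Longrightarrow> act_X g (act_X (inv\<^bsub>G\<^esub> g) x) = x"
  by (simp_all flip: act_X_comp)

lemma subgroup_stabilizer: "subgroup (stabilizer G act_X x) G"
proof (rule G.subgroupI)
  show "stabilizer G act_X x \<noteq> {}" using act_X_one[of x] by (auto simp: stabilizer_def)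
  show "inv\<^bsub>G\<^esub> g \<in> stabilizer G act_X x" if "g \<in> stabilizer G act_X x" for g
    using that act_X_inv(1)[of g x] by (auto simp: stabilizer_def)
qed (auto simp: stabilizer_def act_X_comp)

text \<open>Rational points are maximal ideals, so for \<open>y \<noteq> x\<close> some function vanishes at \<open>y\<close> and has value
  \<open>1\<close> at \<open>x\<close>; the product of these functions over \<open>P\<close> works.\<close>
lemma separating_function:
  assumes x: "x \<in> X_rat" and P: "finite P" "P \<subseteq> X_rat" "x \<notin> P"
  obtains f where "val x f = 1" "\<And>y. y \<in> P \<Longrightarrow> val y f = 0"
proof -
  have "\<exists>f. val x f = 1 \<and> val y f = 0" if "y \<in> P" for y
  proof -
    have y: "y \<in> X_rat" "x \<noteq> y" using that P by auto
    have "\<exists>g. g \<in> y \<and> g \<notin> x"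
    proof (rule ccontr)
      assume "\<nexists>g. g \<in> y \<and> g \<notin> x"
      then have sub: "y \<subseteq> x" by blast
      moreover have "f \<in> y" if "f \<in> x" for f
      proof -
        have "f - scale_A (val y f) 1 \<in> x" using val_diff_mem[OF y(1)] sub by blast
        then have "val x f = val y f" by (rule val_eqI[OF x])
        then show ?thesis using that val_eq_0_iff[OF x] val_eq_0_iff[OF y(1)] by metis
      qed
      ultimately show False using y by blast
    qed
    then obtain g where "val y g = 0" "val x g \<noteq> 0"
      using val_eq_0_iff[OF x] val_eq_0_iff[OF y(1)] by metis
    then have "val x (scale_A (inverse (val x g)) g) = 1 \<and> val y (scale_A (inverse (val x g)) g) = 0"
      by (simp add: val_scale x y)
    then show ?thesis by blast
  qed
  then obtain F where F: "\<And>y. y \<in> P \<Longrightarrow> val x (F y) = 1 \<and> val y (F y) = 0" by metis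
  show ?thesis
  proof
    show "val x (\<Prod>y\<in>P. F y) = 1" using F by (simp add: val_prod x)
    show "val y (\<Prod>y\<in>P. F y) = 0" if "y \<in> P" for y
    proof -
      have "y \<in> X_rat" using that P by blast
      then show ?thesis using F that P by (auto simp: val_prod intro!: prod_zero)
    qed
  qed
qed

section \<open>Evaluation at rational points\<close>

text \<open>Evaluation on representatives; \<open>ev_tensor_class\<close> shows that it induces \<open>ev\<close>.\<close>
definition ev_rep :: "'x set \<Rightarrow> (('a \<times> 'x) \<Rightarrow>\<^sub>0 'k) \<Rightarrow> 'a" where
  "ev_rep x = linear_extension scale_\<aa> (\<lambda>(a, f). scale_\<aa> (val x f) a)"

lemma ev_rep_linear:
  "ev_rep x (p + q) = ev_rep x p + ev_rep x q"
  "ev_rep x (p - q) = ev_rep x p - ev_rep x q"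
  "ev_rep x (free_scale c p) = scale_\<aa> c (ev_rep x p)"
  by (simp_all add: ev_rep_def \<aa>.linear_extension_add \<aa>.linear_extension_diff
      \<aa>.linear_extension_scale)

lemma ev_rep_pure [simp]: "ev_rep x (pure a f) = scale_\<aa> (val x f) a"
  by (simp add: ev_rep_def)

lemma ev_rep_sum: "ev_rep x (\<Sum>i\<in>S. p i) = (\<Sum>i\<in>S. ev_rep x (p i))"
  using ev_rep_linear(2)[of x 0 0]
  by (induction S rule: infinite_finite_induct) (simp_all add: ev_rep_linear)

lemma ev_rep_N:
  assumes "x \<in> X_rat" "p \<in> tensor.N"
  shows "ev_rep x p = 0"
proof -
  have "ev_rep x 0 = 0" using ev_rep_linear(2)[of x 0 0] by simp
  then have "free.subspace {p. ev_rep x p = 0}"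
    by (intro free.subspaceI) (auto simp: ev_rep_linear)
  then have "tensor.N \<subseteq> {p. ev_rep x p = 0}"
    by (rule tensor.N_minimal)
      (simp_all add: ev_rep_linear val_add val_scale assms \<aa>.scale_right_distrib
        \<aa>.scale_left_distrib mult.commute)
  then show ?thesis using assms by blast
qed

lemma ev_rep_mult:
  assumes "x \<in> X_rat"
  shows "ev_rep x (pair_mult p q) = ev_rep x p * ev_rep x q"
proof (induction p rule: pure_induct)
  case (pure a f)
  show ?case
    by (induction q rule: pure_induct)
      (simp_all add: assms val_mult pair_mult_linear ev_rep_linear \<aa>.mult_scale_left
        \<aa>.mult_scale_right distrib_left mult.commute)
qed (simp_all add: pair_mult_linear ev_rep_linear distrib_right \<aa>.mult_scale_left)

lemma ev_tensor_class:
  assumes "x \<in> X_rat"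
  shows "ev x (tensor.tensor_class p) = ev_rep x p"
proof -
  have "ev_rep x q = ev_rep x p" if "q \<in> tensor.tensor_class p" for q
    using that ev_rep_N[OF assms, of "q - p"] by (simp add: tensor.mem_tensor_class ev_rep_linear)
  then have "ev_rep x ` tensor.tensor_class p = {ev_rep x p}"
    using tensor.tensor_class_self[of p] by blast
  then show ?thesis by (simp add: ev_def ev_rep_def)
qed

lemma act_pairs_linear:
  "act_pairs g (p + q) = act_pairs g p + act_pairs g q"
  "act_pairs g (p - q) = act_pairs g p - act_pairs g q"
  "act_pairs g (free_scale c p) = free_scale c (act_pairs g p)"
  by (simp_all add: act_pairs_def free_linear_simps)

lemma act_pairs_pure [simp]: "act_pairs g (pure a f) = pure (act_\<aa> g a) (act_A g f)"
  by (simp add: act_pairs_def)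

lemma act_pairs_sum: "act_pairs g (\<Sum>i\<in>S. p i) = (\<Sum>i\<in>S. act_pairs g (p i))"
  using act_pairs_linear(2)[of g 0 0]
  by (induction S rule: infinite_finite_induct) (simp_all add: act_pairs_linear)

lemma act_pairs_comp:
  assumes "g \<in> carrier G" "h \<in> carrier G"
  shows "act_pairs (g \<otimes>\<^bsub>G\<^esub> h) p = act_pairs g (act_pairs h p)"
  by (induction p rule: pure_induct)
    (simp_all add: act_pairs_linear assms act_A_comp act_\<aa>_comp)

lemma act_pairs_mult:
  assumes "g \<in> carrier G"
  shows "act_pairs g (pair_mult p q) = pair_mult (act_pairs g p) (act_pairs g q)"
proof (induction p rule: pure_induct)
  case (pure a f)
  show ?case
    by (induction q rule: pure_induct)
      (simp_all add: assms pair_mult_linear act_pairs_linear)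
qed (simp_all add: pair_mult_linear act_pairs_linear)

lemma act_pairs_N:
  assumes "g \<in> carrier G" "p \<in> tensor.N"
  shows "act_pairs g p \<in> tensor.N"
proof -
  have "act_pairs g 0 = 0" using act_pairs_linear(2)[of g 0 0] by simp
  then have "free.subspace {p. act_pairs g p \<in> tensor.N}"
    using tensor.subspace_N
    by (intro free.subspaceI) (auto simp: act_pairs_linear free.subspace_def)
  then have "tensor.N \<subseteq> {p. act_pairs g p \<in> tensor.N}"
    by (rule tensor.N_minimal)
      (simp_all add: act_pairs_linear assms tensor.N_add_left tensor.N_add_right
        tensor.N_scale_left tensor.N_scale_right)
  then show ?thesis using assms by blast
qed

lemma act_tensor_class:
  assumes "g \<in> carrier G"
  shows "act_tensor g (tensor.tensor_class p) = tensor.tensor_class (act_pairs g p)"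
  unfolding act_tensor_def tensor.tensor_class_def[symmetric]
  by (rule tensor.Union_tensor_class) (simp add: act_pairs_N assms flip: act_pairs_linear)

lemma ev_rep_act:
  assumes "g \<in> carrier G" "x \<in> X_rat"
  shows "ev_rep (act_X g x) (act_pairs g p) = act_\<aa> g (ev_rep x p)"
  by (induction p rule: pure_induct) (simp_all add: assms val_act act_pairs_linear ev_rep_linear)

section \<open>Equivariant maps\<close>

text \<open>A representative need only be fixed up to the bilinearity relations for its class to be fixed.\<close>
definition equivariant :: "(('a \<times> 'x) \<Rightarrow>\<^sub>0 'k) \<Rightarrow> bool" where
  "equivariant p \<longleftrightarrow> (\<forall>g\<in>carrier G. act_pairs g p - p \<in> tensor.N)"

lemma carrier_map_alg: "carrier map_alg = tensor.tensor_class ` Collect equivariant"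
proof -
  have "(\<forall>g\<in>carrier G. act_tensor g (tensor.tensor_class p) = tensor.tensor_class p) \<longleftrightarrow> equivariant p"
    for p
    by (simp add: equivariant_def act_tensor_class tensor.tensor_class_eq_iff)
  then show ?thesis unfolding map_alg_def tensor.carrier_T by simp blast
qed

lemma map_alg_ops:
  "tensor.tensor_class p \<oplus>\<^bsub>map_alg\<^esub> tensor.tensor_class q = tensor.tensor_class (p + q)"
  "tensor.tensor_class p \<otimes>\<^bsub>map_alg\<^esub> tensor.tensor_class q = tensor.tensor_class (pair_mult p q)"
  "c \<odot>\<^bsub>map_alg\<^esub> tensor.tensor_class p = tensor.tensor_class (free_scale c p)"
  "\<one>\<^bsub>map_alg\<^esub> = tensor.tensor_class (pure 1 1)"
  by (simp_all add: map_alg_def tensor.add_T tensor.mult_T tensor.smult_T tensor.one_T)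

lemma equivariant_add: "equivariant p \<Longrightarrow> equivariant q \<Longrightarrow> equivariant (p + q)"
  unfolding equivariant_def act_pairs_linear add_diff_add
  by (simp add: free.subspace_add tensor.subspace_N)

lemma equivariant_scale: "equivariant p \<Longrightarrow> equivariant (free_scale c p)"
  unfolding equivariant_def act_pairs_linear free.scale_right_diff_distrib[symmetric]
  by (simp add: free.subspace_scale tensor.subspace_N)

lemma equivariant_mult:
  assumes "equivariant p" "equivariant q"
  shows "equivariant (pair_mult p q)"
  unfolding equivariant_def
proof
  fix g assume g: "g \<in> carrier G"
  have "act_pairs g (pair_mult p q) - pair_mult p q =
    pair_mult (act_pairs g p - p) (act_pairs g q) + pair_mult p (act_pairs g q - q)"
    by (simp add: act_pairs_mult g pair_mult_diff_left pair_mult_diff_right)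
  then show "act_pairs g (pair_mult p q) - pair_mult p q \<in> tensor.N"
    using assms g
    by (simp add: equivariant_def free.subspace_add tensor.subspace_N tensor.N_ideal)
qed

lemma equivariant_const: "(\<And>g. g \<in> carrier G \<Longrightarrow> act_A g f = f) \<Longrightarrow> equivariant (pure 1 f)"
  by (simp add: equivariant_def free.subspace_0 tensor.subspace_N)

definition average :: "(('a \<times> 'x) \<Rightarrow>\<^sub>0 'k) \<Rightarrow> (('a \<times> 'x) \<Rightarrow>\<^sub>0 'k)" where
  "average p = free_scale (inverse (of_nat (card (carrier G)))) (\<Sum>g\<in>carrier G. act_pairs g p)"

lemma act_sum_act:
  "h \<in> carrier G \<Longrightarrow>
    act_pairs h (\<Sum>g\<in>carrier G. act_pairs g p) = (\<Sum>g\<in>carrier G. act_pairs g p)"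
  using sum_translate[of h "\<lambda>g. act_pairs g p"]
  by (simp add: act_pairs_sum act_pairs_comp)

lemma equivariant_sum_act: "equivariant (\<Sum>g\<in>carrier G. act_pairs g p)"
  by (simp add: equivariant_def act_sum_act free.subspace_0 tensor.subspace_N)

lemma equivariant_average: "equivariant (average p)"
  unfolding average_def by (intro equivariant_scale equivariant_sum_act)

lemma average_linear:
  "average (p + q) = average p + average q"
  "average (free_scale c p) = free_scale c (average p)"
  by (simp_all add: average_def act_pairs_linear sum.distrib free.scale_right_distrib
      mult.commute flip: free.scale_sum_right)

lemma of_nat_card_G: "(of_nat (card (carrier G)) :: 'k) \<noteq> 0"
  using of_nat_card_subgroup[OF G.subgroup_self] .

lemma average_equivariant:
  assumes "equivariant p"
  shows "average p - p \<in> tensor.N"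
proof -
  let ?n = "of_nat (card (carrier G)) :: 'k"
  have const: "(\<Sum>g\<in>carrier G. p) = free_scale ?n p"
    using finite_G by (simp add: free.sum_constant_scale)
  have "p = free_scale (inverse ?n) (free_scale ?n p)" using of_nat_card_G by simp
  also have "\<dots> = free_scale (inverse ?n) (\<Sum>g\<in>carrier G. p)" by (simp only: const)
  finally have "average p - p = free_scale (inverse ?n) (\<Sum>g\<in>carrier G. act_pairs g p - p)"
    unfolding average_def sum_subtractf free.scale_right_diff_distrib by simp
  also have "\<dots> \<in> tensor.N"
    using assms unfolding equivariant_def
    by (intro free.subspace_scale free.subspace_sum tensor.subspace_N) auto
  finally show ?thesis .
qed

lemma average_N: "p \<in> tensor.N \<Longrightarrow> average p \<in> tensor.N"
  unfolding average_def
  by (intro free.subspace_scale free.subspace_sum tensor.subspace_N act_pairs_N) auto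

lemma ev_rep_equivariant:
  assumes "equivariant p" "g \<in> carrier G" "x \<in> X_rat"
  shows "ev_rep (act_X g x) p = act_\<aa> g (ev_rep x p)"
proof -
  have "ev_rep (act_X g x) (act_pairs g p - p) = 0"
    using assms by (intro ev_rep_N act_X_X_rat) (simp_all add: equivariant_def)
  then show ?thesis using ev_rep_act[OF assms(2,3), of p] by (simp add: ev_rep_linear)
qed

lemma fixed_alg_simps [simp]:
  "carrier (fixed_alg x) = {a. \<forall>g \<in> stabilizer G act_X x. act_\<aa> g a = a}"
  "monoid.mult (fixed_alg x) = (*)" "one (fixed_alg x) = 1" "add (fixed_alg x) = (+)"
  "module.smult (fixed_alg x) = scale_\<aa>"
  by (simp_all add: fixed_alg_def alg_of_def)

lemma ev_hom:
  assumes x: "x \<in> X_rat"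
  shows "algebra_hom map_alg (fixed_alg x) (ev x)"
proof -
  have "ev_rep x p \<in> carrier (fixed_alg x)" if "equivariant p" for p
    using ev_rep_equivariant[OF that _ x, symmetric] by (simp add: stabilizer_def)
  then show ?thesis
    unfolding algebra_hom_def carrier_map_alg
    by (auto simp: map_alg_ops ev_tensor_class x ev_rep_linear ev_rep_mult)
qed

text \<open>Take a function \<open>f\<close> with value \<open>1\<close> at \<open>x\<close> that vanishes at all other points of the orbits
  of \<open>x\<close> and of the points in \<open>Y\<close>, and sum \<open>b \<otimes> f\<close> over the group. At \<open>x\<close> only the terms of the
  stabilizer survive, and each of them is \<open>b\<close>.\<close>
lemma equivariant_interpolation:
  assumes x: "x \<in> X_rat" and b: "b \<in> carrier (fixed_alg x)"
    and Y: "finite Y" "Y \<subseteq> X_rat" "\<And>y g. y \<in> Y \<Longrightarrow> g \<in> carrier G \<Longrightarrow> act_X g y \<noteq> x"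
  obtains p where "equivariant p" "ev_rep x p = b" "\<And>y. y \<in> Y \<Longrightarrow> ev_rep y p = 0"
proof -
  define P where "P = (\<lambda>(g, y). act_X g y) ` (carrier G \<times> insert x Y) - {x}"
  have "finite P" "P \<subseteq> X_rat" "x \<notin> P"
    using finite_G Y x act_X_X_rat by (auto simp: P_def)
  then obtain f where f: "val x f = 1" "\<And>y. y \<in> P \<Longrightarrow> val y f = 0"
    using separating_function[OF x] by metis
  have fP: "val (act_X g y) f = 0" if "g \<in> carrier G" "y \<in> insert x Y" "act_X g y \<noteq> x" for g y
    using that by (intro f(2)) (auto simp: P_def)
  let ?S = "stabilizer G act_X x"
  \<comment> \<open>The factor makes up for the \<open>card ?S\<close> equal terms at \<open>x\<close>.\<close>
  define p where "p = free_scale (inverse (of_nat (card ?S)))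
    (\<Sum>g\<in>carrier G. act_pairs g (pure b f))"
  have ev_p: "ev_rep z p = scale_\<aa> (inverse (of_nat (card ?S)))
      (\<Sum>g\<in>carrier G. scale_\<aa> (val (act_X (inv\<^bsub>G\<^esub> g) z) f) (act_\<aa> g b))" if z: "z \<in> X_rat" for z
  proof -
    have "val z (act_A g f) = val (act_X (inv\<^bsub>G\<^esub> g) z) f" if "g \<in> carrier G" for g
      using val_act[OF that act_X_X_rat[OF _ z], of "inv\<^bsub>G\<^esub> g" f] that by simp
    then show ?thesis by (simp add: p_def ev_rep_linear ev_rep_sum)
  qed
  show ?thesis
  proof
    show "equivariant p" unfolding p_def by (intro equivariant_scale equivariant_sum_act)
    have "scale_\<aa> (val (act_X (inv\<^bsub>G\<^esub> g) x) f) (act_\<aa> g b) = (if g \<in> ?S then b else 0)"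
      if g: "g \<in> carrier G" for g
    proof (cases "g \<in> ?S")
      case True
      then have "act_X (inv\<^bsub>G\<^esub> g) x = x"
        using subgroup.m_inv_closed[OF subgroup_stabilizer True] by (simp add: stabilizer_def)
      then show ?thesis using True b f by simp
    next
      case False
      then have "act_X g x \<noteq> x" using g by (simp add: stabilizer_def)
      then have "act_X (inv\<^bsub>G\<^esub> g) x \<noteq> x"
        using act_X_inv(2)[OF g, of x] by metis
      then show ?thesis using False g fP[of "inv\<^bsub>G\<^esub> g" x] by simp
    qed
    then have "ev_rep x p = scale_\<aa> (inverse (of_nat (card ?S))) (\<Sum>g\<in>carrier G. if g \<in> ?S then b else 0)"
      using ev_p[OF x] by simp
    also have "(\<Sum>g\<in>carrier G. if g \<in> ?S then b else 0) = (\<Sum>g\<in>?S. b)"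
      using finite_G by (simp add: sum.If_cases stabilizer_def Int_def)
    also have "\<dots> = scale_\<aa> (of_nat (card ?S)) b" by (rule \<aa>.sum_constant_scale)
    finally show "ev_rep x p = b" using of_nat_card_subgroup[OF subgroup_stabilizer] by simp
    show "ev_rep y p = 0" if y: "y \<in> Y" for y
    proof -
      have "val (act_X (inv\<^bsub>G\<^esub> g) y) f = 0" if "g \<in> carrier G" for g
        using that y Y(3) by (intro fP) auto
      then show ?thesis using ev_p[of y] y Y(2) by auto
    qed
  qed
qed

lemma ev_surj:
  assumes x: "x \<in> X_rat"
  shows "ev x ` carrier map_alg = carrier (fixed_alg x)"
proof
  show "ev x ` carrier map_alg \<subseteq> carrier (fixed_alg x)"
    using ev_hom[OF x] by (auto simp: algebra_hom_def)
  show "carrier (fixed_alg x) \<subseteq> ev x ` carrier map_alg"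
  proof
    fix b assume "b \<in> carrier (fixed_alg x)"
    then obtain p where p: "equivariant p" "ev_rep x p = b"
      using equivariant_interpolation[OF x, of b "{}"] by auto
    then have "b = ev x (tensor.tensor_class p)" by (simp add: ev_tensor_class[OF x])
    then show "b \<in> ev x ` carrier map_alg"
      unfolding carrier_map_alg using p(1) by blast
  qed
qed

end

context equivariant_map_data
begin

lemma map_alg_closed:
  "\<alpha> \<in> carrier map_alg \<Longrightarrow> \<beta> \<in> carrier map_alg \<Longrightarrow> \<alpha> \<oplus>\<^bsub>map_alg\<^esub> \<beta> \<in> carrier map_alg"
  "\<alpha> \<in> carrier map_alg \<Longrightarrow> \<beta> \<in> carrier map_alg \<Longrightarrow> \<alpha> \<otimes>\<^bsub>map_alg\<^esub> \<beta> \<in> carrier map_alg"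
  "\<alpha> \<in> carrier map_alg \<Longrightarrow> c \<odot>\<^bsub>map_alg\<^esub> \<alpha> \<in> carrier map_alg"
  "\<one>\<^bsub>map_alg\<^esub> \<in> carrier map_alg"
  unfolding carrier_map_alg
  by (auto simp: map_alg_ops equivariant_add equivariant_mult equivariant_scale equivariant_const)

section \<open>The invariants are integral\<close>

text \<open>Expand \<open>0 = \<Prod>\<gamma>. (f - \<gamma> f)\<close> in powers of the first \<open>f\<close>: the coefficients are the elementary symmetric
  functions of the translates \<open>- \<gamma> f\<close>.\<close>
lemma monic_invariant_relation:
  obtains E :: "nat \<Rightarrow> 'x" where "E (card (carrier G)) = 1"
    "\<And>i g. g \<in> carrier G \<Longrightarrow> act_A g (E i) = E i"
    "(\<Sum>i\<le>card (carrier G). f ^ i * E i) = 0"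
proof -
  define n where "n = card (carrier G)"
  define h where "h g = - act_A g f" for g
  \<comment> \<open>\<open>S i\<close> is indexed by the exponent of \<open>f\<close> in the expansion, so that \<open>E i\<close> is the coefficient of \<open>f ^ i\<close>.\<close>
  define S where "S i = {S \<in> Pow (carrier G). n - card S = i}" for i
  define E where "E i = (\<Sum>S\<in>S i. \<Prod>g\<in>S. h g)" for i
  have fin: "finite S" "card S \<le> n" if "S \<subseteq> carrier G" for S
    using that finite_G by (auto simp: n_def card_mono intro: finite_subset)
  have "S n = {{}}"
  proof -
    have "0 < n" using G.one_closed finite_G unfolding n_def card_gt_0_iff by blast
    then have "S = {}" if "S \<subseteq> carrier G" "n - card S = n" for S
      using that fin[of S] by (metis card_0_eq diff_less less_irrefl neq0_conv)
    then show ?thesis by (auto simp: S_def)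
  qed
  then have E_n: "E (card (carrier G)) = 1" by (simp add: E_def n_def[symmetric])
  have E_inv: "act_A k (E i) = E i" if k: "k \<in> carrier G" for k i
  proof -
    have h: "act_A k (h g) = h (k \<otimes>\<^bsub>G\<^esub> g)" if "g \<in> carrier G" for g
      using act_A_diff[OF k, of 0 "act_A g f"] k that by (simp add: h_def act_A_comp)
    have inj: "inj_on (\<lambda>g. k \<otimes>\<^bsub>G\<^esub> g) S" if "S \<subseteq> carrier G" for S
      using inj_on_subset[OF G.inj_on_cmult[OF k] that] .
    have prod: "act_A k (\<Prod>g\<in>S. h g) = (\<Prod>g\<in>(\<lambda>g. k \<otimes>\<^bsub>G\<^esub> g) ` S. h g)" if "S \<subseteq> carrier G" for S
      using that by (subst prod.reindex[OF inj]) (auto simp: act_A_prod k h intro!: prod.cong)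
    have cancel: "(\<lambda>g. a \<otimes>\<^bsub>G\<^esub> g) ` (\<lambda>g. b \<otimes>\<^bsub>G\<^esub> g) ` S = S"
      if "a \<otimes>\<^bsub>G\<^esub> b = \<one>\<^bsub>G\<^esub>" "a \<in> carrier G" "b \<in> carrier G" "S \<subseteq> carrier G" for a b S
    proof -
      have "a \<otimes>\<^bsub>G\<^esub> (b \<otimes>\<^bsub>G\<^esub> g) = g" if "g \<in> S" for g
        using that \<open>S \<subseteq> carrier G\<close> \<open>a \<otimes>\<^bsub>G\<^esub> b = \<one>\<^bsub>G\<^esub>\<close> \<open>a \<in> carrier G\<close> \<open>b \<in> carrier G\<close>
        by (subst G.m_assoc[symmetric]) auto
      then show ?thesis by (simp add: image_image)
    qed
    have Si: "T \<subseteq> carrier G" if "T \<in> S i" for T using that by (simp add: S_def)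
    have mem: "(\<lambda>g. a \<otimes>\<^bsub>G\<^esub> g) ` T \<in> S i" if "a \<in> carrier G" "T \<in> S i" for a T
    proof -
      have "inj_on (\<lambda>g. a \<otimes>\<^bsub>G\<^esub> g) T" using that
        by (intro inj_on_subset[OF G.inj_on_cmult]) (auto simp: S_def)
      then show ?thesis using that by (auto simp: S_def card_image)
    qed
    have "act_A k (E i) = (\<Sum>S\<in>S i. \<Prod>g\<in>(\<lambda>g. k \<otimes>\<^bsub>G\<^esub> g) ` S. h g)"
      unfolding E_def act_A_sum[OF k] by (rule sum.cong) (auto simp: prod S_def)
    also have "\<dots> = E i"
      unfolding E_def
      by (rule sum.reindex_bij_witness[of _ "image (\<lambda>g. inv\<^bsub>G\<^esub> k \<otimes>\<^bsub>G\<^esub> g)" "image (\<lambda>g. k \<otimes>\<^bsub>G\<^esub> g)"])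
        (use k in \<open>simp_all add: cancel mem Si\<close>)
    finally show ?thesis .
  qed
  \<comment> \<open>The factor of the neutral element is \<open>f - f\<close>.\<close>
  have "0 = (\<Prod>g\<in>carrier G. f + h g)"
    using prod.remove[OF finite_G G.one_closed, of "\<lambda>g. f + h g"] by (simp add: h_def)
  also have "\<dots> = (\<Sum>S\<in>Pow (carrier G). f ^ (n - card S) * (\<Prod>g\<in>S. h g))"
    unfolding n_def by (rule prod_add_expand[OF finite_G])
  also have "\<dots> = (\<Sum>i\<le>n. \<Sum>S\<in>S i. f ^ (n - card S) * (\<Prod>g\<in>S. h g))"
    unfolding S_def using finite_G by (intro sum.group[symmetric]) auto
  also have "\<dots> = (\<Sum>i\<le>n. f ^ i * E i)"
    unfolding E_def sum_distrib_left by (intro sum.cong) (auto simp: S_def)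
  finally have "(\<Sum>i\<le>card (carrier G). f ^ i * E i) = 0" by (simp add: n_def)
  then show ?thesis using E_n E_inv by (intro that)
qed

text \<open>Modulo \<open>x\<close>, the monic relation for \<open>f\<close> has scalar coefficients. It splits into linear factors \<open>f - c\<close>, one
  of which lies in the prime \<open>x\<close>.\<close>
lemma rational_of_scalar_invariants:
  assumes I: "ideal_set x" and one: "1 \<notin> x"
    and prime: "\<And>f g. f * g \<in> x \<Longrightarrow> f \<in> x \<or> g \<in> x"
    and scalar: "\<And>f. (\<And>g. g \<in> carrier G \<Longrightarrow> act_A g f = f) \<Longrightarrow> \<exists>c. f - scale_A c 1 \<in> x"
  shows "x \<in> X_rat"
  unfolding X_rat_iff
proof (intro conjI I one allI)
  fix f :: 'x
  define n where "n = card (carrier G)"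
  obtain E :: "nat \<Rightarrow> 'x" where E: "E n = 1" "\<And>i g. g \<in> carrier G \<Longrightarrow> act_A g (E i) = E i"
    "(\<Sum>i\<le>n. f ^ i * E i) = 0"
    using monic_invariant_relation[of f] unfolding n_def by metis
  \<comment> \<open>Taking the scalar \<open>1\<close> for the leading coefficient ensures that the polynomial \<open>p\<close> below is not zero.\<close>
  have "\<exists>c. E i - scale_A c 1 \<in> x \<and> (i = n \<longrightarrow> c = 1)" for i
    using scalar[OF E(2)] I by (cases "i = n") (auto simp: E(1) ideal_set_def intro: exI[of _ 1])
  then obtain c where c: "\<And>i. E i - scale_A (c i) 1 \<in> x" "c n = 1" by metis
  define p where "p = (\<Sum>i\<le>n. monom (c i) i)"
  have cp: "coeff p i = (if i \<le> n then c i else 0)" for i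
    by (auto simp: p_def coeff_sum sum.delta)
  have p0: "p \<noteq> 0" using cp[of n] c(2) by auto
  have pow: "(((*) f) ^^ i) 1 = f ^ i" for i by (induction i) simp_all
  have "poly_apply scale_A ((*) f) p 1 = (\<Sum>i\<le>n. scale_A (coeff p i) ((((*) f) ^^ i) 1))"
    by (rule A.poly_apply_bound, rule degree_le) (simp add: cp)
  also have "\<dots> = (\<Sum>i\<le>n. f ^ i * scale_A (c i) 1)"
    by (simp add: cp pow A.mult_scale_right)
  also have "\<dots> = - ((\<Sum>i\<le>n. f ^ i * E i) - (\<Sum>i\<le>n. f ^ i * scale_A (c i) 1))"
    by (simp add: E(3))
  also have "\<dots> = - (\<Sum>i\<le>n. f ^ i * (E i - scale_A (c i) 1))"
    by (simp add: sum_subtractf right_diff_distrib)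
  also have "\<dots> \<in> x"
    using c(1) I by (intro ideal_set_minus[OF I] ideal_set_sum[OF I]) (simp add: ideal_set_def)
  finally have p: "poly_apply scale_A ((*) f) p 1 \<in> x" .
  have sub: "A.subspace x"
    unfolding A.subspace_def
  proof (intro conjI ballI allI)
    show "scale_A c g \<in> x" if "g \<in> x" for c g
      using I that A.mult_scale_left[of c 1 g] unfolding ideal_set_def by (metis mult_1)
  qed (use I in \<open>auto simp: ideal_set_def\<close>)
  have endo: "endomorphism scale_A UNIV ((*) f)"
    by (simp add: endomorphism_def distrib_left A.mult_scale_right)
  obtain c u where cu: "u \<notin> x" "f * u - scale_A c u \<in> x"
    using eigenvector_modulo_subspace[OF A.vector_space_axioms endo A.subspace_UNIV sub UNIV_I one p0 p]
    by blast
  have "f * u - scale_A c u = (f - scale_A c 1) * u"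
    by (simp add: left_diff_distrib A.mult_scale_left)
  then show "\<exists>c. f - scale_A c 1 \<in> x" using prime cu by metis
qed

end

section \<open>Irreducible representations factor through evaluation at a point\<close>

locale irreducible_map_rep = equivariant_map_data scale_A scale_\<aa> G act_A act_\<aa>
  for scale_A :: "'k::alg_closed_field \<Rightarrow> 'x::{comm_ring, comm_monoid_mult} \<Rightarrow> 'x"
    and scale_\<aa> :: "'k \<Rightarrow> 'a::{ring, monoid_mult} \<Rightarrow> 'a"
    and G :: "('g, 'm) monoid_scheme"
    and act_A :: "'g \<Rightarrow> 'x \<Rightarrow> 'x"
    and act_\<aa> :: "'g \<Rightarrow> 'a \<Rightarrow> 'a" +
  fixes V :: "(nat \<Rightarrow>\<^sub>0 'k) set"
    and \<rho> :: "(('a \<times> 'x) \<Rightarrow>\<^sub>0 'k) set \<Rightarrow> (nat \<Rightarrow>\<^sub>0 'k) \<Rightarrow> (nat \<Rightarrow>\<^sub>0 'k)"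
  assumes irr: "(V, \<rho>) \<in> irr_reps map_alg"
    and nonzero: "V \<noteq> {0}"
begin

definition \<sigma> :: "(('a \<times> 'x) \<Rightarrow>\<^sub>0 'k) \<Rightarrow> (nat \<Rightarrow>\<^sub>0 'k) \<Rightarrow> (nat \<Rightarrow>\<^sub>0 'k)" where
  "\<sigma> p = \<rho> (tensor.tensor_class p)"

lemma rep: "alg_rep map_alg free_scale (V, \<rho>)"
  using irr by (rule irr_reps_alg_rep)

lemma subspace_V: "free.subspace V"
  using rep by (simp add: alg_rep_def)

lemma class_carrier: "equivariant p \<Longrightarrow> tensor.tensor_class p \<in> carrier map_alg"
  by (simp add: carrier_map_alg)

lemma \<sigma>_endomorphism: "equivariant p \<Longrightarrow> endomorphism free_scale V (\<sigma> p)"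
  unfolding \<sigma>_def by (rule alg_rep_endomorphism[OF rep class_carrier])

lemma \<sigma>_closed: "equivariant p \<Longrightarrow> v \<in> V \<Longrightarrow> \<sigma> p v \<in> V"
  using \<sigma>_endomorphism by (simp add: endomorphism_def)

lemma \<sigma>_add: "equivariant p \<Longrightarrow> equivariant q \<Longrightarrow> v \<in> V \<Longrightarrow> \<sigma> (p + q) v = \<sigma> p v + \<sigma> q v"
  and \<sigma>_scale: "equivariant p \<Longrightarrow> v \<in> V \<Longrightarrow> \<sigma> (free_scale c p) v = free_scale c (\<sigma> p v)"
  and \<sigma>_mult: "equivariant p \<Longrightarrow> equivariant q \<Longrightarrow> v \<in> V \<Longrightarrow> \<sigma> (pair_mult p q) v = \<sigma> p (\<sigma> q v)"
  and \<sigma>_one: "v \<in> V \<Longrightarrow> \<sigma> (pure 1 1) v = v"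
  using rep class_carrier by (simp_all add: alg_rep_def \<sigma>_def flip: map_alg_ops)

lemma \<sigma>_cong: "p - q \<in> tensor.N \<Longrightarrow> \<sigma> p = \<sigma> q"
  unfolding \<sigma>_def by (metis tensor.tensor_class_eq_iff)

lemma \<sigma>_irreducible:
  assumes "free.subspace W" "W \<subseteq> V" "\<And>p w. equivariant p \<Longrightarrow> w \<in> W \<Longrightarrow> \<sigma> p w \<in> W"
  shows "W = {0} \<or> W = V"
  using irr assms unfolding irr_reps_def irreducible_rep_def carrier_map_alg \<sigma>_def by auto

text \<open>The vectors reached from \<open>w\<close> form a nonzero invariant subspace.\<close>
lemma \<sigma>_cyclic:
  assumes w: "w \<in> V" "w \<noteq> 0" and v: "v \<in> V"
  obtains p where "equivariant p" "\<sigma> p w = v"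
proof -
  let ?W = "{\<sigma> p w | p. equivariant p}"
  have eq0: "equivariant 0" using equivariant_scale[OF equivariant_const, of 1 0] by simp
  have "free.subspace ?W"
  proof (rule free.subspaceI)
    show "0 \<in> ?W" using \<sigma>_scale[OF eq0 w(1), of 0] eq0 by auto
    show "u + v \<in> ?W" if uv: "u \<in> ?W" "v \<in> ?W" for u v
    proof -
      obtain p q where "u = \<sigma> p w" "v = \<sigma> q w" "equivariant p" "equivariant q"
        using uv by blast
      then show ?thesis using \<sigma>_add[OF _ _ w(1), of p q] equivariant_add[of p q]
        by (auto intro!: exI[of _ "p + q"])
    qed
    show "free_scale c u \<in> ?W" if u: "u \<in> ?W" for c u
    proof -
      obtain p where "u = \<sigma> p w" "equivariant p" using u by blast
      then show ?thesis using \<sigma>_scale[OF _ w(1), of p c] equivariant_scale[of p c]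
        by (auto intro!: exI[of _ "free_scale c p"])
    qed
  qed
  moreover have "?W \<subseteq> V" using \<sigma>_closed w by auto
  moreover have "\<sigma> p u \<in> ?W" if p: "equivariant p" and u: "u \<in> ?W" for p u
  proof -
    obtain q where "u = \<sigma> q w" "equivariant q" using u by blast
    then show ?thesis using \<sigma>_mult[OF p _ w(1), of q] equivariant_mult[OF p, of q]
      by (auto intro!: exI[of _ "pair_mult p q"])
  qed
  ultimately have "?W = {0} \<or> ?W = V" by (rule \<sigma>_irreducible)
  moreover have "w \<in> ?W" using \<sigma>_one[OF w(1)] equivariant_const[of 1] by force
  ultimately have "v \<in> ?W" using w v by blast
  then show ?thesis using that by blast
qed

text \<open>The action of the mean over the group. It extends \<open>\<sigma>\<close> linearly to all tensors, so it can be
  computed on pure tensors, which are seldom equivariant. It is not multiplicative.\<close>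
definition \<tau> :: "(('a \<times> 'x) \<Rightarrow>\<^sub>0 'k) \<Rightarrow> (nat \<Rightarrow>\<^sub>0 'k) \<Rightarrow> (nat \<Rightarrow>\<^sub>0 'k)" where
  "\<tau> p = \<sigma> (average p)"

lemma \<tau>_linear:
  assumes "v \<in> V"
  shows "\<tau> (p + q) v = \<tau> p v + \<tau> q v" "\<tau> (free_scale c p) v = free_scale c (\<tau> p v)"
  by (simp_all add: \<tau>_def average_linear \<sigma>_add \<sigma>_scale equivariant_average assms)

lemma \<tau>_diff: "v \<in> V \<Longrightarrow> \<tau> (p - q) v = \<tau> p v - \<tau> q v"
  by (metis add_diff_cancel diff_add_cancel \<tau>_linear(1))

lemma \<tau>_0: "v \<in> V \<Longrightarrow> \<tau> 0 v = 0"
  using \<tau>_diff[of v 0 0] by simp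

lemma \<tau>_equivariant: "equivariant p \<Longrightarrow> \<tau> p = \<sigma> p"
  unfolding \<tau>_def by (intro \<sigma>_cong average_equivariant)

lemma \<tau>_N:
  assumes "v \<in> V" "p \<in> tensor.N"
  shows "\<tau> p v = 0"
proof -
  have "average p - 0 \<in> tensor.N" using average_N assms by simp
  moreover have "average 0 - 0 \<in> tensor.N"
    by (simp add: average_N free.subspace_0 tensor.subspace_N)
  ultimately have "\<tau> p = \<tau> 0" unfolding \<tau>_def by (metis \<sigma>_cong)
  then show ?thesis using \<tau>_0 assms by simp
qed

lemma \<tau>_cong: "v \<in> V \<Longrightarrow> p - q \<in> tensor.N \<Longrightarrow> \<tau> p v = \<tau> q v"
  using \<tau>_N[of v "p - q"] \<tau>_diff[of v p q] by simp

lemma \<tau>_pure_add_left: "v \<in> V \<Longrightarrow> \<tau> (pure (a + a') f) v = \<tau> (pure a f) v + \<tau> (pure a' f) v"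
  using \<tau>_cong[OF _ tensor.N_add_left] \<tau>_linear(1) by metis

lemma \<tau>_pure_add_right: "v \<in> V \<Longrightarrow> \<tau> (pure a (f + f')) v = \<tau> (pure a f) v + \<tau> (pure a f') v"
  using \<tau>_cong[OF _ tensor.N_add_right] \<tau>_linear(1) by metis

lemma \<tau>_pure_scale_left: "v \<in> V \<Longrightarrow> \<tau> (pure (scale_\<aa> c a) f) v = free_scale c (\<tau> (pure a f) v)"
  using \<tau>_cong[OF _ tensor.N_scale_left] \<tau>_linear(2) by metis

lemma \<tau>_pure_scale_right: "v \<in> V \<Longrightarrow> \<tau> (pure a (scale_A c f)) v = free_scale c (\<tau> (pure a f) v)"
  using \<tau>_cong[OF _ tensor.N_scale_right] \<tau>_linear(2) by metis

lemma \<tau>_pure_0_left: "v \<in> V \<Longrightarrow> \<tau> (pure 0 f) v = 0"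
  using \<tau>_pure_scale_left[of v 0 0 f] by simp

lemma \<tau>_pure_0_right: "v \<in> V \<Longrightarrow> \<tau> (pure a 0) v = 0"
  using \<tau>_pure_scale_right[of v a 0 0] by simp

lemma \<tau>_pure_sum_right: "v \<in> V \<Longrightarrow> \<tau> (pure a (\<Sum>i\<in>S. f i)) v = (\<Sum>i\<in>S. \<tau> (pure a (f i)) v)"
  by (induction S rule: infinite_finite_induct) (simp_all add: \<tau>_pure_add_right \<tau>_pure_0_right)

lemma \<tau>_pure_diff_right: "v \<in> V \<Longrightarrow> \<tau> (pure a (f - f')) v = \<tau> (pure a f) v - \<tau> (pure a f') v"
  by (metis add_diff_cancel diff_add_cancel \<tau>_pure_add_right)

text \<open>The largest ideal \<open>I\<close> such that \<open>\<tau>\<close> kills \<open>\<aa> \<otimes> I\<close>; the factor \<open>g\<close> makes it an ideal.\<close>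
definition Q :: "'x set" where
  "Q = {f. \<forall>a g. \<forall>v\<in>V. \<tau> (pure a (g * f)) v = 0}"

lemma ideal_Q: "ideal_set Q"
  unfolding ideal_set_def Q_def
  by (simp add: \<tau>_pure_0_right distrib_left \<tau>_pure_add_right mult.assoc[symmetric])

lemma one_notin_Q: "1 \<notin> Q"
proof
  assume "1 \<in> Q"
  then have "\<tau> (pure 1 1) v = 0" if "v \<in> V" for v
    using that unfolding Q_def by (metis (mono_tags, lifting) mem_Collect_eq mult_1)
  then have "v = 0" if "v \<in> V" for v
    using that \<sigma>_one \<tau>_equivariant[OF equivariant_const, of 1] by simp
  then show False using nonzero free.subspace_0[OF subspace_V] by blast
qed

text \<open>For an ideal \<open>L\<close>, representatives of the image of \<open>\<aa> \<otimes> L\<close>.\<close>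
definition coeff_in :: "'x set \<Rightarrow> (('a \<times> 'x) \<Rightarrow>\<^sub>0 'k) set" where
  "coeff_in L = free.span {pure a f | a f. f \<in> L}"

lemma coeff_in_pure: "f \<in> L \<Longrightarrow> pure a f \<in> coeff_in L"
  unfolding coeff_in_def by (rule free.span_base) blast

lemma subspace_coeff_in: "free.subspace (coeff_in L)"
  unfolding coeff_in_def by (rule free.subspace_span)

lemma coeff_in_UNIV: "p \<in> coeff_in UNIV"
  using free.subspace_add[OF subspace_coeff_in] free.subspace_scale[OF subspace_coeff_in]
  by (induction p rule: pure_induct) (auto intro: coeff_in_pure)

lemma coeff_in_mult:
  assumes "\<And>f g. f \<in> L \<Longrightarrow> g \<in> L' \<Longrightarrow> f * g \<in> L''" "p \<in> coeff_in L" "q \<in> coeff_in L'"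
  shows "pair_mult p q \<in> coeff_in L''"
proof -
  note sub = free.subspace_0[OF subspace_coeff_in] free.subspace_add[OF subspace_coeff_in]
    free.subspace_scale[OF subspace_coeff_in]
  have zero: "pair_mult 0 q = 0" "pair_mult q 0 = 0" for q :: "('a \<times> 'x) \<Rightarrow>\<^sub>0 'k"
    using pair_mult_diff_left[of 0 0 q] pair_mult_diff_right[of q 0 0] by simp_all
  have 1: "pair_mult (pure a f) q \<in> coeff_in L''" if "f \<in> L" for a f
    using assms(3) unfolding coeff_in_def[of L']
  proof (induction rule: free.span_induct)
    case base
    then show ?case
      by (intro free.subspaceI) (auto simp: zero pair_mult_linear sub)
  next
    case (step q)
    then obtain b g where "q = pure b g" "g \<in> L'" by blast
    then show ?case using coeff_in_pure[OF assms(1)[OF that]] by simp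
  qed
  show ?thesis
    using assms(2) unfolding coeff_in_def[of L]
  proof (induction rule: free.span_induct)
    case base
    then show ?case
      by (intro free.subspaceI) (auto simp: zero pair_mult_linear sub)
  next
    case (step q)
    then show ?case using 1 by auto
  qed
qed

lemma coeff_in_average:
  assumes "\<And>g f. g \<in> carrier G \<Longrightarrow> f \<in> L \<Longrightarrow> act_A g f \<in> L" "f \<in> L"
  shows "average (pure a f) \<in> coeff_in L"
  unfolding average_def using assms
  by (intro free.subspace_scale free.subspace_sum subspace_coeff_in) (simp add: coeff_in_pure)

lemma \<tau>_coeff_in_Q:
  assumes v: "v \<in> V" and p: "p \<in> coeff_in Q"
  shows "\<tau> p v = 0"
  using p unfolding coeff_in_def
proof (induction rule: free.span_induct)
  case base
  then show ?case
    by (intro free.subspaceI) (auto simp: \<tau>_linear \<tau>_0 v)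
next
  case (step q)
  then obtain a f where "q = pure a f" "f \<in> Q" by blast
  then show ?case using v unfolding Q_def by (metis (mono_tags, lifting) mem_Collect_eq mult_1)
qed

text \<open>An element \<open>p\<close> with coefficients in \<open>L\<close> does not kill some \<open>v\<close>, and an element \<open>q\<close> with coefficients
  in \<open>L'\<close> does not kill some \<open>w\<close>. By irreducibility some \<open>m\<close> carries \<open>q w\<close> to \<open>v\<close>, so \<open>p m q\<close> acts nontrivially, although its
  coefficients lie in the product of \<open>L\<close> and \<open>L'\<close>. With the product inside \<open>Q\<close> this is absurd.\<close>
lemma Q_prime:
  assumes L: "ideal_set L" "\<And>g f. g \<in> carrier G \<Longrightarrow> f \<in> L \<Longrightarrow> act_A g f \<in> L"
    and L': "ideal_set L'" "\<And>g f. g \<in> carrier G \<Longrightarrow> f \<in> L' \<Longrightarrow> act_A g f \<in> L'"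
    and LL': "\<And>f f'. f \<in> L \<Longrightarrow> f' \<in> L' \<Longrightarrow> f * f' \<in> Q"
  shows "L \<subseteq> Q \<or> L' \<subseteq> Q"
proof (rule ccontr)
  assume "\<not> (L \<subseteq> Q \<or> L' \<subseteq> Q)"
  then obtain f f' where f: "f \<in> L" "f \<notin> Q" "f' \<in> L'" "f' \<notin> Q" by blast
  obtain a g v where v: "v \<in> V" "\<tau> (pure a (g * f)) v \<noteq> 0" using f unfolding Q_def by blast
  obtain a' g' w where w: "w \<in> V" "\<tau> (pure a' (g' * f')) w \<noteq> 0" using f unfolding Q_def by blast
  let ?p = "average (pure a (g * f))" and ?q = "average (pure a' (g' * f'))"
  note eq = equivariant_average
  have p: "?p \<in> coeff_in L" and q: "?q \<in> coeff_in L'"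
    using f L L' by (auto intro!: coeff_in_average simp: ideal_set_def)
  obtain m where m: "equivariant m" "\<sigma> m (\<sigma> ?q w) = v"
    using \<sigma>_cyclic[OF \<sigma>_closed[OF eq w(1)] _ v(1)] w(2) unfolding \<tau>_def by metis
  have "pair_mult m ?q \<in> coeff_in L'"
    using L'(1) by (intro coeff_in_mult[OF _ coeff_in_UNIV q]) (simp add: ideal_set_def)
  then have pmq: "pair_mult ?p (pair_mult m ?q) \<in> coeff_in Q"
    using coeff_in_mult[OF LL' p] by blast
  have "\<sigma> ?p v = \<sigma> (pair_mult ?p (pair_mult m ?q)) w"
    using m w(1) by (simp add: \<sigma>_mult eq equivariant_mult)
  also have "\<dots> = \<tau> (pair_mult ?p (pair_mult m ?q)) w"
    using m by (simp add: \<tau>_equivariant eq equivariant_mult)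
  also have "\<dots> = 0" by (rule \<tau>_coeff_in_Q[OF w(1) pmq])
  finally show False using v(2) unfolding \<tau>_def by simp
qed

text \<open>Schur's lemma for the central element \<open>1 \<otimes> f\<close>: an eigenspace is an invariant subspace.\<close>
lemma invariant_scalar:
  assumes f: "\<And>g. g \<in> carrier G \<Longrightarrow> act_A g f = f"
  obtains c where "\<And>v. v \<in> V \<Longrightarrow> \<sigma> (pure 1 f) v = free_scale c v"
proof -
  let ?z = "pure 1 f :: ('a \<times> 'x) \<Rightarrow>\<^sub>0 'k"
  have z: "equivariant ?z" using f by (rule equivariant_const)
  note endo = \<sigma>_endomorphism[OF z]
  obtain v where v: "v \<in> V" "v \<notin> {0}" using nonzero free.subspace_0[OF subspace_V] by blast
  obtain S where S: "finite S" "V = free.span S"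
    using irr by (auto simp: irr_reps_def fin_dim_rep_def)
  obtain p where p: "p \<noteq> 0" "poly_apply free_scale (\<sigma> ?z) p v = 0"
    using free.annihilating_polynomial[OF endo S(2,1) v(1)] by blast
  have p': "poly_apply free_scale (\<sigma> ?z) p v \<in> {0}" using p by simp
  obtain c u where cu: "u \<in> V" "u \<noteq> 0" "\<sigma> ?z u - free_scale c u = 0"
    using eigenvector_modulo_subspace[OF free.vector_space_axioms endo subspace_V
        free.subspace_single_0 v p(1) p'] by blast
  let ?W = "{w \<in> V. \<sigma> ?z w = free_scale c w}"
  note zD = endo[unfolded endomorphism_def]
  have "free.subspace ?W"
    using subspace_V zD free.endomorphism_zero[OF endo subspace_V]
    by (intro free.subspaceI)
      (auto simp: free.subspace_def free.scale_right_distrib mult.commute)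
  moreover have "?W \<subseteq> V" by blast
  moreover have "\<sigma> q w \<in> ?W" if q: "equivariant q" and w: "w \<in> ?W" for q w
  proof -
    have "pair_mult ?z q = pair_mult q ?z"
      by (induction q rule: pure_induct) (simp_all add: pair_mult_linear mult.commute)
    then have "\<sigma> ?z (\<sigma> q w) = \<sigma> q (\<sigma> ?z w)"
      using \<sigma>_mult[OF z q, of w] \<sigma>_mult[OF q z, of w] w by simp
    also have "\<dots> = free_scale c (\<sigma> q w)"
      using w \<sigma>_endomorphism[OF q] by (auto simp: endomorphism_def)
    finally show ?thesis using \<sigma>_closed[OF q] w by simp
  qed
  ultimately have "?W = {0} \<or> ?W = V" by (rule \<sigma>_irreducible)
  moreover have "u \<in> ?W" using cu by simp
  ultimately have "?W = V" using cu(2) by auto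
  then show ?thesis using that by blast
qed

lemma invariant_scalar_mod_Q:
  assumes f: "\<And>g. g \<in> carrier G \<Longrightarrow> act_A g f = f"
  obtains c where "f - scale_A c 1 \<in> Q"
proof -
  let ?z = "pure 1 f :: ('a \<times> 'x) \<Rightarrow>\<^sub>0 'k"
  have z: "equivariant ?z" using f by (rule equivariant_const)
  obtain c where c: "\<And>v. v \<in> V \<Longrightarrow> \<sigma> ?z v = free_scale c v"
    using invariant_scalar[OF f] by blast
  have "\<tau> (pure a (g * (f - scale_A c 1))) v = 0" if v: "v \<in> V" for a g v
  proof -
    have "average (pair_mult ?z p) = pair_mult ?z (average p)" for p
      by (simp add: average_def act_pairs_mult f pair_mult_scale_right pair_mult_sum_right)
    then have "\<tau> (pure a (f * g)) v = \<sigma> (pair_mult ?z (average (pure a g))) v"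
      unfolding \<tau>_def by (metis mult_1 pair_mult_pure)
    also have "\<dots> = free_scale c (\<tau> (pure a g) v)"
      using v by (simp add: \<sigma>_mult z equivariant_average \<tau>_def c \<sigma>_closed)
    finally have "\<tau> (pure a (f * g)) v - free_scale c (\<tau> (pure a g) v) = 0" by simp
    then show ?thesis
      using v by (simp add: right_diff_distrib \<tau>_pure_diff_right A.mult_scale_right
          \<tau>_pure_scale_right mult.commute)
  qed
  then show ?thesis using that unfolding Q_def by blast
qed

text \<open>The core of an ideal is the intersection of its translates, a stable ideal. Among the ideals
  that contain \<open>Q\<close> and have their core in \<open>Q\<close>, let \<open>x\<close> be maximal. If \<open>f g \<in> x\<close> with \<open>f, g \<notin> x\<close>, then
  the cores of \<open>x + (f)\<close> and \<open>x + (g)\<close> do not lie in \<open>Q\<close> but their product lies in the core of \<open>x\<close>,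
  against \<open>Q_prime\<close>. The condition passes to unions of chains because the group is finite.\<close>
lemma exists_point:
  obtains x where "x \<in> X_rat" "{f. \<forall>g\<in>carrier G. act_A g f \<in> x} \<subseteq> Q"
proof -
  define core where "core I = {f. \<forall>g\<in>carrier G. act_A g f \<in> I}" for I
  define \<C> where "\<C> = {I. ideal_set I \<and> Q \<subseteq> I \<and> core I \<subseteq> Q}"
  have "core Q \<subseteq> Q" unfolding core_def using G.one_closed by force
  then have "Q \<in> \<C>" using ideal_Q by (simp add: \<C>_def)
  moreover have "\<Union>C \<in> \<C>" if C: "C \<noteq> {}" "subset.chain \<C> C" for C
  proof -
    have sub: "I \<in> \<C>" if "I \<in> C" for I using that C(2) by (auto simp: subset_chain_def)
    have "\<exists>I\<in>C. S \<subseteq> I" if "finite S" "S \<subseteq> \<Union>C" for S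
      using finite_subset_Union_chain[OF that C] by metis
    note fin = this
    have "ideal_set (\<Union>C)"
      unfolding ideal_set_def
    proof (intro conjI ballI allI)
      show "0 \<in> \<Union>C" using C(1) sub by (auto simp: \<C>_def ideal_set_def)
      show "f + g \<in> \<Union>C" if fg: "f \<in> \<Union>C" "g \<in> \<Union>C" for f g
      proof -
        obtain I where "I \<in> C" "f \<in> I" "g \<in> I" using fin[of "{f, g}"] fg by auto
        then show ?thesis using sub[of I] unfolding \<C>_def ideal_set_def by blast
      qed
      show "r * f \<in> \<Union>C" if f: "f \<in> \<Union>C" for f r
      proof -
        obtain I where "I \<in> C" "f \<in> I" using f by auto
        then show ?thesis using sub[of I] unfolding \<C>_def ideal_set_def by blast
      qed
    qed
    moreover have "Q \<subseteq> \<Union>C" using C(1) sub by (auto simp: \<C>_def)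
    moreover have "core (\<Union>C) \<subseteq> Q"
    proof
      fix f assume "f \<in> core (\<Union>C)"
      then obtain I where "I \<in> C" "(\<lambda>g. act_A g f) ` carrier G \<subseteq> I"
        using fin[of "(\<lambda>g. act_A g f) ` carrier G"] finite_G by (auto simp: core_def)
      then have "f \<in> core I" "core I \<subseteq> Q" using sub[of I] by (auto simp: \<C>_def core_def)
      then show "f \<in> Q" by blast
    qed
    ultimately show ?thesis by (simp add: \<C>_def)
  qed
  ultimately obtain x where x: "x \<in> \<C>" and max: "\<And>I. I \<in> \<C> \<Longrightarrow> x \<subseteq> I \<Longrightarrow> I = x"
    using subset_Zorn_nonempty[of \<C>] by (metis empty_iff)
  have I: "ideal_set x" and Qx: "Q \<subseteq> x" and core_x: "core x \<subseteq> Q" using x by (auto simp: \<C>_def)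
  have one: "1 \<notin> x"
  proof
    assume "1 \<in> x"
    then have "1 \<in> core x" by (simp add: core_def)
    then show False using core_x one_notin_Q by blast
  qed
  have prime: "f \<in> x \<or> g \<in> x" if fg: "f * g \<in> x" for f g
  proof (rule ccontr)
    assume neg: "\<not> (f \<in> x \<or> g \<in> x)"
    \<comment> \<open>\<open>J f\<close> is the ideal generated by \<open>x\<close> and \<open>f\<close>.\<close>
    define J where "J f = {u + r * f | u r. u \<in> x}" for f
    have J: "ideal_set (J f)" "x \<subseteq> J f" "f \<in> J f" for f
    proof -
      show "ideal_set (J f)"
        unfolding ideal_set_def
      proof (intro conjI ballI allI)
        show "0 \<in> J f" using I unfolding J_def ideal_set_def
          by (intro CollectI exI[of _ 0]) simp
        show "h + k \<in> J f" if hk: "h \<in> J f" "k \<in> J f" for h k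
        proof -
          obtain u r u' r' where "h = u + r * f" "k = u' + r' * f" "u \<in> x" "u' \<in> x"
            using hk by (auto simp: J_def)
          then have "h + k = (u + u') + (r + r') * f" "u + u' \<in> x"
            using I by (simp_all add: algebra_simps ideal_set_def)
          then show ?thesis unfolding J_def by blast
        qed
        show "s * h \<in> J f" if h: "h \<in> J f" for h s
        proof -
          obtain u r where "h = u + r * f" "u \<in> x" using h by (auto simp: J_def)
          then have "s * h = s * u + (s * r) * f" "s * u \<in> x"
            using I by (simp_all add: distrib_left mult.assoc ideal_set_def)
          then show ?thesis unfolding J_def by blast
        qed
      qed
      show "x \<subseteq> J f"
        unfolding J_def by (intro subsetI CollectI, rule exI, rule exI[of _ 0]) simp
      show "f \<in> J f"
        using I unfolding J_def ideal_set_def by (intro CollectI exI[of _ 0] exI[of _ 1]) simp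
    qed
    have notQ: "\<not> core (J h) \<subseteq> Q" if "h \<notin> x" for h
    proof
      assume "core (J h) \<subseteq> Q"
      then have "J h \<in> \<C>" using J[where f = h] Qx unfolding \<C>_def by blast
      then have "J h = x" using max J(2) by blast
      then show False using J(3)[of h] that by blast
    qed
    have core: "ideal_set (core I)" "\<And>g f. g \<in> carrier G \<Longrightarrow> f \<in> core I \<Longrightarrow> act_A g f \<in> core I"
      if "ideal_set I" for I
      using that by (auto simp: core_def ideal_set_def simp flip: act_A_comp)
    have mult: "h * k \<in> x" if hk: "h \<in> J f" "k \<in> J g" for h k
    proof -
      obtain u r u' r' where e: "h = u + r * f" "k = u' + r' * g" "u \<in> x" "u' \<in> x"
        using hk by (auto simp: J_def)
      then have "h * k = (u' + r' * g) * u + (r * f) * u' + (r * r') * (f * g)"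
        by (simp add: algebra_simps)
      moreover have "a * b \<in> x" if "b \<in> x" for a b using I that by (simp add: ideal_set_def)
      moreover have "a + b \<in> x" if "a \<in> x" "b \<in> x" for a b using I that by (simp add: ideal_set_def)
      ultimately show ?thesis using e fg by metis
    qed
    have "core (J f) \<subseteq> Q \<or> core (J g) \<subseteq> Q"
    proof (rule Q_prime[OF core[OF J(1)] core[OF J(1)]])
      fix h k assume "h \<in> core (J f)" "k \<in> core (J g)"
      then have "h * k \<in> core x" by (simp add: core_def mult)
      then show "h * k \<in> Q" using core_x by blast
    qed
    then show False using neg notQ by blast
  qed
  have scalar: "\<exists>c. f - scale_A c 1 \<in> x" if "\<And>g. g \<in> carrier G \<Longrightarrow> act_A g f = f" for f
    using invariant_scalar_mod_Q[OF that] Qx by blast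
  have "x \<in> X_rat" by (rule rational_of_scalar_invariants[OF I one prime scalar])
  then show ?thesis using that core_x by (simp add: core_def)
qed

text \<open>With functions \<open>F y\<close> that interpolate on the orbit \<open>P\<close> of \<open>x\<close>, every \<open>f\<close> is \<open>\<Sum>y\<in>P. f(y) F y\<close> up to a
  function vanishing on \<open>P\<close>, which lies in \<open>Q\<close>. Hence \<open>\<tau> p\<close> depends only on the values of \<open>p\<close> on \<open>P\<close>,
  and these are all zero.\<close>
lemma vanishing_acts_zero:
  assumes x: "x \<in> X_rat" and core: "{f. \<forall>g\<in>carrier G. act_A g f \<in> x} \<subseteq> Q"
    and p: "equivariant p" "ev_rep x p = 0" and v: "v \<in> V"
  shows "\<sigma> p v = 0"
proof -
  define P where "P = (\<lambda>g. act_X g x) ` carrier G"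
  have P: "finite P" "P \<subseteq> X_rat" using finite_G x act_X_X_rat by (auto simp: P_def)
  have "\<exists>F. \<forall>z\<in>P. val z F = (if y = z then 1 else 0)" if y: "y \<in> P" for y
  proof -
    have "y \<in> X_rat" "finite (P - {y})" "P - {y} \<subseteq> X_rat" "y \<notin> P - {y}" using P y by auto
    from separating_function[OF this]
    obtain F where "val y F = 1" "\<And>z. z \<in> P - {y} \<Longrightarrow> val z F = 0" by metis
    then have "\<forall>z\<in>P. val z F = (if y = z then 1 else 0)" by auto
    then show ?thesis by (rule exI)
  qed
  then obtain F where F: "\<And>y z. y \<in> P \<Longrightarrow> z \<in> P \<Longrightarrow> val z (F y) = (if y = z then 1 else 0)"
    by metis
  have "\<tau> p v = (\<Sum>y\<in>P. \<tau> (pure (ev_rep y p) (F y)) v)"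
  proof (induction p rule: pure_induct)
    case (pure a f)
    \<comment> \<open>\<open>j\<close> is the part of \<open>f\<close> that vanishes on the orbit.\<close>
    define j where "j = f - (\<Sum>y\<in>P. scale_A (val y f) (F y))"
    have "val z j = 0" if "z \<in> P" for z
    proof -
      have "z \<in> X_rat" using that P by blast
      then have "val z j = val z f - (\<Sum>y\<in>P. val y f * val z (F y))"
        by (simp add: j_def val_diff val_sum val_scale)
      also have "(\<Sum>y\<in>P. val y f * val z (F y)) = (\<Sum>y\<in>P. if y = z then val y f else 0)"
        using that F by (intro sum.cong) auto
      finally show ?thesis using that P by simp
    qed
    then have "act_A g j \<in> x" if "g \<in> carrier G" for g
    proof -
      have "act_X (inv\<^bsub>G\<^esub> g) x \<in> P" using that by (simp add: P_def)
      then have "val (act_X (inv\<^bsub>G\<^esub> g) x) j = 0" "act_X (inv\<^bsub>G\<^esub> g) x \<in> X_rat"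
        using P \<open>\<And>z. z \<in> P \<Longrightarrow> val z j = 0\<close> by auto
      then have "j \<in> act_X (inv\<^bsub>G\<^esub> g) x" by (simp add: val_eq_0_iff)
      then show ?thesis using that by (simp add: mem_act_X)
    qed
    then have "j \<in> Q" using core by blast
    then have "\<tau> (pure a j) v = 0"
      by (intro \<tau>_coeff_in_Q[OF v] coeff_in_pure)
    then show ?case
      by (simp add: j_def v \<tau>_pure_diff_right \<tau>_pure_sum_right \<tau>_pure_scale_right
          \<tau>_pure_scale_left)
  next
    case (add p q)
    then show ?case by (simp add: \<tau>_linear v ev_rep_linear \<tau>_pure_add_left sum.distrib)
  next
    case (scale c p)
    then show ?case
      by (simp add: \<tau>_linear v ev_rep_linear \<tau>_pure_scale_left free.scale_sum_right)
  qed
  also have "\<dots> = 0"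
  proof (rule sum.neutral, rule ballI)
    fix y assume "y \<in> P"
    then obtain g where g: "g \<in> carrier G" "y = act_X g x" by (auto simp: P_def)
    then have "ev_rep y p = 0"
      using ev_rep_equivariant[OF p(1) g(1) x] p(2) act_\<aa>_scale[OF g(1), of 0 0] by simp
    then show "\<tau> (pure (ev_rep y p) (F y)) v = 0" by (simp add: \<tau>_pure_0_left v)
  qed
  finally show ?thesis by (simp add: \<tau>_equivariant p)
qed

lemma factors_through_evaluation:
  obtains x \<rho>' where "x \<in> X_rat" "(V, \<rho>') \<in> irr_reps (fixed_alg x)"
    "\<And>\<alpha> v. \<alpha> \<in> carrier map_alg \<Longrightarrow> v \<in> V \<Longrightarrow> \<rho>' (ev x \<alpha>) v = \<rho> \<alpha> v"
proof -
  obtain x where x: "x \<in> X_rat" "{f. \<forall>g\<in>carrier G. act_A g f \<in> x} \<subseteq> Q" by (rule exists_point)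
  have ker: "\<rho> \<alpha> v = \<rho> \<beta> v"
    if ab: "\<alpha> \<in> carrier map_alg" "\<beta> \<in> carrier map_alg" "ev x \<alpha> = ev x \<beta>" "v \<in> V" for \<alpha> \<beta> v
  proof -
    obtain p q where pq: "equivariant p" "\<alpha> = tensor.tensor_class p"
      "equivariant q" "\<beta> = tensor.tensor_class q"
      using ab by (auto simp: carrier_map_alg)
    have eq: "equivariant (p + free_scale (-1) q)"
      using pq by (intro equivariant_add equivariant_scale)
    have "ev_rep x (p + free_scale (-1) q) = 0"
      using ab(3) by (simp add: pq ev_tensor_class x ev_rep_linear)
    then have "\<sigma> (p + free_scale (-1) q) v = 0" by (rule vanishing_acts_zero[OF x eq _ ab(4)])
    then show ?thesis
      using ab(4) by (simp add: pq \<sigma>_add \<sigma>_scale equivariant_scale del: free.scale_minus_left)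
        (simp add: \<sigma>_def)
  qed
  show ?thesis
  proof (rule irr_reps_descend[OF ev_hom[OF x(1)] ev_surj[OF x(1)] _ _ _ _ irr])
    fix \<rho>' assume "(V, \<rho>') \<in> irr_reps (fixed_alg x)"
      "\<And>b v. b \<in> carrier map_alg \<Longrightarrow> v \<in> V \<Longrightarrow> \<rho>' (ev x b) v = \<rho> b v"
    then show thesis using that x(1) by blast
  qed (use map_alg_closed in \<open>auto intro: ker\<close>)
qed

end

section \<open>Transport of representations along the orbits\<close>

context equivariant_map_data
begin

definition transport :: "'g \<Rightarrow> 'x set \<Rightarrow> ('k, 'a) rep set \<Rightarrow> ('k, 'a) rep set" where
  "transport g x C = pullback_class (fixed_alg (act_X g x)) (act_\<aa> (inv\<^bsub>G\<^esub> g)) C"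

lemma act_R_eq: "act_R g (x, C) = (act_X g x, transport g x C)"
  by (simp add: act_R_def transport_def)

lemma act_fixed_alg:
  assumes g: "g \<in> carrier G" and b: "b \<in> carrier (fixed_alg x)"
  shows "act_\<aa> g b \<in> carrier (fixed_alg (act_X g x))"
proof -
  have "act_\<aa> h (act_\<aa> g b) = act_\<aa> g b" if h: "h \<in> carrier G" "act_X h (act_X g x) = act_X g x" for h
  proof -
    \<comment> \<open>The stabilizer of \<open>g x\<close> is conjugate to that of \<open>x\<close>.\<close>
    let ?k = "inv\<^bsub>G\<^esub> g \<otimes>\<^bsub>G\<^esub> h \<otimes>\<^bsub>G\<^esub> g"
    have "act_X ?k x = x" using g h by (simp add: act_X_comp)
    then have "act_\<aa> ?k b = b" using b g h by (simp add: stabilizer_def)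
    then have "act_\<aa> g (act_\<aa> ?k b) = act_\<aa> g b" by simp
    then show ?thesis using g h by (simp add: act_\<aa>_comp)
  qed
  then show ?thesis by (simp add: stabilizer_def)
qed

lemma act_hom:
  assumes g: "g \<in> carrier G"
  shows "algebra_hom (fixed_alg (act_X g x)) (fixed_alg x) (act_\<aa> (inv\<^bsub>G\<^esub> g))"
proof -
  have "act_\<aa> (inv\<^bsub>G\<^esub> g) b \<in> carrier (fixed_alg x)" if "b \<in> carrier (fixed_alg (act_X g x))" for b
    using act_fixed_alg[of "inv\<^bsub>G\<^esub> g" b "act_X g x"] g that by simp
  then show ?thesis using g unfolding algebra_hom_def by simp
qed

lemma act_surj:
  assumes g: "g \<in> carrier G"
  shows "act_\<aa> (inv\<^bsub>G\<^esub> g) ` carrier (fixed_alg (act_X g x)) = carrier (fixed_alg x)"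
proof
  show "act_\<aa> (inv\<^bsub>G\<^esub> g) ` carrier (fixed_alg (act_X g x)) \<subseteq> carrier (fixed_alg x)"
    using act_hom[OF g] by (auto simp: algebra_hom_def)
  show "carrier (fixed_alg x) \<subseteq> act_\<aa> (inv\<^bsub>G\<^esub> g) ` carrier (fixed_alg (act_X g x))"
  proof
    fix b assume "b \<in> carrier (fixed_alg x)"
    then show "b \<in> act_\<aa> (inv\<^bsub>G\<^esub> g) ` carrier (fixed_alg (act_X g x))"
      using act_fixed_alg[OF g] g by (intro image_eqI[of _ _ "act_\<aa> g b"]) simp_all
  qed
qed

lemma transport_R: "g \<in> carrier G \<Longrightarrow> C \<in> R x \<Longrightarrow> transport g x C \<in> R (act_X g x)"
  unfolding transport_def R_def by (rule pullback_class_irr[OF act_hom act_surj])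

lemma transport_zero:
  "g \<in> carrier G \<Longrightarrow> transport g x (zero_class (fixed_alg x)) = zero_class (fixed_alg (act_X g x))"
  unfolding transport_def by (rule pullback_class_zero[OF act_hom])

lemma transport_comp:
  assumes g: "g \<in> carrier G" and h: "h \<in> carrier G" and C: "C \<in> R x"
  shows "transport g (act_X h x) (transport h x C) = transport (g \<otimes>\<^bsub>G\<^esub> h) x C"
  unfolding transport_def act_X_comp[OF g h]
  by (rule pullback_class_comp[OF act_hom[OF g] act_hom[OF h]])
    (use g h C act_hom[of "g \<otimes>\<^bsub>G\<^esub> h" x]
      in \<open>simp_all add: act_X_comp G.inv_mult_group act_\<aa>_comp R_def\<close>)

lemma transport_stabilizer:
  assumes g: "g \<in> stabilizer G act_X x" and C: "C \<in> R x"
  shows "transport g x C = C"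
proof -
  have g': "g \<in> carrier G" "act_X g x = x" using g by (auto simp: stabilizer_def)
  have "act_\<aa> (inv\<^bsub>G\<^esub> g) b = b" if "b \<in> carrier (fixed_alg x)" for b
    using that subgroup.m_inv_closed[OF subgroup_stabilizer g] by simp
  then show ?thesis
    unfolding transport_def g'(2) using C act_hom[OF g'(1), of x] unfolding R_def g'(2)
    by (intro pullback_class_id)
qed

text \<open>Two elements that carry \<open>x\<close> to the same point differ by the stabilizer of \<open>x\<close>, which acts
  trivially on the algebra fixed by it. So a class at \<open>x\<close> can be spread over the orbit.\<close>
lemma transport_cong:
  assumes g: "g \<in> carrier G" and h: "h \<in> carrier G" and eq: "act_X g x = act_X h x" and C: "C \<in> R x"
  shows "transport g x C = transport h x C"
proof -
  let ?k = "inv\<^bsub>G\<^esub> h \<otimes>\<^bsub>G\<^esub> g"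
  have k: "?k \<in> stabilizer G act_X x"
    using g h eq by (simp add: stabilizer_def act_X_comp)
  have "transport h x C = transport h (act_X ?k x) (transport ?k x C)"
    using transport_stabilizer[OF k C] k by (simp add: stabilizer_def)
  also have "\<dots> = transport (h \<otimes>\<^bsub>G\<^esub> ?k) x C" using g h C by (intro transport_comp) auto
  also have "h \<otimes>\<^bsub>G\<^esub> ?k = g" using g h by (simp add: G.m_assoc[symmetric])
  finally show ?thesis by simp
qed

text \<open>The evaluations at \<open>\<gamma> x\<close> and at \<open>x\<close> differ by \<open>\<gamma>\<close> on equivariant maps, and \<open>transport\<close> undoes this.\<close>
lemma ev_transport:
  assumes g: "g \<in> carrier G" and x: "x \<in> X_rat" and C: "C \<in> R x"
  shows "pullback_class map_alg (ev (act_X g x)) (transport g x C) = pullback_class map_alg (ev x) C"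
  unfolding transport_def
proof (rule pullback_class_comp[OF ev_hom[OF act_X_X_rat[OF g x]] act_hom[OF g] ev_hom[OF x]])
  fix \<alpha> assume "\<alpha> \<in> carrier map_alg"
  then obtain p where p: "equivariant p" "\<alpha> = tensor.tensor_class p" by (auto simp: carrier_map_alg)
  then show "ev x \<alpha> = act_\<aa> (inv\<^bsub>G\<^esub> g) (ev (act_X g x) \<alpha>)"
    using g x by (simp add: ev_tensor_class act_X_X_rat ev_rep_equivariant)
qed (use C in \<open>simp add: R_def\<close>)

text \<open>An equivariant map with value \<open>1\<close> at \<open>x\<close> and \<open>0\<close> at \<open>y\<close> acts as the identity on one
  representation and as zero on the other, which is impossible if they are isomorphic and nonzero.\<close>
lemma same_orbit_of_ev_class_eq:
  assumes x: "x \<in> X_rat" and y: "y \<in> X_rat" and C: "C \<in> R x" "C \<noteq> zero_class (fixed_alg x)"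
    and D: "D \<in> R y"
    and eq: "pullback_class map_alg (ev x) C = pullback_class map_alg (ev y) D"
  shows "\<exists>g\<in>carrier G. act_X g y = x"
proof (rule ccontr)
  assume neg: "\<not> (\<exists>g\<in>carrier G. act_X g y = x)"
  have "1 \<in> carrier (fixed_alg x)" by (simp add: stabilizer_def)
  then obtain p where p: "equivariant p" "ev_rep x p = 1" "ev_rep y p = 0"
    using equivariant_interpolation[OF x, of 1 "{y}"] y neg by auto
  define \<alpha> where "\<alpha> = tensor.tensor_class p"
  have \<alpha>: "\<alpha> \<in> carrier map_alg" "ev x \<alpha> = 1" "ev y \<alpha> = 0"
    using p by (auto simp: \<alpha>_def carrier_map_alg ev_tensor_class x y)
  obtain V \<rho> where r: "(V, \<rho>) \<in> irr_reps (fixed_alg x)" "C = iso_rel (fixed_alg x) `` {(V, \<rho>)}"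
    using C(1) by (auto simp: R_def irr_classes_iff)
  obtain W \<sigma> where r': "(W, \<sigma>) \<in> irr_reps (fixed_alg y)" "D = iso_rel (fixed_alg y) `` {(W, \<sigma>)}"
    using D by (auto simp: R_def irr_classes_iff)
  note fd = irr_reps_fin_dim[OF r(1)] irr_reps_fin_dim[OF r'(1)]
  have "rep_iso map_alg free_scale free_scale (V, \<rho> \<circ> ev x) (W, \<sigma> \<circ> ev y)"
    using eq unfolding r(2) r'(2) pullback_class_iso_class[OF ev_hom[OF x] fd(1)]
      pullback_class_iso_class[OF ev_hom[OF y] fd(2)]
      iso_class_eq_iff[OF fin_dim_rep_pullback[OF ev_hom[OF x] fd(1)]
        fin_dim_rep_pullback[OF ev_hom[OF y] fd(2)]] .
  then obtain f where f: "bij_betw f V W"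
    "\<And>b v. b \<in> carrier map_alg \<Longrightarrow> v \<in> V \<Longrightarrow> f (\<rho> (ev x b) v) = \<sigma> (ev y b) (f v)"
    unfolding rep_iso_def by auto
  have rep: "alg_rep (fixed_alg x) free_scale (V, \<rho>)" and rep': "alg_rep (fixed_alg y) free_scale (W, \<sigma>)"
    using r(1) r'(1) by (simp_all add: irr_reps_alg_rep)
  have \<rho>1: "\<rho> 1 v = v" if "v \<in> V" for v using rep that by (simp add: alg_rep_def)
  have \<sigma>0: "\<sigma> 0 w = 0" if "w \<in> W" for w
  proof -
    have "1 \<in> carrier (fixed_alg y)" by (simp add: stabilizer_def)
    then show ?thesis using alg_rep_scale[OF rep' _ that, of 1 0] by simp
  qed
  have "f v = 0" if "v \<in> V" for v
    using f(2)[OF \<alpha>(1) that] \<rho>1[OF that] \<sigma>0[of "f v"] that f(1) by (auto simp: \<alpha> bij_betw_def)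
  moreover have "inj_on f V" using f(1) by (simp add: bij_betw_def)
  moreover have "0 \<in> V" using rep by (simp add: alg_rep_def free.subspace_0)
  ultimately have "V \<subseteq> {0}" "0 \<in> V" by (auto simp: inj_on_def)
  then have "V = {0}" by blast
  then show False using C(2) iso_class_eq_zero_iff[OF fd(1)] r(2) by blast
qed

section \<open>Equivariant functions supported on an orbit\<close>

lemma E_single_R: "\<psi> \<in> E_single \<Longrightarrow> x \<in> X_rat \<Longrightarrow> snd (\<psi> x) \<in> R x"
  and E_single_fst: "\<psi> \<in> E_single \<Longrightarrow> x \<in> X_rat \<Longrightarrow> \<psi> x = (x, snd (\<psi> x))"
  by (auto simp: E_single_def)

lemma E_single_act:
  assumes "\<psi> \<in> E_single" "g \<in> carrier G" "x \<in> X_rat"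
  shows "snd (\<psi> (act_X g x)) = transport g x (snd (\<psi> x))"
proof -
  have "\<psi> (act_X g x) = act_R g (\<psi> x)" using assms by (simp add: E_single_def)
  then show ?thesis by (subst (asm) E_single_fst[OF assms(1,3)]) (simp add: act_R_eq)
qed

lemma Supp_iff:
  assumes "\<psi> \<in> E_single"
  shows "x \<in> Supp \<psi> \<longleftrightarrow> x \<in> X_rat \<and> snd (\<psi> x) \<noteq> zero_class (fixed_alg x)"
proof -
  have "\<psi> x = (x, zero_class (fixed_alg x)) \<longleftrightarrow> snd (\<psi> x) = zero_class (fixed_alg x)"
    if "x \<in> X_rat"
    by (subst E_single_fst[OF assms that]) simp
  then show ?thesis by (auto simp: Supp_def)
qed

lemma Supp_act:
  assumes "\<psi> \<in> E_single" "g \<in> carrier G" "x \<in> Supp \<psi>"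
  shows "act_X g x \<in> Supp \<psi>"
proof -
  have x: "x \<in> X_rat" "snd (\<psi> x) \<noteq> zero_class (fixed_alg x)" using assms Supp_iff by auto
  have "snd (\<psi> x) = transport (inv\<^bsub>G\<^esub> g) (act_X g x) (snd (\<psi> (act_X g x)))"
    using E_single_act[OF assms(1), of "inv\<^bsub>G\<^esub> g" "act_X g x"] assms(2) x act_X_X_rat by simp
  then have "snd (\<psi> (act_X g x)) \<noteq> zero_class (fixed_alg (act_X g x))"
    using transport_zero[of "inv\<^bsub>G\<^esub> g" "act_X g x"] x assms(2) by auto
  then show ?thesis using assms x act_X_X_rat by (simp add: Supp_iff)
qed

lemma mem_orbit: "y \<in> orbit G act_X x \<longleftrightarrow> (\<exists>g\<in>carrier G. y = act_X g x)"
  by (auto simp: orbit_def)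

lemma Supp_eq_orbit:
  assumes \<psi>: "\<psi> \<in> E_single" and x: "x \<in> Supp \<psi>"
  shows "Supp \<psi> = orbit G act_X x"
proof
  show "orbit G act_X x \<subseteq> Supp \<psi>" using Supp_act[OF \<psi> _ x] by (auto simp: mem_orbit)
  obtain z where z: "Supp \<psi> \<subseteq> orbit G act_X z" using \<psi> x by (auto simp: E_single_def)
  then have "x \<in> orbit G act_X z" using x by blast
  then obtain h where h: "h \<in> carrier G" "x = act_X h z" by (auto simp: mem_orbit)
  show "Supp \<psi> \<subseteq> orbit G act_X x"
  proof
    fix y assume "y \<in> Supp \<psi>"
    then have "y \<in> orbit G act_X z" using z by blast
    then obtain g where g: "g \<in> carrier G" "y = act_X g z" by (auto simp: mem_orbit)
    have "y = act_X (g \<otimes>\<^bsub>G\<^esub> inv\<^bsub>G\<^esub> h) x" using g h by (simp add: act_X_comp)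
    then show "y \<in> orbit G act_X x" using g h by (auto simp: mem_orbit)
  qed
qed

text \<open>By \<open>ev_transport\<close> the point chosen in the definition of \<open>ev_class\<close> does not matter.\<close>
lemma ev_class_eq:
  assumes \<psi>: "\<psi> \<in> E_single" and x: "x \<in> Supp \<psi>"
  shows "ev_class \<psi> = pullback_class map_alg (ev x) (snd (\<psi> x))"
proof -
  define y where "y = (SOME y. y \<in> X_rat \<and> orbit G act_X y = Supp \<psi>)"
  have "x \<in> X_rat \<and> orbit G act_X x = Supp \<psi>"
    using Supp_eq_orbit[OF \<psi> x] x Supp_iff[OF \<psi>] by simp
  then have y: "y \<in> X_rat" "orbit G act_X y = Supp \<psi>"
    unfolding y_def by (metis (mono_tags, lifting) someI_ex)+
  have "x \<in> orbit G act_X y" using x by (simp add: y(2))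
  then obtain g where g: "g \<in> carrier G" "x = act_X g y" by (auto simp: mem_orbit)
  have "ev_class \<psi> = pullback_class map_alg (ev y) (snd (\<psi> y))"
    using x by (auto simp: ev_class_def y_def Let_def)
  also have "\<dots> = pullback_class map_alg (ev x) (snd (\<psi> x))"
    unfolding g(2) E_single_act[OF \<psi> g(1) y(1)]
    by (rule ev_transport[symmetric, OF g(1) y(1) E_single_R[OF \<psi> y(1)]])
  finally show ?thesis .
qed

lemma E_single_eqI:
  assumes \<psi>: "\<psi> \<in> E_single" "\<psi>' \<in> E_single" and supp: "Supp \<psi> = Supp \<psi>'"
    and eq: "\<And>x. x \<in> Supp \<psi> \<Longrightarrow> snd (\<psi> x) = snd (\<psi>' x)"
  shows "\<psi> = \<psi>'"
proof (rule extensionalityI[of _ X_rat])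
  show "\<psi> \<in> extensional X_rat" "\<psi>' \<in> extensional X_rat" using \<psi> by (simp_all add: E_single_def PiE_def)
  fix x assume x: "x \<in> X_rat"
  have "snd (\<psi> x) = snd (\<psi>' x)"
    using eq[of x] supp Supp_iff[OF \<psi>(1), of x] Supp_iff[OF \<psi>(2), of x] x by metis
  then show "\<psi> x = \<psi>' x" using E_single_fst[OF \<psi>(1) x] E_single_fst[OF \<psi>(2) x] by simp
qed

lemma ev_class_irr:
  assumes \<psi>: "\<psi> \<in> E_single"
  shows "ev_class \<psi> \<in> irr_classes map_alg"
proof (cases "Supp \<psi> = {}")
  case True
  then show ?thesis by (simp add: ev_class_def zero_class_irr)
next
  case False
  then obtain x where x: "x \<in> Supp \<psi>" by blast
  then have "x \<in> X_rat" using Supp_iff[OF \<psi>] by simp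
  then show ?thesis
    unfolding ev_class_eq[OF \<psi> x] using E_single_R[OF \<psi>]
    by (intro pullback_class_irr[OF ev_hom ev_surj]) (simp_all add: R_def)
qed

lemma ev_class_eq_zero_iff:
  assumes \<psi>: "\<psi> \<in> E_single"
  shows "ev_class \<psi> = zero_class map_alg \<longleftrightarrow> Supp \<psi> = {}"
proof
  assume zero: "ev_class \<psi> = zero_class map_alg"
  show "Supp \<psi> = {}"
  proof (rule ccontr)
    assume "Supp \<psi> \<noteq> {}"
    then obtain x where x: "x \<in> Supp \<psi>" by blast
    then have x': "x \<in> X_rat" "snd (\<psi> x) \<noteq> zero_class (fixed_alg x)" using Supp_iff[OF \<psi>] by auto
    then show False
      using zero unfolding ev_class_eq[OF \<psi> x]
      using pullback_class_eq_zero_iff[OF ev_hom[OF x'(1)]] E_single_R[OF \<psi> x'(1)]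
      by (simp add: R_def)
  qed
qed (simp add: ev_class_def)

lemma inj_on_ev_class: "inj_on ev_class E_single"
proof (rule inj_onI)
  fix \<psi> \<psi>' assume \<psi>: "\<psi> \<in> E_single" "\<psi>' \<in> E_single" and eq: "ev_class \<psi> = ev_class \<psi>'"
  show "\<psi> = \<psi>'"
  proof (cases "Supp \<psi> = {}")
    case True
    then have "Supp \<psi>' = {}" using ev_class_eq_zero_iff \<psi> eq by metis
    then show ?thesis using True by (intro E_single_eqI[OF \<psi>]) simp_all
  next
    case False
    then have "Supp \<psi>' \<noteq> {}" using ev_class_eq_zero_iff \<psi> eq by metis
    then obtain x y where xy: "x \<in> Supp \<psi>" "y \<in> Supp \<psi>'" using False by blast
    then have x: "x \<in> X_rat" "snd (\<psi> x) \<noteq> zero_class (fixed_alg x)" and y: "y \<in> X_rat"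
      using Supp_iff \<psi> by auto
    have "\<exists>g\<in>carrier G. act_X g y = x"
      using eq unfolding ev_class_eq[OF \<psi>(1) xy(1)] ev_class_eq[OF \<psi>(2) xy(2)]
      by (rule same_orbit_of_ev_class_eq[OF x(1) y E_single_R[OF \<psi>(1) x(1)] x(2)
            E_single_R[OF \<psi>(2) y]])
    then have x': "x \<in> Supp \<psi>'" using Supp_act[OF \<psi>(2) _ xy(2)] by blast
    have supp: "Supp \<psi> = orbit G act_X x" "Supp \<psi>' = orbit G act_X x"
      by (rule Supp_eq_orbit[OF \<psi>(1) xy(1)], rule Supp_eq_orbit[OF \<psi>(2) x'])
    have "snd (\<psi> x) = snd (\<psi>' x)"
    proof (rule pullback_class_inj[OF ev_hom[OF x(1)] ev_surj[OF x(1)]])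
      show "pullback_class map_alg (ev x) (snd (\<psi> x)) = pullback_class map_alg (ev x) (snd (\<psi>' x))"
        using eq unfolding ev_class_eq[OF \<psi>(1) xy(1)] ev_class_eq[OF \<psi>(2) x'] .
    qed (use E_single_R \<psi> x in \<open>auto simp: R_def\<close>)
    then have "snd (\<psi> z) = snd (\<psi>' z)" if "z \<in> Supp \<psi>" for z
      using that E_single_act \<psi> x(1) by (auto simp: supp mem_orbit)
    then show ?thesis using supp by (intro E_single_eqI[OF \<psi>]) simp_all
  qed
qed

text \<open>The equivariant function supported on the orbit of \<open>x\<close> with class \<open>C\<close> at \<open>x\<close>; by \<open>transport_cong\<close> it
  does not depend on the chosen group element.\<close>
definition orbit_function ::
    "'x set \<Rightarrow> ('k, 'a) rep set \<Rightarrow> 'x set \<Rightarrow> 'x set \<times> ('k, 'a) rep set" where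
  "orbit_function x C = (\<lambda>z\<in>X_rat. (z,
     if z \<in> orbit G act_X x then transport (SOME g. g \<in> carrier G \<and> act_X g x = z) x C
     else zero_class (fixed_alg z)))"

lemma orbit_function_orbit:
  assumes x: "x \<in> X_rat" and C: "C \<in> R x" and g: "g \<in> carrier G"
  shows "orbit_function x C (act_X g x) = (act_X g x, transport g x C)"
proof -
  define h where "h = (SOME h. h \<in> carrier G \<and> act_X h x = act_X g x)"
  have "h \<in> carrier G \<and> act_X h x = act_X g x"
    unfolding h_def by (rule someI[of _ g]) (simp add: g)
  then have "transport h x C = transport g x C" using g C by (intro transport_cong) auto
  then show ?thesis
    using g act_X_X_rat[OF g x] by (auto simp: orbit_function_def mem_orbit h_def[symmetric])
qed

lemma orbit_function_E_single:
  assumes x: "x \<in> X_rat" and C: "C \<in> R x"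
  shows "orbit_function x C \<in> E_single"
proof -
  let ?\<psi> = "orbit_function x C"
  have off: "?\<psi> z = (z, zero_class (fixed_alg z))" if "z \<in> X_rat" "z \<notin> orbit G act_X x" for z
    using that by (simp add: orbit_function_def)
  have R: "?\<psi> z \<in> {z} \<times> R z" if z: "z \<in> X_rat" for z
  proof (cases "z \<in> orbit G act_X x")
    case True
    then obtain g where "g \<in> carrier G" "z = act_X g x" by (auto simp: mem_orbit)
    then show ?thesis using transport_R[OF _ C] by (simp add: orbit_function_orbit[OF x C])
  next
    case False
    then show ?thesis using off[OF z] by (simp add: R_def zero_class_irr)
  qed
  have "?\<psi> (act_X g z) = act_R g (?\<psi> z)" if g: "g \<in> carrier G" and z: "z \<in> X_rat" for g z
  proof (cases "z \<in> orbit G act_X x")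
    case True
    then obtain h where h: "h \<in> carrier G" "z = act_X h x" by (auto simp: mem_orbit)
    have "?\<psi> (act_X g z) = ?\<psi> (act_X (g \<otimes>\<^bsub>G\<^esub> h) x)" using g h by (simp add: act_X_comp)
    also have "\<dots> = (act_X (g \<otimes>\<^bsub>G\<^esub> h) x, transport (g \<otimes>\<^bsub>G\<^esub> h) x C)"
      using g h by (intro orbit_function_orbit[OF x C]) simp
    also have "\<dots> = act_R g (?\<psi> z)"
      using g h by (simp add: orbit_function_orbit[OF x C] act_R_eq act_X_comp transport_comp C)
    finally show ?thesis .
  next
    case False
    have "act_X g z \<notin> orbit G act_X x"
    proof
      assume "act_X g z \<in> orbit G act_X x"
      then obtain h where h: "h \<in> carrier G" "act_X g z = act_X h x" by (auto simp: mem_orbit)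
      have "z = act_X (inv\<^bsub>G\<^esub> g) (act_X g z)" using g by simp
      also have "\<dots> = act_X (inv\<^bsub>G\<^esub> g \<otimes>\<^bsub>G\<^esub> h) x" unfolding h(2) using g h(1) by (simp add: act_X_comp)
      finally have "z = act_X (inv\<^bsub>G\<^esub> g \<otimes>\<^bsub>G\<^esub> h) x" .
      then show False using False g h(1) by (auto simp: mem_orbit)
    qed
    then show ?thesis
      using False g z by (simp add: off act_X_X_rat act_R_eq transport_zero)
  qed
  moreover have "Supp ?\<psi> \<subseteq> orbit G act_X x" using off by (auto simp: Supp_def)
  moreover have "?\<psi> \<in> X_rat \<rightarrow>\<^sub>E R_X"
  proof (rule PiE_I)
    show "?\<psi> z \<in> R_X" if "z \<in> X_rat" for z using R[OF that] that by (auto simp: R_X_def)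
  qed (simp add: orbit_function_def)
  ultimately show ?thesis using R x unfolding E_single_def by blast
qed

lemma zero_function_E_single: "(\<lambda>z\<in>X_rat. (z, zero_class (fixed_alg z))) \<in> E_single"
  unfolding E_single_def
  by (auto simp: R_X_def R_def zero_class_irr Supp_def act_X_X_rat act_R_eq transport_zero)

lemma ev_class_surj:
  assumes "D \<in> irr_classes map_alg"
  shows "D \<in> ev_class ` E_single"
proof -
  obtain V \<rho> where r: "(V, \<rho>) \<in> irr_reps map_alg" "D = iso_rel map_alg `` {(V, \<rho>)}"
    using assms by (auto simp: irr_classes_iff)
  show ?thesis
  proof (cases "V = {0}")
    case True
    then have "D = zero_class map_alg"
      using r iso_class_eq_zero_iff[OF irr_reps_fin_dim[OF r(1)]] by blast
    moreover have "Supp (\<lambda>z\<in>X_rat. (z, zero_class (fixed_alg z))) = {}" by (auto simp: Supp_def)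
    ultimately have "D = ev_class (\<lambda>z\<in>X_rat. (z, zero_class (fixed_alg z)))"
      by (simp add: ev_class_def)
    then show ?thesis using zero_function_E_single by blast
  next
    case False
    interpret irreducible_map_rep scale_A scale_\<aa> G act_A act_\<aa> V \<rho>
      by unfold_locales (use r False in auto)
    obtain x \<rho>' where x: "x \<in> X_rat" and r': "(V, \<rho>') \<in> irr_reps (fixed_alg x)"
      and factor: "\<And>\<alpha> v. \<alpha> \<in> carrier map_alg \<Longrightarrow> v \<in> V \<Longrightarrow> \<rho>' (ev x \<alpha>) v = \<rho> \<alpha> v"
      by (rule factors_through_evaluation) (erule that, assumption, blast)
    define C where "C = iso_rel (fixed_alg x) `` {(V, \<rho>')}"
    note fd = irr_reps_fin_dim[OF r']
    have C: "C \<in> R x" unfolding C_def R_def irr_classes_iff using r' by blast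
    have C0: "C \<noteq> zero_class (fixed_alg x)"
      unfolding C_def iso_class_eq_zero_iff[OF fd] by (rule False)
    have "rep_iso map_alg free_scale free_scale (V, \<rho>' \<circ> ev x) (V, \<rho>)"
      by (rule rep_iso_of_eq) (simp add: factor)
    then have D: "pullback_class map_alg (ev x) C = D"
      unfolding C_def r(2) pullback_class_iso_class[OF ev_hom[OF x] fd]
        iso_class_eq_iff[OF fin_dim_rep_pullback[OF ev_hom[OF x] fd] irr_reps_fin_dim[OF r(1)]] .
    let ?\<psi> = "orbit_function x C"
    have \<psi>: "?\<psi> \<in> E_single" by (rule orbit_function_E_single[OF x C])
    have "\<one>\<^bsub>G\<^esub> \<in> stabilizer G act_X x" by (simp add: stabilizer_def)
    then have \<psi>x: "snd (?\<psi> x) = C"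
      using orbit_function_orbit[OF x C G.one_closed] transport_stabilizer[OF _ C] by simp
    then have "x \<in> Supp ?\<psi>" using x C0 by (simp add: Supp_iff[OF \<psi>])
    then have "ev_class ?\<psi> = D" using ev_class_eq[OF \<psi>] \<psi>x D by simp
    then show ?thesis using \<psi> by blast
  qed
qed

lemma bij_betw_ev_class: "bij_betw ev_class E_single (irr_classes map_alg)"
  unfolding bij_betw_def using inj_on_ev_class ev_class_irr ev_class_surj by blast

end

theorem corollary2p2:
  fixes scale_A :: "'k::alg_closed_field \<Rightarrow> 'x::{comm_ring, comm_monoid_mult} \<Rightarrow> 'x"
    and scale_\<aa> :: "'k \<Rightarrow> 'a::{ring, monoid_mult} \<Rightarrow> 'a"
    and G :: "('g, 'm) monoid_scheme"
    and act_A :: "'g \<Rightarrow> 'x \<Rightarrow> 'x"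
    and act_\<aa> :: "'g \<Rightarrow> 'a \<Rightarrow> 'a"
  assumes "equivariant_map_data scale_A scale_\<aa> G act_A act_\<aa>"
  shows "bij_betw (equivariant_map_data.ev_class scale_A scale_\<aa> G act_A act_\<aa>)
           (equivariant_map_data.E_single scale_A scale_\<aa> G act_A act_\<aa>)
           (irr_classes (equivariant_map_data.map_alg scale_A scale_\<aa> G act_A act_\<aa>))"
  using assms by (rule equivariant_map_data.bij_betw_ev_class)

end
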